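(* Let $\mathcal{P}$ be a probability distribution on a data space $\mathcal{Z}$, let $S=\{z_1,\dots,z_n\}$ consist of $n$ i.i.d. draws from $\mathcal{P}$, let $\mathcal{W},\mathcal{V}\subseteq\mathbb{R}^p$ be nonempty closed convex sets, and let $\ell:\mathcal{W}\times\mathcal{V}\times\mathcal{Z}\to\mathbb{R}$ be differentiable in $(\mathbf{w},\mathbf{v})$ and satisfy: (i) for some $\rho>0$, $\ell(\cdot,\mathbf{v};z)$ is $\rho$-strongly convex and $\ell(\mathbf{w},\cdot;z)$ is $\rho$-strongly concave for all $\mathbf{w},\mathbf{v},z$; (ii) $\|\nabla_{\mathbf{w}}\ell\|_2\le G$ and $\|\nabla_{\mathbf{v}}\ell\|_2\le G$ everywhere; (iii) for some $\beta>0$, each of $\nabla_{\mathbf{w}}\ell(\cdot,\cdot;z)$ and $\nabla_{\mathbf{v}}\ell(\cdot,\cdot;z)$ is $\beta$-Lipschitz in $\mathbf{w}$ (for fixed $\mathbf{v}$) and in $\mathbf{v}$ (for fixed $\mathbf{w}$) with respect to $\|\cdot\|_2$; (iv) $0\le\ell\le M_\ell$. Let $\mathcal{A}:\mathcal{Z}^n\to\mathcal{W}\times\mathcal{V}$ be $\gamma$-argument stable. Then for all $\iota\in(0,1)$ and $\zeta\in(0,1)$, with probability at least $1-\zeta$ over $S$, $$R(\mathcal{A}_{\mathbf{w}}(S))-\frac{1+\iota}{1-\iota}\inf_{\mathbf{w}\in\mathcal{W}}R(\mathbf{w})\le\sqrt{\frac{(1+\beta/\rho)^2G^2\gamma^2(1+64n\log(6/\zeta))}{2(1-\iota)^2n}\log\Big(\frac6\zeta\Big)}+\sqrt{\frac{G^2\gamma^2+64G^2n\gamma^2\log(6/\zeta)}{2(1-\iota)^2n}\log\Big(\frac6\zeta\Big)}$$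 $$+\frac{50\sqrt2(1+e+\beta/\rho)G\gamma\log(n)}{1-\iota}\log\Big(\frac{6e}\zeta\Big)+\frac{(24+4\iota)M_\ell}{3\iota(1-\iota)n}\log\Big(\frac6\zeta\Big)+\frac1{1-\iota}\triangle_S^s(\mathcal{A}_{\mathbf{w}}(S),\mathcal{A}_{\mathbf{v}}(S)).$$
   Context: $L(\mathbf{w},\mathbf{v})=\mathbb{E}_{z\sim\mathcal{P}}[\ell(\mathbf{w},\mathbf{v};z)]$, $L_S(\mathbf{w},\mathbf{v})=\frac1n\sum_{i=1}^n\ell(\mathbf{w},\mathbf{v};z_i)$, $R(\mathbf{w})=\sup_{\mathbf{v}\in\mathcal{V}}L(\mathbf{w},\mathbf{v})$. Strong primal-dual empirical risk: $\triangle_S^s(\mathbf{w},\mathbf{v})=\sup_{\mathbf{v}'\in\mathcal{V}}L_S(\mathbf{w},\mathbf{v}')-\inf_{\mathbf{w}'\in\mathcal{W}}L_S(\mathbf{w}',\mathbf{v})$. A differentiable $f$ is $\rho$-strongly convex if $f(\mathbf{x})-f(\mathbf{x}')\ge\langle\nabla f(\mathbf{x}'),\mathbf{x}-\mathbf{x}'\rangle+\frac\rho2\|\mathbf{x}-\mathbf{x}'\|_2^2$; strongly concave means the negative is strongly convex. $\mathcal{A}(S)=(\mathcal{A}_{\mathbf{w}}(S),\mathcal{A}_{\mathbf{v}}(S))$ is $\gamma$-argument stable if for all $S,S'\in\mathcal{Z}^n$ differing in at most one element, $\|\mathcal{A}_{\mathbf{w}}(S)-\mathcal{A}_{\mathbf{w}}(S')\|_2+\|\mathcal{A}_{\mathbf{v}}(S)-\mathcal{A}_{\mathbf{v}}(S')\|_2\le\gamma$.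 (The paper denotes the smoothness constant by $L$; here it is $\beta$.) *)

theory Defs
  imports "HOL-Probability.Probability"
begin

definition emp_loss :: "('a \<Rightarrow> 'b \<Rightarrow> 'z \<Rightarrow> real) \<Rightarrow> nat \<Rightarrow> (nat \<Rightarrow> 'z) \<Rightarrow> 'a \<Rightarrow> 'b \<Rightarrow> real" where
  "emp_loss l n S w v = (\<Sum>i<n. l w v (S i)) / real n"

definition pop_loss :: "'z measure \<Rightarrow> ('a \<Rightarrow> 'b \<Rightarrow> 'z \<Rightarrow> real) \<Rightarrow> 'a \<Rightarrow> 'b \<Rightarrow> real" where
  "pop_loss P l w v = (\<integral>z. l w v z \<partial>P)"

definition pop_risk :: "'z measure \<Rightarrow> ('a \<Rightarrow> 'b \<Rightarrow> 'z \<Rightarrow> real) \<Rightarrow> 'b set \<Rightarrow> 'a \<Rightarrow> real" where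
  "pop_risk P l V w = (SUP v\<in>V. pop_loss P l w v)"

definition strong_pd_emp_risk ::
  "('a \<Rightarrow> 'b \<Rightarrow> 'z \<Rightarrow> real) \<Rightarrow> nat \<Rightarrow> (nat \<Rightarrow> 'z) \<Rightarrow> 'a set \<Rightarrow> 'b set \<Rightarrow> 'a \<Rightarrow> 'b \<Rightarrow> real" where
  "strong_pd_emp_risk l n S W V w v =
     (SUP v'\<in>V. emp_loss l n S w v') - (INF w'\<in>W. emp_loss l n S w' v)"

definition strongly_convex_on_grad :: "'a::real_inner set \<Rightarrow> ('a \<Rightarrow> real) \<Rightarrow> ('a \<Rightarrow> 'a) \<Rightarrow> real \<Rightarrow> bool" where
  "strongly_convex_on_grad C f f' \<rho> \<longleftrightarrow>
     (\<forall>x\<in>C. \<forall>x'\<in>C. f x - f x' \<ge> f' x' \<bullet> (x - x') + \<rho> / 2 * (norm (x - x'))\<^sup>2)"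

definition argument_stable ::
  "'z set \<Rightarrow> nat \<Rightarrow> ((nat \<Rightarrow> 'z) \<Rightarrow> 'a::real_normed_vector \<times> 'b::real_normed_vector) \<Rightarrow> real \<Rightarrow> bool" where
  "argument_stable Z n A \<gamma> \<longleftrightarrow>
     (\<forall>S\<in>PiE {..<n} (\<lambda>_. Z). \<forall>S'\<in>PiE {..<n} (\<lambda>_. Z).
        card {i\<in>{..<n}. S i \<noteq> S' i} \<le> 1 \<longrightarrow>
        norm (fst (A S) - fst (A S')) + norm (snd (A S) - snd (A S')) \<le> \<gamma>)"

end

theory Submission
  imports Defs
begin

text \<open>
  Since the loss is bounded and strongly convex-concave, \<open>W\<close> and \<open>V\<close> are compact, a minimiser \<open>w\<^sup>*\<close> of
  the primal risk exists, and the best response \<open>v\<^sup>*(w)\<close> is well defined and \<open>\<beta>/\<rho>\<close>-Lipschitz. Then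
  \[ R(A_w) - R(w^*) \le [L - L_S](A_w, v^*(A_w)) + \triangle_S^s + [L_S - L](w^*, A_v), \]
  and both brackets are generalization gaps of predictors \<open>f(S; z)\<close> that move by at most
  \<open>(1 + \<beta>/\<rho>) G \<gamma>\<close> and \<open>G \<gamma>\<close> when one example changes.

  Up to \<open>2 a n\<close>, the gap of an \<open>a\<close>-stable predictor times \<open>n\<close> is \<open>\<Sum>\<^sub>i g\<^sub>i(S)\<close>, where \<open>g\<^sub>i\<close> is centred in
  coordinate \<open>i\<close> and moves by at most \<open>2 a\<close> in the others. Following Bousquet, Klochkov and Zhivotovskiy,
  average \<open>g\<^sub>i\<close> over the other members of the dyadic block of \<open>i\<close>, for growing blocks. Each of the
  \<open>O(log n)\<close> increments is, within a block, a sum of conditionally independent centred terms that are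
  themselves subgaussian by McDiarmid; this is carried out with exponential moments instead of
  \<open>L\<^sup>p\<close>-norms. What remains is an i.i.d. sum of \<open>\<mu> - \<phi>(z\<^sub>i)\<close> with \<open>\<phi> = E\<^sub>S f(S; \<cdot>)\<close>, to which Bernstein's
  inequality applies; the \<open>L\<^sup>2\<close>-norm of \<open>\<phi>\<close> is replaced by that of \<open>f(S; \<cdot>)\<close> because the latter is again
  a function of \<open>S\<close> with differences at most \<open>a\<close>. Finally \<open>0 \<le> \<ell> \<le> M\<close> bounds the squared norm by \<open>M\<close>
  times the mean, and AM-GM trades it for the factors \<open>1 \<plusminus> \<iota>\<close>.
\<close>

subsection \<open>Bounded measurable functions and exponential moments\<close>

text \<open>The bound is demanded at every point of the space rather than almost everywhere, so it
  survives passing to any section of a function on a product space.\<close>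

definition bdd_meas :: "'a measure \<Rightarrow> ('a \<Rightarrow> real) \<Rightarrow> bool" where
  "bdd_meas M f \<longleftrightarrow> f \<in> borel_measurable M \<and> (\<exists>b. \<forall>x\<in>space M. \<bar>f x\<bar> \<le> b)"

lemma bdd_measI: "f \<in> borel_measurable M \<Longrightarrow> (\<And>x. x \<in> space M \<Longrightarrow> \<bar>f x\<bar> \<le> b) \<Longrightarrow> bdd_meas M f"
  by (auto simp: bdd_meas_def)

lemma bdd_meas_measurable [measurable_dest]: "bdd_meas M f \<Longrightarrow> f \<in> borel_measurable M"
  by (simp add: bdd_meas_def)

lemma bdd_meas_bound:
  assumes "bdd_meas M f" obtains b where "b \<ge> 0" "\<And>x. x \<in> space M \<Longrightarrow> \<bar>f x\<bar> \<le> b"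
proof -
  from assms obtain b where "\<And>x. x \<in> space M \<Longrightarrow> \<bar>f x\<bar> \<le> b" by (auto simp: bdd_meas_def)
  then show ?thesis by (intro that[of "max b 0"]) fastforce+
qed

lemma bdd_meas_integrable: "finite_measure M \<Longrightarrow> bdd_meas M f \<Longrightarrow> integrable M f"
  by (auto simp: bdd_meas_def intro!: finite_measure.integrable_const_bound AE_I2)

lemma bdd_meas_const [intro]: "bdd_meas M (\<lambda>x. c)"
  by (auto simp: bdd_meas_def)

lemma bdd_meas_add [intro]:
  assumes f: "bdd_meas M f" and g: "bdd_meas M g" shows "bdd_meas M (\<lambda>x. f x + g x)"
proof -
  obtain a b where "\<And>x. x \<in> space M \<Longrightarrow> \<bar>f x\<bar> \<le> a" "\<And>x. x \<in> space M \<Longrightarrow> \<bar>g x\<bar> \<le> b"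
    using bdd_meas_bound[OF f] bdd_meas_bound[OF g] by metis
  then show ?thesis
    using f g by (intro bdd_measI[where b = "a + b"]) (auto intro: order_trans[OF abs_triangle_ineq] add_mono dest: bdd_meas_measurable)
qed

lemma bdd_meas_mult [intro]:
  assumes f: "bdd_meas M f" and g: "bdd_meas M g" shows "bdd_meas M (\<lambda>x. f x * g x)"
proof -
  obtain a where a: "\<And>x. x \<in> space M \<Longrightarrow> \<bar>f x\<bar> \<le> a" "a \<ge> 0"
    using bdd_meas_bound[OF f] by metis
  obtain b where "\<And>x. x \<in> space M \<Longrightarrow> \<bar>g x\<bar> \<le> b" "b \<ge> 0"
    using bdd_meas_bound[OF g] by metis
  then show ?thesis
    using f g a by (intro bdd_measI[where b = "a * b"]) (auto simp: abs_mult intro: mult_mono dest: bdd_meas_measurable)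
qed

lemma bdd_meas_uminus [intro]: "bdd_meas M f \<Longrightarrow> bdd_meas M (\<lambda>x. - f x)"
  using bdd_meas_mult[OF bdd_meas_const[of M "-1"]] by force

lemma bdd_meas_diff [intro]: "bdd_meas M f \<Longrightarrow> bdd_meas M g \<Longrightarrow> bdd_meas M (\<lambda>x. f x - g x)"
  using bdd_meas_add[OF _ bdd_meas_uminus] by force

lemma bdd_meas_sum [intro]: "(\<And>i. i \<in> A \<Longrightarrow> bdd_meas M (f i)) \<Longrightarrow> bdd_meas M (\<lambda>x. \<Sum>i\<in>A. f i x)"
  by (induction A rule: infinite_finite_induct) auto

lemma bdd_meas_power [intro]: "bdd_meas M f \<Longrightarrow> bdd_meas M (\<lambda>x. f x ^ n)"
  by (induction n) auto

lemma bdd_meas_exp [intro]: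
  assumes f: "bdd_meas M f" shows "bdd_meas M (\<lambda>x. exp (f x))"
proof -
  obtain a where a: "\<And>x. x \<in> space M \<Longrightarrow> \<bar>f x\<bar> \<le> a"
    using bdd_meas_bound[OF f] by metis
  show ?thesis
    using f a by (intro bdd_measI[where b = "exp a"]) (force dest: bdd_meas_measurable)+
qed

lemma bdd_meas_sqrt [intro]:
  assumes f: "bdd_meas M f" shows "bdd_meas M (\<lambda>x. sqrt (f x))"
proof -
  obtain a where a: "\<And>x. x \<in> space M \<Longrightarrow> \<bar>f x\<bar> \<le> a"
    using bdd_meas_bound[OF f] by metis
  have "\<bar>sqrt (f x)\<bar> \<le> sqrt a" if "x \<in> space M" for x
  proof -
    \<comment> \<open>\<open>sqrt\<close> is odd on the reals, so the modulus passes inside it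
      whatever the sign of \<open>f x\<close>.\<close>
    have "\<bar>sqrt (f x)\<bar> = sqrt \<bar>f x\<bar>" by (cases "f x \<ge> 0") (auto simp: real_sqrt_minus)
    then show ?thesis using a[OF that] by simp
  qed
  with f show ?thesis
    by (intro bdd_measI[where b = "sqrt a"]) (auto dest: bdd_meas_measurable)
qed

lemma bdd_meas_compose:
  assumes f: "bdd_meas N f" and g [measurable]: "g \<in> measurable M N" shows "bdd_meas M (\<lambda>x. f (g x))"
proof -
  obtain a where "\<And>x. x \<in> space N \<Longrightarrow> \<bar>f x\<bar> \<le> a"
    using bdd_meas_bound[OF f] by metis
  with f measurable_space[OF g] show ?thesis
    by (intro bdd_measI[where b = a]) (auto intro!: measurable_compose[OF g] dest: bdd_meas_measurable)
qed

lemmas bdd_meas_intros = bdd_meas_const bdd_meas_sum bdd_meas_add bdd_meas_diff bdd_meas_uminus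
  bdd_meas_mult bdd_meas_power bdd_meas_exp bdd_meas_sqrt

section \<open>Expectations of bounded functions and Fubini's theorem\<close>

lemma (in prob_space) bdd_integral_le:
  assumes f: "bdd_meas M f" and le: "\<And>x. x \<in> space M \<Longrightarrow> f x \<le> b" shows "(\<integral>x. f x \<partial>M) \<le> b"
  using integral_le_const[OF bdd_meas_integrable[OF _ f]] le by (auto intro: AE_I2 simp: finite_measure_axioms)

lemma (in prob_space) bdd_integral_ge:
  assumes f: "bdd_meas M f" and le: "\<And>x. x \<in> space M \<Longrightarrow> b \<le> f x" shows "b \<le> (\<integral>x. f x \<partial>M)"
  using integral_ge_const[OF bdd_meas_integrable[OF _ f]] le by (auto intro: AE_I2 simp: finite_measure_axioms)

lemma (in prob_space) bdd_integral_abs_le: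
  assumes f: "bdd_meas M f" and le: "\<And>x. x \<in> space M \<Longrightarrow> \<bar>f x\<bar> \<le> b" shows "\<bar>\<integral>x. f x \<partial>M\<bar> \<le> b"
proof -
  have "f x \<le> b" "- b \<le> f x" if "x \<in> space M" for x using le[OF that] by auto
  then show ?thesis using bdd_integral_le[OF f, of b] bdd_integral_ge[OF f, of "-b"] by auto
qed

lemma (in prob_space) bdd_integral_diff_abs_le:
  assumes f: "bdd_meas M f" and g: "bdd_meas M g" and le: "\<And>x. x \<in> space M \<Longrightarrow> \<bar>f x - g x\<bar> \<le> b"
  shows "\<bar>(\<integral>x. f x \<partial>M) - (\<integral>x. g x \<partial>M)\<bar> \<le> b"
  using bdd_integral_abs_le[OF bdd_meas_diff[OF f g] le]
    Bochner_Integration.integral_diff[OF bdd_meas_integrable[OF _ f] bdd_meas_integrable[OF _ g]]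
  by (simp add: finite_measure_axioms)

lemma bdd_integral_mono:
  assumes "finite_measure M" "bdd_meas M f" "bdd_meas M g" "\<And>x. x \<in> space M \<Longrightarrow> f x \<le> g x"
  shows "(\<integral>x. f x \<partial>M) \<le> (\<integral>x. g x \<partial>M)"
  using assms by (intro integral_mono bdd_meas_integrable) auto

lemma bdd_meas_integral:
  assumes N: "prob_space N" and f: "bdd_meas (M \<Otimes>\<^sub>M N) (case_prod f)"
  shows "bdd_meas M (\<lambda>x. \<integral>y. f x y \<partial>N)"
proof -
  interpret N: prob_space N by fact
  obtain b where b: "\<And>x. x \<in> space (M \<Otimes>\<^sub>M N) \<Longrightarrow> \<bar>case_prod f x\<bar> \<le> b"
    using bdd_meas_bound[OF f] by metis
  have [measurable]: "case_prod f \<in> borel_measurable (M \<Otimes>\<^sub>M N)"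
    using f by (rule bdd_meas_measurable)
  show ?thesis
  proof (intro bdd_measI[where b = b])
    fix x assume x: "x \<in> space M"
    then have "bdd_meas N (f x)"
      using bdd_meas_compose[OF f, of "Pair x" N] by simp
    then show "\<bar>\<integral>y. f x y \<partial>N\<bar> \<le> b"
      using b x by (intro N.bdd_integral_abs_le) (auto simp: space_pair_measure)
  qed measurable
qed

lemma bdd_meas_Pair:
  assumes f: "bdd_meas (M \<Otimes>\<^sub>M N) (case_prod f)" and x: "x \<in> space M"
  shows "bdd_meas N (f x)"
  using bdd_meas_compose[OF f, of "Pair x" N] x by simp

lemma bdd_Fubini:
  assumes M: "prob_space M" and N: "prob_space N" and f: "bdd_meas (M \<Otimes>\<^sub>M N) (case_prod f)"
  shows "(\<integral>y. (\<integral>x. f x y \<partial>M) \<partial>N) = (\<integral>x. (\<integral>y. f x y \<partial>N) \<partial>M)"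
proof -
  interpret M: prob_space M by fact
  interpret N: prob_space N by fact
  interpret pair_prob_space M N ..
  show ?thesis
    by (intro Fubini_integral bdd_meas_integrable f) (rule finite_measure_axioms)
qed

section \<open>Exponential inequalities and moment generating functions\<close>

lemma exp_le_quadratic:
  fixes u :: real assumes "u \<le> 1" shows "exp u \<le> 1 + u + u\<^sup>2"
proof (cases "u \<ge> 0")
  case True
  then show ?thesis using exp_bound[of u] assms by simp
next
  case False
  define y where "y = - u"
  have y: "y \<ge> 0" using False by (simp add: y_def)
  \<comment> \<open>In terms of \<open>y\<close> the claim is
    \<open>1 \<le> (1 - y + y\<^sup>2) * exp y\<close>. The quadratic Taylor minorant of
    \<open>exp y\<close> is enough: multiplied out, the product exceeds 1 by exactly this
    half-sum.\<close>
  have "0 \<le> (y\<^sup>2 + y ^ 3 + y ^ 4) / 2" using y by simp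
  then have "1 \<le> (1 - y + y\<^sup>2) * (1 + y + y\<^sup>2 / 2)"
    by (simp add: algebra_simps power2_eq_square power3_eq_cube power4_eq_xxxx field_simps)
  also have "\<dots> \<le> (1 - y + y\<^sup>2) * exp y"
  proof (rule mult_left_mono)
    show "1 + y + y\<^sup>2 / 2 \<le> exp y" using exp_lower_Taylor_quadratic[OF y] .
    have "0 \<le> (1 - y / 2)\<^sup>2 + 3 / 4 * y\<^sup>2" by simp
    then show "0 \<le> 1 - y + y\<^sup>2" by (simp add: power2_eq_square algebra_simps)
  qed
  finally have "exp (- y) \<le> 1 - y + y\<^sup>2"
    by (simp add: exp_minus field_simps)
  then show ?thesis by (simp add: y_def)
qed

text \<open>For a centred variable X the linear term integrates to zero, so E exp X is at most E exp
  (X^2): this is how centring becomes a quadratic exponent.\<close>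

lemma exp_le_add_exp_sq: "exp (x::real) \<le> x + exp (x\<^sup>2)"
proof (cases "x \<le> 1")
  case True
  have "1 + x\<^sup>2 \<le> exp (x\<^sup>2)" by (rule exp_ge_add_one_self)
  with exp_le_quadratic[OF True] show ?thesis by linarith
next
  case False
  then have "x \<le> x\<^sup>2" by (simp add: power2_eq_square)
  then have "exp x \<le> exp (x\<^sup>2)" by simp
  with False show ?thesis by linarith
qed

text \<open>Phrased through the oscillation, since a bounded-difference condition controls the
  distance of two values but names no interval. The infimum and supremum of \<open>f\<close> provide
  the interval, and negative \<open>t\<close> is reduced to positive \<open>t\<close> through
  \<open>- f\<close>.\<close>

lemma (in prob_space) Hoeffding_mgf:
  assumes f: "bdd_meas M f" and osc: "\<And>x y. x \<in> space M \<Longrightarrow> y \<in> space M \<Longrightarrow> \<bar>f x - f y\<bar> \<le> c"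
  shows "(\<integral>x. exp (t * (f x - (\<integral>y. f y \<partial>M))) \<partial>M) \<le> exp (t\<^sup>2 * c\<^sup>2 / 8)"
proof -
  have pos: "(\<integral>x. exp (t * (g x - (\<integral>y. g y \<partial>M))) \<partial>M) \<le> exp (t\<^sup>2 * c\<^sup>2 / 8)"
    if g: "bdd_meas M g" and o: "\<And>x y. x \<in> space M \<Longrightarrow> y \<in> space M \<Longrightarrow> \<bar>g x - g y\<bar> \<le> c"
      and t: "t > 0" for g t
  proof -
    define a where "a = Inf (g ` space M)"
    define b where "b = Sup (g ` space M)"
    have ne: "g ` space M \<noteq> {}" using not_empty by simp
    obtain B where "\<And>x. x \<in> space M \<Longrightarrow> \<bar>g x\<bar> \<le> B" using bdd_meas_bound[OF g] by metis
    then have bdd: "bdd_above (g ` space M)" "bdd_below (g ` space M)"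
      by (auto intro!: bdd_aboveI2[where M = B] bdd_belowI2[where m = "-B"] simp: abs_le_iff minus_le_iff)
    have ab: "a \<le> g x" "g x \<le> b" if "x \<in> space M" for x
      unfolding a_def b_def using bdd that by (auto intro: cINF_lower cSUP_upper)
    have le: "g x \<le> a + c" if x: "x \<in> space M" for x
    proof -
      have "g x - c \<le> a"
        unfolding a_def using o[OF x] by (intro cINF_greatest not_empty) (force simp: abs_le_iff)
      then show ?thesis by simp
    qed
    have "b \<le> a + c" unfolding b_def by (intro cSUP_least not_empty le)
    moreover have "a \<le> b" using ab not_empty by force
    ultimately have bac: "(b - a)\<^sup>2 \<le> c\<^sup>2" by (intro power_mono) auto
    interpret g: interval_bounded_random_variable M g a b
      using ab g by unfold_locales (auto dest: bdd_meas_measurable)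
    have "(\<integral>\<^sup>+x. ennreal (exp (t * (g x - (\<integral>y. g y \<partial>M)))) \<partial>M) \<le> ennreal (exp (t\<^sup>2 * (b - a)\<^sup>2 / 8))"
      using g.Hoeffdings_lemma_nn_integral[OF t] by simp
    also have "\<dots> \<le> ennreal (exp (t\<^sup>2 * c\<^sup>2 / 8))"
      using bac by (intro ennreal_leI) (auto intro!: mult_left_mono)
    finally show ?thesis by (intro integral_real_bounded) auto
  qed
  consider "t > 0" | "t = 0" | "t < 0" by linarith
  then show ?thesis
  proof cases
    case 1 then show ?thesis using pos[OF f osc] by blast
  next
    case 2 then show ?thesis by (simp add: prob_space)
  next
    case 3
    have "(\<integral>x. exp (- t * (- f x - (\<integral>y. - f y \<partial>M))) \<partial>M) \<le> exp ((- t)\<^sup>2 * c\<^sup>2 / 8)"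
      using 3 osc by (intro pos bdd_meas_uminus f) (auto simp: abs_minus_commute)
    then show ?thesis by (simp add: algebra_simps)
  qed
qed

text \<open>Linearise the square: \<open>exp (s y\<^sup>2)\<close> is the expectation of \<open>exp (sqrt (2 s) g y)\<close> for a
  standard Gaussian \<open>g\<close>.\<close>

lemma (in prob_space) subgaussian_exp_square:
  assumes Y: "bdd_meas M Y" and sub: "\<And>t. (\<integral>x. exp (t * Y x) \<partial>M) \<le> exp (t\<^sup>2 * \<tau> / 2)"
    and s: "s \<ge> 0" "2 * s * \<tau> \<le> 1/2"
  shows "(\<integral>x. exp (s * (Y x)\<^sup>2) \<partial>M) \<le> sqrt 2"
proof -
  define t where "t = sqrt (2 * s)"
  have t2: "t\<^sup>2 = 2 * s" using s by (simp add: t_def)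
  have [measurable]: "Y \<in> borel_measurable M" using Y by (rule bdd_meas_measurable)
  interpret pair_sigma_finite M lborel ..
  \<comment> \<open>Completing the square with \<open>t\<^sup>2 = 2 * s\<close> turns the tilted
    standard density into \<open>exp (s * y\<^sup>2)\<close> times the normal density with mean
    \<open>t * y\<close>, which integrates to one.\<close>
  have lin: "ennreal (exp (s * y\<^sup>2)) = (\<integral>\<^sup>+g. ennreal (exp (t * g * y) * normal_density 0 1 g) \<partial>lborel)" for y
  proof -
    have "exp (t * g * y) * normal_density 0 1 g = exp (s * y\<^sup>2) * normal_density (t * y) 1 g" for g
    proof -
      have "t * g * y - g\<^sup>2 / 2 = s * y\<^sup>2 - (g - t * y)\<^sup>2 / 2"
        using t2 by (simp add: power2_diff power_mult_distrib field_simps)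
      then have "exp (t * g * y) * exp (- (g\<^sup>2) / 2) = exp (s * y\<^sup>2) * exp (- ((g - t * y)\<^sup>2) / 2)"
        by (simp add: exp_add[symmetric] )
      then show ?thesis by (simp add: normal_density_def)
    qed
    then have "(\<integral>\<^sup>+g. ennreal (exp (t * g * y) * normal_density 0 1 g) \<partial>lborel)
       = (\<integral>\<^sup>+g. ennreal (exp (s * y\<^sup>2)) * ennreal (normal_density (t * y) 1 g) \<partial>lborel)"
      by (simp add: ennreal_mult)
    also have "\<dots> = ennreal (exp (s * y\<^sup>2)) * (\<integral>\<^sup>+g. ennreal (normal_density (t * y) 1 g) \<partial>lborel)"
      by (intro nn_integral_cmult) auto
    also have "(\<integral>\<^sup>+g. ennreal (normal_density (t * y) 1 g) \<partial>lborel) = 1"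
      by (subst nn_integral_eq_integral) auto
    finally show ?thesis by simp
  qed
  have inner: "(\<integral>\<^sup>+x. ennreal (exp (t * g * Y x) * normal_density 0 1 g) \<partial>M)
      \<le> ennreal (sqrt 2 * normal_density 0 (sqrt 2) g)" for g
  proof -
    have i: "integrable M (\<lambda>x. exp (t * g * Y x) * normal_density 0 1 g)"
      by (intro bdd_meas_integrable bdd_meas_mult bdd_meas_exp bdd_meas_const Y) (rule finite_measure_axioms)
    \<comment> \<open>The bound \<open>2 * s * \<tau> \<le> 1/2\<close> leaves the factor
      \<open>exp (g\<^sup>2 / 4)\<close>, which halves the Gaussian exponent. What remains is
      \<open>sqrt 2\<close> times a density of variance 2, hence the constant
      \<open>sqrt 2\<close>.\<close>
    have eq: "exp (g\<^sup>2 / 4) * normal_density 0 1 g = sqrt 2 * normal_density 0 (sqrt 2) g"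
      by (simp add: normal_density_def real_sqrt_mult field_simps exp_add[symmetric])
    have "(\<integral>x. exp (t * g * Y x) * normal_density 0 1 g \<partial>M) \<le> exp ((t * g)\<^sup>2 * \<tau> / 2) * normal_density 0 1 g"
      using sub[of "t * g"] by (auto intro!: mult_right_mono)
    also have "(t * g)\<^sup>2 * \<tau> / 2 = g\<^sup>2 * (2 * s * \<tau>) / 2"
      by (simp add: power_mult_distrib t2)
    also have "exp (g\<^sup>2 * (2 * s * \<tau>) / 2) * normal_density 0 1 g \<le> exp (g\<^sup>2 / 4) * normal_density 0 1 g"
      using mult_left_mono[OF s(2), of "g\<^sup>2"] by (intro mult_right_mono) auto
    also note eq
    finally show ?thesis
      by (subst nn_integral_eq_integral[OF i]) (auto intro: ennreal_leI)
  qed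
  have "(\<integral>\<^sup>+x. ennreal (exp (s * (Y x)\<^sup>2)) \<partial>M)
     = (\<integral>\<^sup>+x. \<integral>\<^sup>+g. ennreal (exp (t * g * Y x) * normal_density 0 1 g) \<partial>lborel \<partial>M)"
    by (simp only: lin)
  also have "\<dots> = (\<integral>\<^sup>+g. \<integral>\<^sup>+x. ennreal (exp (t * g * Y x) * normal_density 0 1 g) \<partial>M \<partial>lborel)"
    by (rule Fubini'[symmetric]) measurable
  also have "\<dots> \<le> (\<integral>\<^sup>+g. ennreal (sqrt 2 * normal_density 0 (sqrt 2) g) \<partial>lborel)"
    by (intro nn_integral_mono inner)
  also have "\<dots> = ennreal (sqrt 2)"
    by (subst nn_integral_eq_integral) auto
  finally show ?thesis by (intro integral_real_bounded) auto
qed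

text \<open>Markov's inequality for \<open>exp (l * Z)\<close> at level \<open>exp (s + u)\<close>.
  In this form \<open>u\<close> measures the failure probability directly, and each tail bound below
  only has to choose \<open>l\<close>.\<close>

lemma (in prob_space) chernoff_event:
  assumes Z: "bdd_meas M Z" and l: "l > 0" and mgf: "(\<integral>x. exp (l * Z x) \<partial>M) \<le> exp s"
  shows "measure M {x \<in> space M. Z x \<le> (s + u) / l} \<ge> 1 - exp (- u)"
proof -
  have [measurable]: "Z \<in> borel_measurable M" using Z by (rule bdd_meas_measurable)
  have "bdd_meas M (\<lambda>x. exp (l * Z x))" by (intro bdd_meas_exp bdd_meas_mult bdd_meas_const Z)
  then have i: "integrable M (\<lambda>x. exp (l * Z x))"
    by (rule bdd_meas_integrable[rotated]) (rule finite_measure_axioms)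
  have "{x \<in> space M. \<not> Z x \<le> (s + u) / l} \<subseteq> {x \<in> space M. exp (l * Z x) \<ge> exp (s + u)}"
    using l by (auto simp: field_simps)
  then have "measure M {x \<in> space M. \<not> Z x \<le> (s + u) / l} \<le> measure M {x \<in> space M. exp (l * Z x) \<ge> exp (s + u)}"
    by (intro finite_measure_mono) auto
  also have "\<dots> \<le> (\<integral>x. exp (l * Z x) \<partial>M) / exp (s + u)"
    by (rule integral_Markov_inequality_measure[OF i, where A = "{}"]) auto
  also have "\<dots> \<le> exp s / exp (s + u)" using mgf by (intro divide_right_mono) auto
  also have "\<dots> = exp (- u)" by (simp add: exp_add exp_minus field_simps)
  finally show ?thesis
    by (subst (asm) prob_neg) auto
qed

subsection \<open>Resampling coordinates of an i.i.d. sample\<close>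

text \<open>Induction on the index set. With the other coordinates frozen, Hoeffding's lemma in the
  new coordinate \<open>i\<close> costs the factor with \<open>(c i)\<^sup>2\<close>; the average
  over that coordinate is a function of the remaining ones that keeps the differences
  \<open>c j\<close>, so the induction hypothesis applies to it.\<close>

lemma McDiarmid_mgf:
  fixes P :: "'z measure" and F :: "('i \<Rightarrow> 'z) \<Rightarrow> real"
  assumes ps: "prob_space P" and I: "finite I"
    and F: "bdd_meas (PiM I (\<lambda>_. P)) F"
    and diff: "\<And>S i y. S \<in> space (PiM I (\<lambda>_. P)) \<Longrightarrow> i \<in> I \<Longrightarrow> y \<in> space P \<Longrightarrow> \<bar>F (S(i := y)) - F S\<bar> \<le> c i"
  shows "(\<integral>S. exp (t * (F S - (\<integral>S. F S \<partial>PiM I (\<lambda>_. P)))) \<partial>PiM I (\<lambda>_. P)) \<le> exp (t\<^sup>2 * (\<Sum>i\<in>I. (c i)\<^sup>2) / 8)"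
  using I F diff
proof (induction I arbitrary: F rule: finite_induct)
  case empty
  interpret prob_space "PiM {} (\<lambda>_. P)" by (intro prob_space_PiM ps)
  \<comment> \<open>The empty product space has the single point
    \<open>\<lambda>_. undefined\<close>, so \<open>F\<close> is constant there.\<close>
  have "(\<integral>S. F S \<partial>PiM {} (\<lambda>_. P)) = F (\<lambda>_. undefined)"
    using prob_space by (subst Bochner_Integration.integral_cong[OF refl, of _ _ "\<lambda>_. F (\<lambda>_. undefined)"])
      (auto simp: space_PiM_empty)
  note EF = this
  have "(\<integral>S. exp (t * (F S - (\<integral>S. F S \<partial>PiM {} (\<lambda>_. P)))) \<partial>PiM {} (\<lambda>_. P)) = integral\<^sup>L (PiM {} (\<lambda>_. P) :: ('i \<Rightarrow> 'z) measure) (\<lambda>_. 1)"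
    unfolding EF by (rule Bochner_Integration.integral_cong) (auto simp: space_PiM_empty)
  then show ?case using prob_space by simp
next
  case (insert i I)
  have psI: "prob_space (PiM I (\<lambda>_. P))" and psJ: "prob_space (PiM (insert i I) (\<lambda>_. P))"
    by (auto intro!: prob_space_PiM ps)
  interpret D: prob_space P by fact
  interpret product_prob_space "\<lambda>_. P" I ..
  define F' where "F' = (\<lambda>S. \<integral>y. F (S(i := y)) \<partial>P)"
  let ?I = "PiM I (\<lambda>_. P)" let ?J = "PiM (insert i I) (\<lambda>_. P)"
  from psI psJ have finI: "finite_measure ?I" and finJ: "finite_measure ?J" by (auto intro: prob_space.finite_measure)
  have pair: "bdd_meas (?I \<Otimes>\<^sub>M P) (\<lambda>(S, y). F (S(i := y)))"
    using bdd_meas_compose[OF insert.prems(1), of "\<lambda>(S, y). S(i := y)" "?I \<Otimes>\<^sub>M P"]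
      measurable_add_dim[of i I "\<lambda>_. P"] by (simp add: case_prod_unfold fun_upd_def)
  have upd: "S(i := y) \<in> space ?J" if "S \<in> space ?I" "y \<in> space P" for S y
    using that by (auto simp: space_PiM PiE_def extensional_def)
  have sec: "bdd_meas P (\<lambda>y. F (S(i := y)))" if "S \<in> space ?I" for S
    using bdd_meas_Pair[OF pair that] .
  have F': "bdd_meas ?I F'"
    unfolding F'_def by (rule bdd_meas_integral[OF ps pair])
  have EF: "(\<integral>S. F S \<partial>?J) = (\<integral>S. F' S \<partial>?I)"
    unfolding F'_def
    by (intro product_integral_insert insert bdd_meas_integrable[OF finJ])
  define e where "e = (\<integral>S. F' S \<partial>?I)"
  have e1: "bdd_meas ?J (\<lambda>S. exp (t * (F S - e)))"
    by (intro bdd_meas_intros insert.prems)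
  have e2: "bdd_meas (?I \<Otimes>\<^sub>M P) (\<lambda>(S, y). exp (t * (F (S(i := y)) - e)))"
    using bdd_meas_compose[OF e1, of "\<lambda>(S, y). S(i := y)" "?I \<Otimes>\<^sub>M P"]
      measurable_add_dim[of i I "\<lambda>_. P"] by (simp add: case_prod_unfold fun_upd_def)
  have "(\<integral>S. exp (t * (F S - e)) \<partial>?J) = (\<integral>S. (\<integral>y. exp (t * (F (S(i := y)) - e)) \<partial>P) \<partial>?I)"
    by (intro product_integral_insert insert bdd_meas_integrable[OF finJ] e1)
  also have "\<dots> \<le> (\<integral>S. exp (t * (F' S - e)) * exp (t\<^sup>2 * (c i)\<^sup>2 / 8) \<partial>?I)"
  proof (rule bdd_integral_mono[OF finI])
    show "bdd_meas ?I (\<lambda>S. \<integral>y. exp (t * (F (S(i := y)) - e)) \<partial>P)"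
      by (rule bdd_meas_integral[OF ps e2])
    show "bdd_meas ?I (\<lambda>S. exp (t * (F' S - e)) * exp (t\<^sup>2 * (c i)\<^sup>2 / 8))"
      by (intro bdd_meas_intros F')
    fix S assume S: "S \<in> space ?I"
    have "(\<integral>y. exp (t * (F (S(i := y)) - e)) \<partial>P) = (\<integral>y. exp (t * (F' S - e)) * exp (t * (F (S(i := y)) - F' S)) \<partial>P)"
      by (intro Bochner_Integration.integral_cong) (simp_all add: algebra_simps flip: exp_add)
    also have "\<dots> = exp (t * (F' S - e)) * (\<integral>y. exp (t * (F (S(i := y)) - F' S)) \<partial>P)"
      by simp
    also have "\<dots> \<le> exp (t * (F' S - e)) * exp (t\<^sup>2 * (c i)\<^sup>2 / 8)"
    proof (rule mult_left_mono)
      show "(\<integral>y. exp (t * (F (S(i := y)) - F' S)) \<partial>P) \<le> exp (t\<^sup>2 * (c i)\<^sup>2 / 8)"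
        unfolding F'_def
      proof (rule D.Hoeffding_mgf[OF sec[OF S]])
        fix x y assume "x \<in> space P" "y \<in> space P"
        \<comment> \<open>Two values of coordinate \<open>i\<close> are compared by regarding one
          sample as an update of the other.\<close>
        then have "\<bar>F ((S(i := y))(i := x)) - F (S(i := y))\<bar> \<le> c i"
          by (intro insert.prems(2) upd S) auto
        then show "\<bar>F (S(i := x)) - F (S(i := y))\<bar> \<le> c i"
          by (simp only: fun_upd_upd)
      qed
    qed auto
    finally show "(\<integral>y. exp (t * (F (S(i := y)) - e)) \<partial>P) \<le> exp (t * (F' S - e)) * exp (t\<^sup>2 * (c i)\<^sup>2 / 8)" .
  qed
  also have "\<dots> = (\<integral>S. exp (t * (F' S - e)) \<partial>?I) * exp (t\<^sup>2 * (c i)\<^sup>2 / 8)"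
    by simp
  also have "\<dots> \<le> exp (t\<^sup>2 * (\<Sum>i\<in>I. (c i)\<^sup>2) / 8) * exp (t\<^sup>2 * (c i)\<^sup>2 / 8)"
    unfolding e_def
  proof (intro mult_right_mono insert.IH F')
    fix S j y assume S: "S \<in> space ?I" and j: "j \<in> I" and y: "y \<in> space P"
    have S': "S(j := y) \<in> space ?I" using S j y by (auto simp: space_PiM PiE_def extensional_def)
    show "\<bar>F' (S(j := y)) - F' S\<bar> \<le> c j"
      unfolding F'_def
    proof (rule D.bdd_integral_diff_abs_le[OF sec[OF S'] sec[OF S]])
      fix z assume z: "z \<in> space P"
      have "j \<noteq> i" using j insert by auto
      then have "(S(j := y))(i := z) = (S(i := z))(j := y)" by (rule fun_upd_twist)
      moreover have "\<bar>F ((S(i := z))(j := y)) - F (S(i := z))\<bar> \<le> c j"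
        using j y by (intro insert.prems(2) upd S z) auto
      ultimately show "\<bar>F ((S(j := y))(i := z)) - F (S(i := z))\<bar> \<le> c j"
        by (simp only:)
    qed
  qed auto
  also have "\<dots> = exp (t\<^sup>2 * (\<Sum>i\<in>insert i I. (c i)\<^sup>2) / 8)"
    using insert by (simp add: algebra_simps add_divide_distrib flip: exp_add)
  finally show ?case unfolding EF e_def .
qed

text \<open>With \<open>T\<close> an independent copy of \<open>S\<close> this resamples the
  coordinates in \<open>J\<close>. Both samples live on the full product space, so conditional
  expectations are handled without splitting the product into factors.\<close>

definition mix :: "'i set \<Rightarrow> ('i \<Rightarrow> 'z) \<Rightarrow> ('i \<Rightarrow> 'z) \<Rightarrow> 'i \<Rightarrow> 'z" where
  "mix J S T = (\<lambda>i. if i \<in> J then T i else S i)"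

lemma mix_singleton: "mix {i} S T = S(i := T i)"
  by (auto simp: mix_def)

locale iid_sample = prob_space P for P :: "'z measure" +
  fixes I :: "'i set"
  assumes fin_I: "finite I"
begin

abbreviation "\<Omega> \<equiv> PiM I (\<lambda>_. P)"

text \<open>The conditional expectation of \<open>h\<close> given the coordinates outside
  \<open>J\<close>, realised as a genuine function on the full space that is constant in the
  coordinates of \<open>J\<close>.\<close>

definition avg :: "'i set \<Rightarrow> (('i \<Rightarrow> 'z) \<Rightarrow> real) \<Rightarrow> ('i \<Rightarrow> 'z) \<Rightarrow> real" where
  "avg J h S = (\<integral>T. h (mix J S T) \<partial>\<Omega>)"

lemma prob_space_\<Omega>: "prob_space \<Omega>"
  by (intro prob_space_PiM prob_space_axioms)

lemma finite_measure_\<Omega>: "finite_measure \<Omega>"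
  using prob_space_\<Omega> by (rule prob_space.finite_measure)

lemma mix_in_space: "S \<in> space \<Omega> \<Longrightarrow> T \<in> space \<Omega> \<Longrightarrow> mix J S T \<in> space \<Omega>"
  by (auto simp: space_PiM PiE_def mix_def extensional_def)

lemma update_in_space: "S \<in> space \<Omega> \<Longrightarrow> i \<in> I \<Longrightarrow> y \<in> space P \<Longrightarrow> S(i := y) \<in> space \<Omega>"
  by (auto simp: space_PiM PiE_def extensional_def)

lemma component_in_space: "S \<in> space \<Omega> \<Longrightarrow> i \<in> I \<Longrightarrow> S i \<in> space P"
  by (auto simp: space_PiM)

lemma measurable_mix [measurable]: "(\<lambda>(S, T). mix J S T) \<in> measurable (\<Omega> \<Otimes>\<^sub>M \<Omega>) \<Omega>"
  unfolding mix_def case_prod_unfold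
proof (rule measurable_PiM_single')
  fix i assume "i \<in> I"
  then show "(\<lambda>p. if i \<in> J then snd p i else fst p i) \<in> measurable (\<Omega> \<Otimes>\<^sub>M \<Omega>) P"
    by (cases "i \<in> J") simp_all
qed (auto simp: space_pair_measure space_PiM PiE_def extensional_def)

lemma bdd_meas_mix:
  assumes "bdd_meas \<Omega> h"
  shows "bdd_meas (\<Omega> \<Otimes>\<^sub>M \<Omega>) (\<lambda>(S, T). h (mix J S T))"
  using bdd_meas_compose[OF assms measurable_mix] by (simp add: case_prod_unfold)

lemma bdd_meas_mix2: "bdd_meas \<Omega> h \<Longrightarrow> S \<in> space \<Omega> \<Longrightarrow> bdd_meas \<Omega> (\<lambda>T. h (mix J S T))"
  using bdd_meas_Pair[OF bdd_meas_mix] .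

lemma bdd_meas_avg: "bdd_meas \<Omega> h \<Longrightarrow> bdd_meas \<Omega> (avg J h)"
  unfolding avg_def using bdd_meas_integral[OF prob_space_\<Omega> bdd_meas_mix] by auto

text \<open>The preimage of a box is a product of two boxes. In each coordinate one of the two sides
  is the whole space and the other the given set, so the two products of masses recombine into one,
  and boxes determine the product measure.\<close>

lemma distr_mix: "distr (\<Omega> \<Otimes>\<^sub>M \<Omega>) \<Omega> (\<lambda>(S, T). mix J S T) = \<Omega>"
proof -
  have ps: "prob_space P" by (rule prob_space_axioms)
  interpret product_prob_space "\<lambda>_. P" I ..
  show ?thesis
  proof (rule PiM_eqI)
    fix A :: "'i \<Rightarrow> 'z set" assume A: "\<And>i. i \<in> I \<Longrightarrow> A i \<in> sets P"
    define A1 where "A1 = (\<lambda>i. if i \<in> J then space P else A i)"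
    define A2 where "A2 = (\<lambda>i. if i \<in> J then A i else space P)"
    have sets: "A1 i \<in> sets P" "A2 i \<in> sets P" if "i \<in> I" for i using A[OF that] by (auto simp: A1_def A2_def)
    have sub: "A i \<subseteq> space P" if "i \<in> I" for i using A[OF that] by (rule sets.sets_into_space)
    have eq: "(\<lambda>(S, T). mix J S T) -` Pi\<^sub>E I A \<inter> space (\<Omega> \<Otimes>\<^sub>M \<Omega>) = Pi\<^sub>E I A1 \<times> Pi\<^sub>E I A2"
      using sub by (fastforce simp: space_pair_measure space_PiM PiE_def Pi_def extensional_def mix_def A1_def A2_def split: if_splits)
    have "emeasure (distr (\<Omega> \<Otimes>\<^sub>M \<Omega>) \<Omega> (\<lambda>(S, T). mix J S T)) (Pi\<^sub>E I A) = emeasure (\<Omega> \<Otimes>\<^sub>M \<Omega>) (Pi\<^sub>E I A1 \<times> Pi\<^sub>E I A2)"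
      using A by (subst emeasure_distr) (auto simp: eq fin_I intro!: sets_PiM_I_finite)
    also have "\<dots> = emeasure \<Omega> (Pi\<^sub>E I A1) * emeasure \<Omega> (Pi\<^sub>E I A2)"
      using sets fin_I by (intro sigma_finite_measure.emeasure_pair_measure_Times[OF prob_space_imp_sigma_finite[OF prob_space_\<Omega>]] sets_PiM_I_finite) auto
    also have "\<dots> = (\<Prod>i\<in>I. emeasure P (A1 i)) * (\<Prod>i\<in>I. emeasure P (A2 i))"
      using sets fin_I by (simp add: emeasure_PiM)
    also have "\<dots> = (\<Prod>i\<in>I. emeasure P (A i))"
      unfolding prod.distrib[symmetric] by (intro prod.cong) (auto simp: A1_def A2_def prob_space.emeasure_space_1[OF ps])
    finally show "emeasure (distr (\<Omega> \<Otimes>\<^sub>M \<Omega>) \<Omega> (\<lambda>(S, T). mix J S T)) (Pi\<^sub>E I A) = (\<Prod>i\<in>I. emeasure P (A i))" .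
  qed (simp_all add: fin_I)
qed

text \<open>Tower property: a partially resampled i.i.d. sample has the same distribution as the
  original one.\<close>

lemma integral_mix:
  assumes h: "bdd_meas \<Omega> h"
  shows "(\<integral>S. (\<integral>T. h (mix J S T) \<partial>\<Omega>) \<partial>\<Omega>) = (\<integral>S. h S \<partial>\<Omega>)"
proof -
  interpret O: prob_space \<Omega> by (rule prob_space_\<Omega>)
  interpret pair_prob_space \<Omega> \<Omega> ..
  have "(\<integral>S. (\<integral>T. h (mix J S T) \<partial>\<Omega>) \<partial>\<Omega>) = (\<integral>p. (case p of (S, T) \<Rightarrow> h (mix J S T)) \<partial>(\<Omega> \<Otimes>\<^sub>M \<Omega>))"
    using integral_fst[OF bdd_meas_integrable[OF finite_measure_axioms bdd_meas_mix[OF h]]] by simp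
  also have "\<dots> = (\<integral>p. h ((\<lambda>(S, T). mix J S T) p) \<partial>(\<Omega> \<Otimes>\<^sub>M \<Omega>))"
    by (simp add: case_prod_unfold)
  also have "\<dots> = (\<integral>S. h S \<partial>(distr (\<Omega> \<Otimes>\<^sub>M \<Omega>) \<Omega> (\<lambda>(S, T). mix J S T)))"
    using h by (intro integral_distr[symmetric] measurable_mix) (rule bdd_meas_measurable)
  finally show ?thesis by (simp add: distr_mix)
qed

lemma integral_avg: "bdd_meas \<Omega> h \<Longrightarrow> (\<integral>S. avg J h S \<partial>\<Omega>) = (\<integral>S. h S \<partial>\<Omega>)"
  unfolding avg_def by (rule integral_mix)

text \<open>After resampling \<open>C\<close> and then \<open>D\<close>, the coordinates in the
  union come from \<open>mix D T T'\<close>, which is again a single i.i.d. sample.\<close>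

lemma avg_avg:
  assumes h: "bdd_meas \<Omega> h" and S: "S \<in> space \<Omega>"
  shows "avg C (avg D h) S = avg (C \<union> D) h S"
proof -
  have "mix D (mix C S T) T' = mix (C \<union> D) S (mix D T T')" for T T'
    by (auto simp: mix_def)
  then have "avg C (avg D h) S = (\<integral>T. (\<integral>T'. h (mix (C \<union> D) S (mix D T T')) \<partial>\<Omega>) \<partial>\<Omega>)"
    by (simp add: avg_def)
  also have "\<dots> = (\<integral>T. h (mix (C \<union> D) S T) \<partial>\<Omega>)"
    by (rule integral_mix[OF bdd_meas_mix2[OF h S]])
  finally show ?thesis by (simp add: avg_def)
qed

lemma avg_mix: "D \<subseteq> J \<Longrightarrow> avg J h (mix D S T) = avg J h S"
proof -
  assume "D \<subseteq> J"
  then have "mix J (mix D S T) T' = mix J S T'" for T' by (auto simp: mix_def fun_eq_iff)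
  then show ?thesis by (simp add: avg_def)
qed

lemma avg_empty: "avg {} h S = h S"
  using prob_space.prob_space[OF prob_space_\<Omega>] by (simp add: avg_def mix_def)

lemma avg_diff:
  assumes "bdd_meas \<Omega> h" "bdd_meas \<Omega> k" "S \<in> space \<Omega>"
  shows "avg J (\<lambda>S. h S - k S) S = avg J h S - avg J k S"
  unfolding avg_def using assms
  by (intro Bochner_Integration.integral_diff bdd_meas_integrable[OF finite_measure_\<Omega>] bdd_meas_mix2)

lemma avg_cong: "(\<And>S. S \<in> space \<Omega> \<Longrightarrow> h S = k S) \<Longrightarrow> S \<in> space \<Omega> \<Longrightarrow> avg J h S = avg J k S"
  unfolding avg_def by (intro Bochner_Integration.integral_cong) (auto intro: mix_in_space)

lemma integral_component:
  fixes k :: "'z \<Rightarrow> real"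
  assumes i: "i \<in> I" and k: "k \<in> borel_measurable P"
  shows "(\<integral>T. k (T i) \<partial>\<Omega>) = (\<integral>y. k y \<partial>P)"
proof -
  have "(\<integral>T. k (T i) \<partial>\<Omega>) = (\<integral>y. k y \<partial>distr \<Omega> P (\<lambda>T. T i))"
    using i by (intro integral_distr[symmetric] k) simp
  also have "distr \<Omega> P (\<lambda>T. T i) = P"
    using i prob_space_axioms by (intro distr_PiM_component)
  finally show ?thesis .
qed

lemma bdd_meas_update:
  assumes h: "bdd_meas \<Omega> h" and S: "S \<in> space \<Omega>" and i: "i \<in> I"
  shows "bdd_meas P (\<lambda>y. h (S(i := y)))"
proof (rule bdd_meas_compose[OF h])
  have "S(i := y) = (\<lambda>j. if j = i then y else S j)" for y by auto
  moreover have "(\<lambda>y j. if j = i then y else S j) \<in> measurable P \<Omega>"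
  proof (rule measurable_PiM_single')
    fix j assume "j \<in> I"
    then show "(\<lambda>y. if j = i then y else S j) \<in> measurable P P"
      using component_in_space[OF S] by (cases "j = i") auto
  qed (use S i in \<open>auto simp: space_PiM PiE_def extensional_def\<close>)
  ultimately show "(\<lambda>y. S(i := y)) \<in> measurable P \<Omega>" by simp
qed

lemma avg_singleton:
  assumes h: "bdd_meas \<Omega> h" and S: "S \<in> space \<Omega>" and i: "i \<in> I"
  shows "avg {i} h S = (\<integral>y. h (S(i := y)) \<partial>P)"
  unfolding avg_def mix_singleton
  using integral_component[OF i bdd_meas_measurable[OF bdd_meas_update[OF h S i]]] .

lemma avg_diff_le:
  assumes h: "bdd_meas \<Omega> h" and S: "S \<in> space \<Omega>" and j: "j \<in> I" and y: "y \<in> space P" and c: "c \<ge> 0"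
    and le: "\<And>S. S \<in> space \<Omega> \<Longrightarrow> \<bar>h (S(j := y)) - h S\<bar> \<le> c"
  shows "\<bar>avg J h (S(j := y)) - avg J h S\<bar> \<le> c"
  unfolding avg_def
proof (intro prob_space.bdd_integral_diff_abs_le[OF prob_space_\<Omega>] bdd_meas_mix2 h S update_in_space j y)
  fix T assume T: "T \<in> space \<Omega>"
  \<comment> \<open>If \<open>j\<close> lies in \<open>J\<close>, the update is overwritten by the
    resampling and the difference is 0; otherwise it commutes with the resampling.\<close>
  have "mix J (S(j := y)) T = (if j \<in> J then mix J S T else (mix J S T)(j := y))"
    by (auto simp: mix_def)
  then show "\<bar>h (mix J (S(j := y)) T) - h (mix J S T)\<bar> \<le> c"
    using le[OF mix_in_space[OF S T]] c by auto
qed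

lemma integral_exp_sum:
  assumes Y: "\<And>i. i \<in> B \<Longrightarrow> bdd_meas P (Y i)" and B: "B \<subseteq> I"
  shows "(\<integral>T. exp (\<Sum>i\<in>B. Y i (T i)) \<partial>\<Omega>) = (\<Prod>i\<in>B. \<integral>y. exp (Y i y) \<partial>P)"
proof -
  have ps: "prob_space P" by (rule prob_space_axioms)
  interpret product_prob_space "\<lambda>_. P" I ..
  \<comment> \<open>Factors equal to one extend the product from \<open>B\<close> to all
    coordinates, where independence can be used.\<close>
  define f where "f = (\<lambda>i y. if i \<in> B then exp (Y i y) else 1)"
  have finB: "finite B" using B fin_I by (rule finite_subset)
  have "bdd_meas P (f i)" for i
    unfolding f_def using Y by (cases "i \<in> B") (auto intro: bdd_meas_exp)
  then have int: "integrable P (f i)" for i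
    by (rule bdd_meas_integrable[OF prob_space.finite_measure[OF ps]])
  have "exp (\<Sum>i\<in>B. Y i (T i)) = (\<Prod>i\<in>I. f i (T i))" for T
    using B fin_I by (simp add: exp_sum[OF finB] f_def prod.If_cases Int_absorb1)
  then have "(\<integral>T. exp (\<Sum>i\<in>B. Y i (T i)) \<partial>\<Omega>) = (\<integral>T. (\<Prod>i\<in>I. f i (T i)) \<partial>\<Omega>)"
    by simp
  also have "\<dots> = (\<Prod>i\<in>I. \<integral>y. f i y \<partial>P)"
    by (rule product_integral_prod[OF fin_I int])
  also have "\<dots> = (\<Prod>i\<in>I. if i \<in> B then \<integral>y. exp (Y i y) \<partial>P else 1)"
    by (intro prod.cong) (auto simp: f_def prob_space.prob_space[OF ps])
  also have "\<dots> = (\<Prod>i\<in>B. \<integral>y. exp (Y i y) \<partial>P)"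
    using B fin_I by (simp add: prod.If_cases Int_absorb1)
  finally show ?thesis .
qed

end

text \<open>AM-GM for the powers \<open>b i ^ card B\<close>, after which \<open>b i \<ge> 1\<close>
  allows raising the exponent to \<open>N\<close>. In the block estimate the factors depend on
  common frozen coordinates; a sum, unlike a product, can be integrated over those term by
  term.\<close>

lemma prod_le_mean_power:
  fixes b :: "'i \<Rightarrow> real"
  assumes B: "finite B" "B \<noteq> {}" "card B \<le> N" and b: "\<And>i. i \<in> B \<Longrightarrow> b i \<ge> 1"
  shows "(\<Prod>i\<in>B. b i) \<le> (\<Sum>i\<in>B. b i ^ N) / card B"
proof -
  have m: "card B > 0" using B by (simp add: card_gt_0_iff)
  have p: "0 < (\<Prod>i\<in>B. b i)" using b by (intro prod_pos) (auto intro: less_le_trans[OF zero_less_one])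
  have nn: "b i ^ card B \<ge> 0" if "i \<in> B" for i using b[OF that] by simp
  have "(\<Prod>i\<in>B. b i) = (\<Prod>i\<in>B. b i ^ card B) powr (1 / card B)"
    using p m by (simp add: prod_power_distrib[symmetric] powr_powr flip: powr_realpow)
  also have "\<dots> \<le> (\<Sum>i\<in>B. b i ^ card B) / card B"
    using arith_geom_mean[of B "\<lambda>i. b i ^ card B"] B nn by (simp add: sum_divide_distrib)
  also have "\<dots> \<le> (\<Sum>i\<in>B. b i ^ N) / card B"
    using b B by (intro divide_right_mono sum_mono power_increasing) auto
  finally show ?thesis .
qed

lemma (in prob_space) power_integral_exp_le:
  assumes u: "bdd_meas M u"
  shows "(\<integral>x. exp (u x) \<partial>M) ^ N \<le> (\<integral>x. exp (real N * u x) \<partial>M)"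
proof -
  \<comment> \<open>Odd powers are convex only on the half-line, which suffices since exponentials
    are positive.\<close>
  have cvx: "convex_on {0<..} (\<lambda>x::real. x ^ N)"
    using convex_on_subset[OF convex_power_even[of N], of "{0<..}"] convex_on_subset[OF convex_power_odd[of N], of "{0<..}"]
    by (cases "even N") (auto simp: subset_eq)
  have i: "bdd_meas M (\<lambda>x. exp (u x))" "bdd_meas M (\<lambda>x. (exp (u x)) ^ N)"
    by (intro bdd_meas_intros u)+
  have "(\<integral>x. exp (u x) \<partial>M) ^ N \<le> (\<integral>x. (exp (u x)) ^ N \<partial>M)"
    by (rule jensens_inequality[where I = "{0<..}" and a = 0 and q = "\<lambda>x. x ^ N"])
      (use i bdd_meas_integrable[OF finite_measure_axioms] cvx in auto)
  then show ?thesis by (simp add: exp_of_nat_mult)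
qed

subsection \<open>Exponential moment of one block\<close>

context iid_sample
begin

text \<open>The change in the conditional expectation of \<open>g i\<close> when the averaged set
  grows from \<open>B - {i}\<close> by the further set \<open>C\<close>. For \<open>i\<close> in
  \<open>B\<close> and \<open>C\<close> disjoint from \<open>B\<close>, coordinate \<open>i\<close>
  is kept in both terms.\<close>

definition block_diff :: "'i set \<Rightarrow> 'i set \<Rightarrow> ('i \<Rightarrow> ('i \<Rightarrow> 'z) \<Rightarrow> real) \<Rightarrow> 'i \<Rightarrow> ('i \<Rightarrow> 'z) \<Rightarrow> real" where
  "block_diff B C g i S = avg (B - {i}) (g i) S - avg (C \<union> (B - {i})) (g i) S"

lemma bdd_meas_block_diff: "bdd_meas \<Omega> (g i) \<Longrightarrow> bdd_meas \<Omega> (block_diff B C g i)"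
  unfolding block_diff_def by (intro bdd_meas_diff bdd_meas_avg)

text \<open>As a function of the coordinates in \<open>C\<close>, the increment is a function with
  bounded differences minus its mean, so by McDiarmid it is subgaussian with variance proxy
  \<open>card C * c\<^sup>2 / 4\<close>. For \<open>s = N * \<theta>\<^sup>2\<close> and
  \<open>card C \<le> N\<close>, the hypothesis on \<open>\<theta>\<close> gives the condition
  \<open>2 * s * \<tau> \<le> 1/2\<close> under which the exponential of the square is
  bounded.\<close>

lemma block_diff_exp_square:
  assumes C: "C \<subseteq> I" "card C \<le> N" "B \<inter> C = {}" and i: "i \<in> B" and g: "bdd_meas \<Omega> (g i)"
    and diff: "\<And>j S y. j \<in> I - {i} \<Longrightarrow> S \<in> space \<Omega> \<Longrightarrow> y \<in> space P \<Longrightarrow> \<bar>g i (S(j := y)) - g i S\<bar> \<le> c"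
    and c: "c \<ge> 0" and \<theta>: "(real N * \<theta> * c)\<^sup>2 \<le> 1"
  shows "(\<integral>S. exp (real N * \<theta>\<^sup>2 * (block_diff B C g i S)\<^sup>2) \<partial>\<Omega>) \<le> sqrt 2"
proof -
  interpret O: prob_space \<Omega> by (rule prob_space_\<Omega>)
  define H where "H = avg (B - {i}) (g i)"
  define Y where "Y = block_diff B C g i"
  have H: "bdd_meas \<Omega> H" unfolding H_def by (rule bdd_meas_avg[OF g])
  have Y: "bdd_meas \<Omega> Y" unfolding Y_def using g by (rule bdd_meas_block_diff)
  have sq: "bdd_meas \<Omega> (\<lambda>S. exp (real N * \<theta>\<^sup>2 * (Y S)\<^sup>2))" by (intro bdd_meas_intros Y)
  \<comment> \<open>The second average ignores the coordinates in \<open>C\<close>, so only the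
    first one feels the resampling.\<close>
  have YH: "Y (mix C S T) = H (mix C S T) - avg C H S" if "S \<in> space \<Omega>" "T \<in> space \<Omega>" for S T
    unfolding Y_def block_diff_def H_def using avg_avg[OF g that(1), of C "B - {i}"] by (simp add: avg_mix)
  have inner: "(\<integral>T. exp (real N * \<theta>\<^sup>2 * (Y (mix C S T))\<^sup>2) \<partial>\<Omega>) \<le> sqrt 2" if S: "S \<in> space \<Omega>" for S
  proof -
    define F where "F = (\<lambda>T. H (mix C S T))"
    have F: "bdd_meas \<Omega> F" unfolding F_def by (rule bdd_meas_mix2[OF H S])
    define \<tau> where "\<tau> = real (card C) * c\<^sup>2 / 4"
    have "(\<integral>T. exp (real N * \<theta>\<^sup>2 * (Y (mix C S T))\<^sup>2) \<partial>\<Omega>) = (\<integral>T. exp (real N * \<theta>\<^sup>2 * (F T - (\<integral>T. F T \<partial>\<Omega>))\<^sup>2) \<partial>\<Omega>)"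
      using YH[OF S] by (intro Bochner_Integration.integral_cong) (auto simp: F_def avg_def)
    also have "\<dots> \<le> sqrt 2"
    proof (rule O.subgaussian_exp_square)
      show "bdd_meas \<Omega> (\<lambda>T. F T - (\<integral>T. F T \<partial>\<Omega>))" by (intro bdd_meas_intros F)
      fix t
      have "(\<integral>T. exp (t * (F T - (\<integral>T. F T \<partial>\<Omega>))) \<partial>\<Omega>) \<le> exp (t\<^sup>2 * (\<Sum>j\<in>I. (if j \<in> C then c else 0)\<^sup>2) / 8)"
      proof (rule McDiarmid_mgf[OF prob_space_axioms fin_I F])
        fix T j y assume T: "T \<in> space \<Omega>" and j: "j \<in> I" and y: "y \<in> space P"
        have eq: "mix C S (T(j := y)) = (if j \<in> C then (mix C S T)(j := y) else mix C S T)"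
          by (auto simp: mix_def)
        \<comment> \<open>Here \<open>j\<close> in \<open>C\<close> differs from \<open>i\<close> in
          \<open>B\<close>, so the bound on differences applies, and averaging preserves it.\<close>
        have "\<bar>H ((mix C S T)(j := y)) - H (mix C S T)\<bar> \<le> c" if "j \<in> C"
          unfolding H_def using that C i j y
          by (intro avg_diff_le[OF g mix_in_space[OF S T] j y c] diff) auto
        then show "\<bar>F (T(j := y)) - F T\<bar> \<le> (if j \<in> C then c else 0)"
          by (auto simp: F_def eq)
      qed
      also have "(\<Sum>j\<in>I. (if j \<in> C then c else 0)\<^sup>2) = (\<Sum>j\<in>I. if j \<in> C then c\<^sup>2 else 0)"
        by (intro sum.cong) auto
      also have "\<dots> = real (card C) * c\<^sup>2"
        using C fin_I by (simp add: sum.If_cases Int_absorb1)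
      finally show "(\<integral>T. exp (t * (F T - (\<integral>T. F T \<partial>\<Omega>))) \<partial>\<Omega>) \<le> exp (t\<^sup>2 * \<tau> / 2)"
        by (simp add: \<tau>_def)
      have "2 * (real N * \<theta>\<^sup>2) * \<tau> = real N * real (card C) * \<theta>\<^sup>2 * c\<^sup>2 / 2"
        by (simp add: \<tau>_def)
      also have "\<dots> \<le> real N * real N * \<theta>\<^sup>2 * c\<^sup>2 / 2"
        using C by (intro divide_right_mono mult_right_mono mult_left_mono) auto
      also have "\<dots> = (real N * \<theta> * c)\<^sup>2 / 2" by (simp add: power2_eq_square)
      finally show "2 * (real N * \<theta>\<^sup>2) * \<tau> \<le> 1 / 2" using \<theta> by simp
    qed simp
    finally show ?thesis .
  qed
  have "(\<integral>S. exp (real N * \<theta>\<^sup>2 * (Y S)\<^sup>2) \<partial>\<Omega>) = (\<integral>S. (\<integral>T. exp (real N * \<theta>\<^sup>2 * (Y (mix C S T))\<^sup>2) \<partial>\<Omega>) \<partial>\<Omega>)"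
    using integral_mix[OF sq] by simp
  also have "\<dots> \<le> sqrt 2"
    by (intro O.bdd_integral_le inner bdd_meas_integral[OF prob_space_\<Omega> bdd_meas_mix[OF sq]])
  finally show ?thesis unfolding Y_def .
qed

text \<open>Given the coordinates outside \<open>B\<close>, the summands are independent and centred; centring turns
  \<open>exp (\<theta> Y)\<close> into \<open>exp (\<theta>\<^sup>2 Y\<^sup>2)\<close>, and AM-GM with Jensen decouples the product.\<close>

lemma block_diff_mgf:
  assumes B: "B \<subseteq> I" "card B \<le> N" and C: "C \<subseteq> I" "card C \<le> N" "B \<inter> C = {}"
    and g: "\<And>i. i \<in> B \<Longrightarrow> bdd_meas \<Omega> (g i)"
    and mean0: "\<And>i S. i \<in> B \<Longrightarrow> S \<in> space \<Omega> \<Longrightarrow> avg {i} (g i) S = 0"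
    and diff: "\<And>i j S y. i \<in> B \<Longrightarrow> j \<in> I - {i} \<Longrightarrow> S \<in> space \<Omega> \<Longrightarrow> y \<in> space P \<Longrightarrow> \<bar>g i (S(j := y)) - g i S\<bar> \<le> c"
    and c: "c \<ge> 0" and \<theta>: "(real N * \<theta> * c)\<^sup>2 \<le> 1"
  shows "(\<integral>S. exp (\<theta> * (\<Sum>i\<in>B. block_diff B C g i S)) \<partial>\<Omega>) \<le> sqrt 2"
proof (cases "B = {}")
  case True
  then show ?thesis using prob_space.prob_space[OF prob_space_\<Omega>] by simp
next
  case False
  interpret O: prob_space \<Omega> by (rule prob_space_\<Omega>)
  define Y where "Y = block_diff B C g"
  have finB: "finite B" using B fin_I by (auto intro: finite_subset)
  have Y: "bdd_meas \<Omega> (Y i)" if "i \<in> B" for i unfolding Y_def using g[OF that] by (rule bdd_meas_block_diff)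
  \<comment> \<open>Both averages integrate out the rest of the block, so within \<open>B\<close>
    the increment of \<open>g i\<close> depends on its own coordinate alone: this is the conditional
    independence.\<close>
  have YB: "Y i (mix B S T) = Y i (S(i := T i))" if "i \<in> B" for i S T
  proof -
    have "mix (B - {i}) (mix B S T) T' = mix (B - {i}) (S(i := T i)) T'"
      "mix (C \<union> (B - {i})) (mix B S T) T' = mix (C \<union> (B - {i})) (S(i := T i)) T'" for T'
      using that C by (auto simp: mix_def fun_eq_iff)
    then show ?thesis by (simp add: Y_def block_diff_def avg_def)
  qed
  \<comment> \<open>Averages combine into an average over the union, so coordinate \<open>i\<close>
    may be integrated innermost, where \<open>g i\<close> has mean zero.\<close>
  have Y0: "(\<integral>y. Y i (S(i := y)) \<partial>P) = 0" if i: "i \<in> B" and S: "S \<in> space \<Omega>" for i S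
  proof -
    have iI: "i \<in> I" using i B by auto
    have z: "avg (insert i J) (g i) S = 0" for J
    proof -
      have "avg (insert i J) (g i) S = avg J (avg {i} (g i)) S"
        by (simp add: avg_avg[OF g[OF i] S])
      also have "\<dots> = avg J (\<lambda>_. 0) S" by (rule avg_cong[OF mean0[OF i] S])
      finally show ?thesis by (simp add: avg_def)
    qed
    have "(\<integral>y. Y i (S(i := y)) \<partial>P) = avg {i} (Y i) S"
      by (rule avg_singleton[OF Y[OF i] S iI, symmetric])
    also have "\<dots> = avg {i} (avg (B - {i}) (g i)) S - avg {i} (avg (C \<union> (B - {i})) (g i)) S"
      unfolding Y_def block_diff_def by (intro avg_diff bdd_meas_avg g i S)
    also have "\<dots> = 0" by (simp add: avg_avg[OF g[OF i] S] z)
    finally show ?thesis .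
  qed
  have sq: "bdd_meas \<Omega> (\<lambda>S. exp (real N * \<theta>\<^sup>2 * (Y i S)\<^sup>2))" if "i \<in> B" for i
    by (intro bdd_meas_intros Y that)
  have tot: "bdd_meas \<Omega> (\<lambda>S. exp (\<theta> * (\<Sum>i\<in>B. Y i S)))"
    by (intro bdd_meas_intros Y)
  have inner: "(\<integral>T. exp (\<theta> * (\<Sum>i\<in>B. Y i (mix B S T))) \<partial>\<Omega>)
      \<le> (\<Sum>i\<in>B. avg {i} (\<lambda>S. exp (real N * \<theta>\<^sup>2 * (Y i S)\<^sup>2)) S) / card B" if S: "S \<in> space \<Omega>" for S
  proof -
    define Z where "Z = (\<lambda>i y. Y i (S(i := y)))"
    have Z: "bdd_meas P (Z i)" if "i \<in> B" for i
      unfolding Z_def using that B by (intro bdd_meas_update Y S) auto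
    have "(\<integral>T. exp (\<theta> * (\<Sum>i\<in>B. Y i (mix B S T))) \<partial>\<Omega>) = (\<integral>T. exp (\<Sum>i\<in>B. \<theta> * Z i (T i)) \<partial>\<Omega>)"
      by (simp add: YB Z_def sum_distrib_left)
    also have "\<dots> = (\<Prod>i\<in>B. \<integral>y. exp (\<theta> * Z i y) \<partial>P)"
      by (rule integral_exp_sum[where Y = "\<lambda>i y. \<theta> * Z i y"]) (intro bdd_meas_intros Z B | assumption)+
    also have "\<dots> \<le> (\<Prod>i\<in>B. \<integral>y. exp (\<theta>\<^sup>2 * (Z i y)\<^sup>2) \<partial>P)"
    proof (rule prod_mono, intro conjI)
      fix i assume i: "i \<in> B"
      show "0 \<le> (\<integral>y. exp (\<theta> * Z i y) \<partial>P)" by simp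
      have b: "bdd_meas P (\<lambda>y. \<theta> * Z i y)" "bdd_meas P (\<lambda>y. exp (\<theta>\<^sup>2 * (Z i y)\<^sup>2))"
        by (intro bdd_meas_intros Z i)+
      have "(\<integral>y. exp (\<theta> * Z i y) \<partial>P) \<le> (\<integral>y. \<theta> * Z i y + exp (\<theta>\<^sup>2 * (Z i y)\<^sup>2) \<partial>P)"
        using exp_le_add_exp_sq[of "\<theta> * Z i _"]
        by (intro bdd_integral_mono[OF finite_measure_axioms] bdd_meas_intros Z i) (simp add: power_mult_distrib)
      also have "\<dots> = (\<integral>y. \<theta> * Z i y \<partial>P) + (\<integral>y. exp (\<theta>\<^sup>2 * (Z i y)\<^sup>2) \<partial>P)"
        using b by (intro Bochner_Integration.integral_add bdd_meas_integrable[OF finite_measure_axioms])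
      also have "(\<integral>y. \<theta> * Z i y \<partial>P) = 0" using Y0[OF i S] by (simp add: Z_def)
      finally show "(\<integral>y. exp (\<theta> * Z i y) \<partial>P) \<le> (\<integral>y. exp (\<theta>\<^sup>2 * (Z i y)\<^sup>2) \<partial>P)" by simp
    qed
    also have "\<dots> \<le> (\<Sum>i\<in>B. (\<integral>y. exp (\<theta>\<^sup>2 * (Z i y)\<^sup>2) \<partial>P) ^ N) / card B"
    proof (rule prod_le_mean_power[OF finB False B(2)])
      fix i assume i: "i \<in> B"
      show "1 \<le> (\<integral>y. exp (\<theta>\<^sup>2 * (Z i y)\<^sup>2) \<partial>P)"
        by (intro bdd_integral_ge bdd_meas_intros Z i) auto
    qed
    also have "\<dots> \<le> (\<Sum>i\<in>B. avg {i} (\<lambda>S. exp (real N * \<theta>\<^sup>2 * (Y i S)\<^sup>2)) S) / card B"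
    proof (intro divide_right_mono sum_mono)
      fix i assume i: "i \<in> B"
      \<comment> \<open>Jensen moves the power \<open>N\<close> into the exponent, which yields the
        weight \<open>real N * \<theta>\<^sup>2\<close> for which the squared increment was
        estimated.\<close>
      have "(\<integral>y. exp (\<theta>\<^sup>2 * (Z i y)\<^sup>2) \<partial>P) ^ N \<le> (\<integral>y. exp (real N * (\<theta>\<^sup>2 * (Z i y)\<^sup>2)) \<partial>P)"
        by (intro power_integral_exp_le bdd_meas_intros Z i)
      also have "\<dots> = avg {i} (\<lambda>S. exp (real N * \<theta>\<^sup>2 * (Y i S)\<^sup>2)) S"
        using i B by (subst avg_singleton[OF sq[OF i] S]) (auto simp: Z_def mult.assoc)
      finally show "(\<integral>y. exp (\<theta>\<^sup>2 * (Z i y)\<^sup>2) \<partial>P) ^ N \<le> avg {i} (\<lambda>S. exp (real N * \<theta>\<^sup>2 * (Y i S)\<^sup>2)) S" .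
    qed simp
    finally show ?thesis .
  qed
  have "(\<integral>S. exp (\<theta> * (\<Sum>i\<in>B. Y i S)) \<partial>\<Omega>) = (\<integral>S. (\<integral>T. exp (\<theta> * (\<Sum>i\<in>B. Y i (mix B S T))) \<partial>\<Omega>) \<partial>\<Omega>)"
    using integral_mix[OF tot] by simp
  also have "\<dots> \<le> (\<integral>S. (\<Sum>i\<in>B. avg {i} (\<lambda>S. exp (real N * \<theta>\<^sup>2 * (Y i S)\<^sup>2)) S) * (1 / card B) \<partial>\<Omega>)"
  proof (rule bdd_integral_mono[OF finite_measure_\<Omega>])
    show "bdd_meas \<Omega> (\<lambda>S. \<integral>T. exp (\<theta> * (\<Sum>i\<in>B. Y i (mix B S T))) \<partial>\<Omega>)"
      by (rule bdd_meas_integral[OF prob_space_\<Omega> bdd_meas_mix[OF tot]])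
    show "bdd_meas \<Omega> (\<lambda>S. (\<Sum>i\<in>B. avg {i} (\<lambda>S. exp (real N * \<theta>\<^sup>2 * (Y i S)\<^sup>2)) S) * (1 / card B))"
      by (intro bdd_meas_mult bdd_meas_sum bdd_meas_avg sq bdd_meas_const)
  qed (use inner in auto)
  \<comment> \<open>Averaging over coordinate \<open>i\<close> does not change the total
    expectation, so each summand becomes an unconditional moment.\<close>
  also have "\<dots> = (\<Sum>i\<in>B. \<integral>S. exp (real N * \<theta>\<^sup>2 * (Y i S)\<^sup>2) \<partial>\<Omega>) / card B"
    by (simp add: Bochner_Integration.integral_sum bdd_meas_integrable[OF finite_measure_\<Omega>] bdd_meas_avg sq integral_avg)
  also have "\<dots> \<le> (\<Sum>i\<in>B. sqrt 2) / card B"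
    unfolding Y_def
    by (intro divide_right_mono sum_mono block_diff_exp_square[OF C _ g _ c \<theta>] diff) auto
  also have "\<dots> = sqrt 2" using finB False by simp
  finally show ?thesis unfolding Y_def .
qed

end

subsection \<open>Dyadic decomposition\<close>

text \<open>Convexity of the exponential. It takes the place of independence for a sum of dependent
  terms, at the price of the factor \<open>card A\<close> in the exponent.\<close>

lemma exp_sum_le_mean:
  fixes x :: "'i \<Rightarrow> real"
  assumes A: "finite A" "A \<noteq> {}"
  shows "exp (\<Sum>a\<in>A. x a) \<le> (\<Sum>a\<in>A. exp (card A * x a)) / card A"
proof -
  have c: "card A > 0" using A by (simp add: card_gt_0_iff)
  have "exp (\<Sum>a\<in>A. (1 / card A) *\<^sub>R (card A * x a)) \<le> (\<Sum>a\<in>A. (1 / card A) * exp (card A * x a))"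
    by (rule convex_on_sum[OF A exp_convex]) (use c in auto)
  then show ?thesis using c by (simp add: sum_divide_distrib)
qed

locale iid_sequence = iid_sample P "{..<n}" for P :: "'z measure" and n :: nat
begin

definition blk :: "nat \<Rightarrow> nat \<Rightarrow> nat set" where
  "blk k b = {j \<in> {..<n}. j div 2 ^ k = b}"

text \<open>The other half of the dyadic parent of block \<open>b\<close>; towards the end of the
  sample it can be incomplete or empty.\<close>

definition sib :: "nat \<Rightarrow> nat \<Rightarrow> nat set" where
  "sib k b = blk (Suc k) (b div 2) - blk k b"

lemma blk_subset: "blk k b \<subseteq> {..<n}" and sib_subset: "sib k b \<subseteq> {..<n}" and blk_sib_disjoint: "blk k b \<inter> sib k b = {}"
  by (auto simp: blk_def sib_def)

lemma card_blk: "card (blk k b) \<le> 2 ^ k"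
proof -
  have "blk k b \<subseteq> {b * 2 ^ k..<b * 2 ^ k + 2 ^ k}"
  proof
    fix j assume "j \<in> blk k b"
    then have "j div 2 ^ k = b" by (simp add: blk_def)
    moreover have "j = (j div 2 ^ k) * 2 ^ k + j mod 2 ^ k" "j mod 2 ^ k < 2 ^ k"
      by (auto simp only: div_mult_mod_eq) simp
    ultimately show "j \<in> {b * 2 ^ k..<b * 2 ^ k + 2 ^ k}"
      by (metis atLeastLessThan_iff le_add1 nat_add_left_cancel_less)
  qed
  then have "card (blk k b) \<le> card {b * 2 ^ k..<b * 2 ^ k + 2 ^ k}" by (intro card_mono) auto
  then show ?thesis by simp
qed

lemma blk_div: "j div 2 ^ Suc k = (j div 2 ^ k) div (2::nat)"
  by (metis div_mult2_eq power_Suc2)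

lemma card_sib: "card (sib k b) \<le> 2 ^ k"
proof -
  \<comment> \<open>Blocks 2a and 2a + 1 have the common parent a, so the sibling of an even block
    is its successor and that of an odd block its predecessor.\<close>
  have "sib k b \<subseteq> blk k (if even b then b + 1 else b - 1)"
  proof
    fix j assume "j \<in> sib k b"
    then have "j < n" "(j div 2 ^ k) div 2 = b div 2" "j div 2 ^ k \<noteq> b"
      by (auto simp: sib_def blk_def blk_div simp del: power_Suc)
    then show "j \<in> blk k (if even b then b + 1 else b - 1)"
      by (auto simp: blk_def elim!: evenE oddE)
  qed
  then have "card (sib k b) \<le> card (blk k (if even b then b + 1 else b - 1))"
    by (intro card_mono) (auto simp: blk_def)
  with card_blk show ?thesis by (rule order_trans[rotated])
qed

text \<open>For each \<open>i\<close>, the averages over the dyadic blocks around \<open>i\<close>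
  telescope from level 0, where the block without \<open>i\<close> is empty, to level
  \<open>K\<close>, where the block is the whole sample. The indices are then regrouped by
  blocks.\<close>

lemma dyadic_decomposition:
  assumes K: "n \<le> 2 ^ K"
  shows "(\<Sum>i<n. g i S - avg ({..<n} - {i}) (g i) S)
    = (\<Sum>k<K. \<Sum>b\<le>n div 2 ^ k. \<Sum>i\<in>blk k b. block_diff (blk k b) (sib k b) g i S)"
proof -
  have i: "g i S - avg ({..<n} - {i}) (g i) S
    = (\<Sum>k<K. block_diff (blk k (i div 2 ^ k)) (sib k (i div 2 ^ k)) g i S)" if i: "i < n" for i
  proof -
    define h where "h = (\<lambda>k. avg (blk k (i div 2 ^ k) - {i}) (g i) S)"
    have step: "block_diff (blk k (i div 2 ^ k)) (sib k (i div 2 ^ k)) g i S = h k - h (Suc k)" for k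
    proof -
      have "blk k (i div 2 ^ k) \<subseteq> blk (Suc k) (i div 2 ^ Suc k)"
        by (auto simp: blk_def blk_div simp del: power_Suc)
      then have "sib k (i div 2 ^ k) \<union> (blk k (i div 2 ^ k) - {i}) = blk (Suc k) (i div 2 ^ Suc k) - {i}"
        using i by (auto simp: sib_def blk_div blk_def simp del: power_Suc)
      then show ?thesis by (simp add: block_diff_def h_def del: power_Suc)
    qed
    have "h 0 = g i S"
    proof -
      have "blk 0 (i div 2 ^ 0) - {i} = {}" by (auto simp: blk_def)
      then show ?thesis by (simp only: h_def avg_empty)
    qed
    moreover have "h K = avg ({..<n} - {i}) (g i) S"
    proof -
      have "blk K (i div 2 ^ K) = {..<n}" using i K by (auto simp: blk_def)
      then show ?thesis by (simp only: h_def)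
    qed
    ultimately show ?thesis by (simp only: step sum_lessThan_telescope')
  qed
  have "(\<Sum>i<n. g i S - avg ({..<n} - {i}) (g i) S)
    = (\<Sum>i<n. \<Sum>k<K. block_diff (blk k (i div 2 ^ k)) (sib k (i div 2 ^ k)) g i S)"
    using i by (intro sum.cong) auto
  also have "\<dots> = (\<Sum>k<K. \<Sum>i<n. block_diff (blk k (i div 2 ^ k)) (sib k (i div 2 ^ k)) g i S)"
    by (rule sum.swap)
  also have "\<dots> = (\<Sum>k<K. \<Sum>b\<le>n div 2 ^ k. \<Sum>i\<in>blk k b. block_diff (blk k b) (sib k b) g i S)"
  proof (rule sum.cong[OF refl])
    fix k
    \<comment> \<open>The range \<open>b \<le> n div 2 ^ k\<close> includes the last, partial block;
      if \<open>2 ^ k\<close> divides \<open>n\<close>, that block is empty and contributes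
      nothing.\<close>
    have "(\<Sum>i<n. block_diff (blk k (i div 2 ^ k)) (sib k (i div 2 ^ k)) g i S)
      = (\<Sum>b\<le>n div 2 ^ k. \<Sum>i\<in>{i \<in> {..<n}. i div 2 ^ k = b}. block_diff (blk k (i div 2 ^ k)) (sib k (i div 2 ^ k)) g i S)"
      by (rule sum.group[symmetric]) (auto intro: div_le_mono)
    also have "\<dots> = (\<Sum>b\<le>n div 2 ^ k. \<Sum>i\<in>blk k b. block_diff (blk k b) (sib k b) g i S)"
      by (intro sum.cong) (auto simp: blk_def)
    finally show "(\<Sum>i<n. block_diff (blk k (i div 2 ^ k)) (sib k (i div 2 ^ k)) g i S)
       = (\<Sum>b\<le>n div 2 ^ k. \<Sum>i\<in>blk k b. block_diff (blk k b) (sib k b) g i S)" .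
  qed
  finally show ?thesis .
qed

text \<open>The increments of different blocks and levels may be dependent, so convexity is applied
  twice: over the \<open>K\<close> levels and then over the \<open>m k\<close> blocks of a level. A
  single block thus gets the exponent \<open>\<theta> k\<close>, and its smallness condition holds
  because block size times number of blocks is at most \<open>2 * n\<close>.\<close>

lemma dyadic_mgf:
  assumes K: "n \<le> 2 ^ K" "\<And>k. k < K \<Longrightarrow> 2 ^ k \<le> n" "K > 0"
    and g: "\<And>i. i < n \<Longrightarrow> bdd_meas \<Omega> (g i)"
    and mean0: "\<And>i S. i < n \<Longrightarrow> S \<in> space \<Omega> \<Longrightarrow> avg {i} (g i) S = 0"
    and diff: "\<And>i j S y. i < n \<Longrightarrow> j < n \<Longrightarrow> j \<noteq> i \<Longrightarrow> S \<in> space \<Omega> \<Longrightarrow> y \<in> space P \<Longrightarrow> \<bar>g i (S(j := y)) - g i S\<bar> \<le> c"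
    and c: "c \<ge> 0" and l: "l \<ge> 0" "l * (2 * real n * real K * c) \<le> 1"
  shows "(\<integral>S. exp (l * (\<Sum>i<n. g i S - avg ({..<n} - {i}) (g i) S)) \<partial>\<Omega>) \<le> sqrt 2"
proof -
  define X where "X = (\<lambda>k b S. \<Sum>i\<in>blk k b. block_diff (blk k b) (sib k b) g i S)"
  define m where "m = (\<lambda>k. Suc (n div 2 ^ k))"
  define \<theta> where "\<theta> = (\<lambda>k. real (m k) * (real K * l))"
  have X: "bdd_meas \<Omega> (X k b)" for k b
    unfolding X_def by (intro bdd_meas_sum bdd_meas_block_diff g) (auto simp: blk_def)
  have XE: "(\<integral>S. exp (\<theta> k * X k b S) \<partial>\<Omega>) \<le> sqrt 2" if k: "k < K" for k b
    unfolding X_def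
  proof (rule block_diff_mgf[where N = "2 ^ k" and c = c])
    \<comment> \<open>\<open>m k\<close> is one more than \<open>n div 2 ^ k\<close>, which adds
      \<open>2 ^ k \<le> n\<close> to a multiple of \<open>2 ^ k\<close> that is itself at most
      \<open>n\<close>.\<close>
    have "2 ^ k * m k \<le> 2 * n"
      using K(2)[OF k] by (simp add: m_def) (metis add.commute add_le_mono mult_2 times_div_less_eq_dividend)
    then have le: "real (2 ^ k) * real (m k) \<le> 2 * real n"
      by (metis of_nat_le_iff of_nat_mult of_nat_numeral)
    have "real (2 ^ k) * \<theta> k * c = (real (2 ^ k) * real (m k)) * (real K * l * c)"
      by (simp add: \<theta>_def)
    also have "\<dots> \<le> (2 * real n) * (real K * l * c)"
      using c l by (intro mult_right_mono le) auto
    finally have "real (2 ^ k) * \<theta> k * c \<le> 1" using l by (simp add: mult_ac)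
    moreover have "0 \<le> real (2 ^ k) * \<theta> k * c" using c l by (simp add: \<theta>_def)
    ultimately show "(real (2 ^ k) * \<theta> k * c)\<^sup>2 \<le> 1" by (simp add: power_le_one)
  qed (use blk_subset sib_subset blk_sib_disjoint card_blk card_sib g mean0 diff c in \<open>auto simp: blk_def\<close>)
  have pt: "exp (l * (\<Sum>k<K. \<Sum>b\<le>n div 2 ^ k. X k b S))
    \<le> (\<Sum>k<K. (\<Sum>b\<le>n div 2 ^ k. exp (\<theta> k * X k b S)) * (1 / m k)) * (1 / K)" for S
  proof -
    have "exp (l * (\<Sum>k<K. \<Sum>b\<le>n div 2 ^ k. X k b S)) = exp (\<Sum>k<K. l * (\<Sum>b\<le>n div 2 ^ k. X k b S))"
      by (simp add: sum_distrib_left)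
    also have "\<dots> \<le> (\<Sum>k<K. exp (K * (l * (\<Sum>b\<le>n div 2 ^ k. X k b S)))) / K"
      using exp_sum_le_mean[of "{..<K}"] K(3) by auto
    also have "\<dots> \<le> (\<Sum>k<K. (\<Sum>b\<le>n div 2 ^ k. exp (\<theta> k * X k b S)) / m k) / K"
    proof (intro divide_right_mono sum_mono)
      fix k
      have "exp (K * (l * (\<Sum>b\<le>n div 2 ^ k. X k b S))) = exp (\<Sum>b\<le>n div 2 ^ k. K * l * X k b S)"
        by (simp add: sum_distrib_left mult.assoc)
      also have "\<dots> \<le> (\<Sum>b\<le>n div 2 ^ k. exp (card {..n div 2 ^ k} * (K * l * X k b S))) / card {..n div 2 ^ k}"
        by (rule exp_sum_le_mean) auto
      finally show "exp (K * (l * (\<Sum>b\<le>n div 2 ^ k. X k b S))) \<le> (\<Sum>b\<le>n div 2 ^ k. exp (\<theta> k * X k b S)) / m k"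
        by (simp add: \<theta>_def m_def mult_ac)
    qed simp
    finally show ?thesis by simp
  qed
  have e: "bdd_meas \<Omega> (\<lambda>S. exp (\<theta> k * X k b S))" for k b by (intro bdd_meas_intros X)
  have eK: "bdd_meas \<Omega> (\<lambda>S. (\<Sum>b\<le>n div 2 ^ k. exp (\<theta> k * X k b S)) * (1 / m k))" for k
    by (intro bdd_meas_mult bdd_meas_sum bdd_meas_const e)
  note int = bdd_meas_integrable[OF finite_measure_\<Omega>]
  have "(\<integral>S. exp (l * (\<Sum>i<n. g i S - avg ({..<n} - {i}) (g i) S)) \<partial>\<Omega>)
     = (\<integral>S. exp (l * (\<Sum>k<K. \<Sum>b\<le>n div 2 ^ k. X k b S)) \<partial>\<Omega>)"
    by (simp add: dyadic_decomposition[OF K(1)] X_def)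
  also have "\<dots> \<le> (\<integral>S. (\<Sum>k<K. (\<Sum>b\<le>n div 2 ^ k. exp (\<theta> k * X k b S)) * (1 / m k)) * (1 / K) \<partial>\<Omega>)"
    by (intro bdd_integral_mono[OF finite_measure_\<Omega>] pt bdd_meas_exp bdd_meas_mult bdd_meas_sum bdd_meas_const X)
  also have "\<dots> = (\<integral>S. (\<Sum>k<K. (\<Sum>b\<le>n div 2 ^ k. exp (\<theta> k * X k b S)) * (1 / m k)) \<partial>\<Omega>) * (1 / K)"
    by (rule Bochner_Integration.integral_mult_left_zero)
  also have "\<dots> = (\<Sum>k<K. (\<Sum>b\<le>n div 2 ^ k. \<integral>S. exp (\<theta> k * X k b S) \<partial>\<Omega>) * (1 / m k)) * (1 / K)"
    by (subst Bochner_Integration.integral_sum[OF int[OF eK]])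
      (simp only: Bochner_Integration.integral_mult_left_zero Bochner_Integration.integral_sum[OF int[OF e]])
  also have "\<dots> \<le> (\<Sum>k<K. (\<Sum>b\<le>n div 2 ^ k. sqrt 2) * (1 / m k)) * (1 / K)"
    using XE by (intro mult_right_mono sum_mono) auto
  also have "\<dots> = sqrt 2" using K(3) by (simp add: m_def)
  finally show ?thesis .
qed

lemma dyadic_tail:
  assumes K: "n \<le> 2 ^ K" "\<And>k. k < K \<Longrightarrow> 2 ^ k \<le> n" and n: "n > 0"
    and g: "\<And>i. i < n \<Longrightarrow> bdd_meas \<Omega> (g i)"
    and mean0: "\<And>i S. i < n \<Longrightarrow> S \<in> space \<Omega> \<Longrightarrow> avg {i} (g i) S = 0"
    and diff: "\<And>i j S y. i < n \<Longrightarrow> j < n \<Longrightarrow> j \<noteq> i \<Longrightarrow> S \<in> space \<Omega> \<Longrightarrow> y \<in> space P \<Longrightarrow> \<bar>g i (S(j := y)) - g i S\<bar> \<le> c"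
    and c: "c > 0"
  shows "1 - exp (- x) \<le> measure \<Omega> {S \<in> space \<Omega>. (\<Sum>i<n. g i S - avg ({..<n} - {i}) (g i) S) \<le> 2 * real n * real K * c * (1 + x)}"
proof (cases "K = 0")
  case True
  \<comment> \<open>With no levels both the sum and the bound vanish; the case is kept apart because
    \<open>l\<close> below divides by \<open>K\<close>.\<close>
  have "(\<Sum>i<n. g i S - avg ({..<n} - {i}) (g i) S) = 0" for S
    using dyadic_decomposition[OF K(1)] True by simp
  then show ?thesis using prob_space.prob_space[OF prob_space_\<Omega>] True by simp
next
  case False
  interpret O: prob_space \<Omega> by (rule prob_space_\<Omega>)
  define Z where "Z = (\<lambda>S. \<Sum>i<n. g i S - avg ({..<n} - {i}) (g i) S)"
  define l where "l = 1 / (2 * real n * real K * c)"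
  have Z: "bdd_meas \<Omega> Z" unfolding Z_def by (intro bdd_meas_sum bdd_meas_diff bdd_meas_avg g) auto
  have l0: "l > 0" using n False c by (simp add: l_def)
  \<comment> \<open>The moment \<open>sqrt 2\<close> is at most \<open>exp 1\<close>, which gives
    the 1 in \<open>1 + x\<close>.\<close>
  have s: "ln (sqrt 2) \<le> (1::real)"
    using ln_add_one_self_le_self[of 1] by (simp add: ln_sqrt)
  have "(\<integral>S. exp (l * Z S) \<partial>\<Omega>) \<le> sqrt 2"
    unfolding Z_def using K False c n
    by (intro dyadic_mgf[where K = K and c = c] g mean0 diff) (auto simp: l_def)
  also have "sqrt 2 = exp (ln (sqrt (2::real)))" by simp
  also have "\<dots> \<le> exp 1" using s by (simp only: exp_le_cancel_iff)
  finally have "1 - exp (- x) \<le> measure \<Omega> {S \<in> space \<Omega>. Z S \<le> (1 + x) / l}"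
    by (rule O.chernoff_event[OF Z l0])
  then show ?thesis by (simp add: Z_def l_def mult_ac)
qed

end

subsection \<open>Generalization of stable predictors\<close>

text \<open>Cauchy-Schwarz from the nonnegative integral of (s f - t g)^2. The balanced choice
  \<open>s = sqrt G\<close>, \<open>t = sqrt F\<close> settles the case of positive norms; if one
  norm vanishes, a large multiplier shows that the mixed integral cannot be positive.\<close>

lemma integral_mult_le_sqrt:
  fixes f g :: "'a \<Rightarrow> real"
  assumes M: "finite_measure M" and f: "bdd_meas M f" and g: "bdd_meas M g"
  shows "(\<integral>x. f x * g x \<partial>M) \<le> sqrt (\<integral>x. (f x)\<^sup>2 \<partial>M) * sqrt (\<integral>x. (g x)\<^sup>2 \<partial>M)"
proof -
  define F G H where "F = (\<integral>x. (f x)\<^sup>2 \<partial>M)" and "G = (\<integral>x. (g x)\<^sup>2 \<partial>M)" and "H = (\<integral>x. f x * g x \<partial>M)"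
  have nn: "F \<ge> 0" "G \<ge> 0" by (auto simp: F_def G_def)
  have q: "2 * H * s * t \<le> s\<^sup>2 * F + t\<^sup>2 * G" for s t
  proof -
    have b: "bdd_meas M (\<lambda>x. (f x)\<^sup>2)" "bdd_meas M (\<lambda>x. (g x)\<^sup>2)" "bdd_meas M (\<lambda>x. f x * g x)"
      by (intro bdd_meas_intros f g)+
    note i [simp] = b[THEN bdd_meas_integrable[OF M]]
    have "0 \<le> (\<integral>x. (s * f x - t * g x)\<^sup>2 \<partial>M)" by simp
    also have "\<dots> = (\<integral>x. s\<^sup>2 * (f x)\<^sup>2 - 2 * s * t * (f x * g x) + t\<^sup>2 * (g x)\<^sup>2 \<partial>M)"
      by (intro Bochner_Integration.integral_cong) (auto simp: power2_diff power_mult_distrib)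
    also have "\<dots> = s\<^sup>2 * F - 2 * s * t * H + t\<^sup>2 * G"
      by (simp add: F_def G_def H_def)
    finally show ?thesis by (simp add: mult_ac)
  qed
  have "H \<le> sqrt F * sqrt G"
  proof (cases "F = 0 \<or> G = 0")
    case False
    have "2 * H * sqrt G * sqrt F \<le> 2 * (F * G)"
      using q[of "sqrt G" "sqrt F"] nn by (simp add: mult.commute)
    also have "F * G = (sqrt F * sqrt F) * (sqrt G * sqrt G)" using nn by simp
    finally have "H * (sqrt F * sqrt G) \<le> (sqrt F * sqrt G) * (sqrt F * sqrt G)"
      by (simp only: mult_ac)
    moreover have "0 < sqrt F * sqrt G" using False nn by simp
    ultimately show ?thesis by (rule mult_right_le_imp_le)
  next
    case True
    have "H \<le> 0"
    proof (rule ccontr)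
      assume "\<not> H \<le> 0"
      then have h: "H > 0" by simp
      show False
      proof (cases "F = 0")
        case True
        have "2 * H * ((G + 1) / H) * 1 \<le> G" using q[of "(G + 1) / H" 1] True by simp
        then show False using h nn by simp
      next
        case False
        then have "G = 0" using \<open>F = 0 \<or> G = 0\<close> by simp
        then have "2 * H * 1 * ((F + 1) / H) \<le> F" using q[of 1 "(F + 1) / H"] by simp
        then show False using h nn by simp
      qed
    qed
    then show ?thesis using True by auto
  qed
  then show ?thesis by (simp add: F_def G_def H_def)
qed

lemma (in prob_space) integral_abs_le_sqrt:
  assumes f: "bdd_meas M f"
  shows "(\<integral>x. \<bar>f x\<bar> \<partial>M) \<le> sqrt (\<integral>x. (f x)\<^sup>2 \<partial>M)"
proof -
  obtain b where "\<And>x. x \<in> space M \<Longrightarrow> \<bar>f x\<bar> \<le> b" using bdd_meas_bound[OF f] by metis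
  then have "bdd_meas M (\<lambda>x. \<bar>f x\<bar>)"
    using bdd_meas_measurable[OF f] by (intro bdd_measI[where b = b]) auto
  from integral_mult_le_sqrt[OF finite_measure_axioms this bdd_meas_const[of M 1]] show ?thesis
    by (simp add: prob_space)
qed

text \<open>The triangle inequality for the L^2-norm. Applied to \<open>f (S(i := y))\<close> and
  \<open>f S\<close>, it makes the norm of a stable predictor itself a function of the sample with
  bounded differences.\<close>

lemma (in prob_space) L2_norm_diff_le:
  assumes f: "bdd_meas M f" and g: "bdd_meas M g" and a: "\<And>x. x \<in> space M \<Longrightarrow> \<bar>f x - g x\<bar> \<le> a"
  shows "sqrt (\<integral>x. (f x)\<^sup>2 \<partial>M) \<le> sqrt (\<integral>x. (g x)\<^sup>2 \<partial>M) + a"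
proof -
  obtain b where b: "\<And>x. x \<in> space M \<Longrightarrow> \<bar>g x\<bar> \<le> b" using bdd_meas_bound[OF g] by metis
  then have g': "bdd_meas M (\<lambda>x. \<bar>g x\<bar>)"
    using bdd_meas_measurable[OF g] by (intro bdd_measI[where b = b]) auto
  have a0: "a \<ge> 0" using a not_empty by fastforce
  have b: "bdd_meas M (\<lambda>x. (g x)\<^sup>2)" by (intro bdd_meas_intros g)
  note i [simp] = b[THEN bdd_meas_integrable[OF finite_measure_axioms]] g'[THEN bdd_meas_integrable[OF finite_measure_axioms]]
  have "(\<integral>x. (f x)\<^sup>2 \<partial>M) \<le> (\<integral>x. (g x)\<^sup>2 + 2 * a * \<bar>g x\<bar> + a\<^sup>2 \<partial>M)"
  proof (intro bdd_integral_mono[OF finite_measure_axioms] bdd_meas_intros f g g')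
    fix x assume "x \<in> space M"
    from a[OF this] have "\<bar>f x\<bar> \<le> \<bar>g x\<bar> + a" by linarith
    then have "\<bar>f x\<bar>\<^sup>2 \<le> (\<bar>g x\<bar> + a)\<^sup>2" by (intro power_mono) auto
    then show "(f x)\<^sup>2 \<le> (g x)\<^sup>2 + 2 * a * \<bar>g x\<bar> + a\<^sup>2" by (simp add: power2_sum mult_ac)
  qed
  also have "\<dots> = (\<integral>x. (g x)\<^sup>2 \<partial>M) + 2 * a * (\<integral>x. \<bar>g x\<bar> \<partial>M) + a\<^sup>2"
    by (simp add: prob_space)
  also have "\<dots> \<le> (\<integral>x. (g x)\<^sup>2 \<partial>M) + 2 * a * sqrt (\<integral>x. (g x)\<^sup>2 \<partial>M) + a\<^sup>2"
    using a0 integral_abs_le_sqrt[OF g] by (intro add_mono mult_left_mono) auto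
  also have "\<dots> = (sqrt (\<integral>x. (g x)\<^sup>2 \<partial>M) + a)\<^sup>2"
    by (simp add: power2_sum mult_ac)
  finally show ?thesis using a0 by (simp add: real_le_lsqrt)
qed

lemma (in prob_space) Bernstein_mgf:
  assumes \<phi>: "bdd_meas M \<phi>" and bd: "\<And>z. z \<in> space M \<Longrightarrow> \<bar>\<phi> z\<bar> \<le> b" and l: "l \<ge> 0" "l * (2 * b) \<le> 1"
  shows "(\<integral>z. exp (l * ((\<integral>z. \<phi> z \<partial>M) - \<phi> z)) \<partial>M) \<le> exp (l\<^sup>2 * (\<integral>z. (\<phi> z)\<^sup>2 \<partial>M))"
proof -
  define \<mu> where "\<mu> = (\<integral>z. \<phi> z \<partial>M)"
  have \<mu>: "\<bar>\<mu>\<bar> \<le> b" unfolding \<mu>_def by (rule bdd_integral_abs_le[OF \<phi> bd])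
  have b: "bdd_meas M (\<lambda>x. (\<phi> x)\<^sup>2)" by (intro bdd_meas_intros \<phi>)
  note i [simp] = b[THEN bdd_meas_integrable[OF finite_measure_axioms]] \<phi>[THEN bdd_meas_integrable[OF finite_measure_axioms]]
  \<comment> \<open>Since \<open>\<mu> - \<phi> z\<close> is at most \<open>2 * b\<close>, the
    argument stays below 1, where the quadratic bound for the exponential is valid. The term with
    \<open>\<mu>\<^sup>2\<close> is dropped in the end: the raw second moment is what is later
    compared with the norm of the predictor.\<close>
  have "(\<integral>z. exp (l * (\<mu> - \<phi> z)) \<partial>M) \<le> (\<integral>z. 1 + l * (\<mu> - \<phi> z) + (l * (\<mu> - \<phi> z))\<^sup>2 \<partial>M)"
  proof (intro bdd_integral_mono[OF finite_measure_axioms] bdd_meas_intros \<phi> exp_le_quadratic)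
    fix z assume "z \<in> space M"
    then have "l * (\<mu> - \<phi> z) \<le> l * (2 * b)" using \<mu> bd[of z] l by (intro mult_left_mono) auto
    then show "l * (\<mu> - \<phi> z) \<le> 1" using l by simp
  qed
  also have "\<dots> = (\<integral>z. (1 + l * \<mu> + l\<^sup>2 * \<mu>\<^sup>2) - (l + 2 * l\<^sup>2 * \<mu>) * \<phi> z + l\<^sup>2 * (\<phi> z)\<^sup>2 \<partial>M)"
    by (intro Bochner_Integration.integral_cong) (auto simp: power2_eq_square algebra_simps)
  also have "\<dots> = (1 + l * \<mu> + l\<^sup>2 * \<mu>\<^sup>2) - (l + 2 * l\<^sup>2 * \<mu>) * \<mu> + l\<^sup>2 * (\<integral>z. (\<phi> z)\<^sup>2 \<partial>M)"
    by (simp add: prob_space \<mu>_def)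
  also have "\<dots> = 1 + (l\<^sup>2 * (\<integral>z. (\<phi> z)\<^sup>2 \<partial>M) - l\<^sup>2 * \<mu>\<^sup>2)"
    by (simp add: power2_eq_square algebra_simps)
  also have "\<dots> \<le> 1 + l\<^sup>2 * (\<integral>z. (\<phi> z)\<^sup>2 \<partial>M)" by simp
  also have "\<dots> \<le> exp (l\<^sup>2 * (\<integral>z. (\<phi> z)\<^sup>2 \<partial>M))" by (rule exp_ge_add_one_self)
  finally show ?thesis by (simp add: \<mu>_def)
qed

context iid_sequence
begin

section \<open>Bernstein and McDiarmid tail bounds\<close>

lemma Bernstein_tail:
  assumes \<phi>: "bdd_meas P \<phi>" and bd: "\<And>z. z \<in> space P \<Longrightarrow> \<bar>\<phi> z\<bar> \<le> b" and b: "b > 0" and x: "x > 0" and n: "n > 0"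
  shows "1 - exp (- x) \<le> measure \<Omega> {S \<in> space \<Omega>. (\<Sum>i<n. (\<integral>z. \<phi> z \<partial>P) - \<phi> (S i))
     \<le> 2 * b * x + 2 * sqrt (real n * x) * sqrt (\<integral>z. (\<phi> z)\<^sup>2 \<partial>P)}"
proof -
  interpret O: prob_space \<Omega> by (rule prob_space_\<Omega>)
  define v where "v = (\<integral>z. (\<phi> z)\<^sup>2 \<partial>P)"
  define \<mu> where "\<mu> = (\<integral>z. \<phi> z \<partial>P)"
  \<comment> \<open>For positive \<open>v\<close>, \<open>1 / r\<close> minimises
    \<open>l * (n * v) + x / l\<close>. Adding \<open>2 * b\<close> to the denominator of
    \<open>l\<close> enforces \<open>l * (2 * b) \<le> 1\<close> and costs only the term
    \<open>2 * b * x\<close>.\<close>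
  define r where "r = sqrt (n * v / x)"
  define l where "l = 1 / (2 * b + r)"
  define Z where "Z = (\<lambda>S. \<Sum>i<n. \<mu> - \<phi> (S i))"
  have v: "v \<ge> 0" by (simp add: v_def)
  have r: "r \<ge> 0" using v x by (simp add: r_def)
  have l: "l > 0" using b r by (simp add: l_def add_pos_nonneg)
  have lb: "l * (2 * b) \<le> 1" using b r by (simp add: l_def field_simps)
  have r2: "n * v = r\<^sup>2 * x" using v x by (simp add: r_def)
  have Z: "bdd_meas \<Omega> Z"
    unfolding Z_def by (intro bdd_meas_sum bdd_meas_diff bdd_meas_const bdd_meas_compose[OF \<phi>]) simp
  have "(\<integral>S. exp (l * Z S) \<partial>\<Omega>) = (\<integral>S. exp (\<Sum>i<n. l * (\<mu> - \<phi> (S i))) \<partial>\<Omega>)"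
    by (simp add: Z_def sum_distrib_left)
  also have "\<dots> = (\<Prod>i<n. \<integral>y. exp (l * (\<mu> - \<phi> y)) \<partial>P)"
    by (rule integral_exp_sum[where Y = "\<lambda>i y. l * (\<mu> - \<phi> y)"]) (auto intro!: bdd_meas_intros \<phi>)
  also have "\<dots> \<le> (\<Prod>i<n. exp (l\<^sup>2 * v))"
    unfolding \<mu>_def v_def using l lb by (intro prod_mono conjI Bernstein_mgf[OF \<phi> bd]) auto
  also have "\<dots> = exp (l\<^sup>2 * (n * v))" by (simp add: exp_of_nat_mult[symmetric] mult_ac)
  finally have "1 - exp (- x) \<le> measure \<Omega> {S \<in> space \<Omega>. Z S \<le> (l\<^sup>2 * (n * v) + x) / l}"
    by (rule O.chernoff_event[OF Z l])
  also have "\<dots> \<le> measure \<Omega> {S \<in> space \<Omega>. Z S \<le> 2 * b * x + 2 * sqrt (real n * x) * sqrt v}"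
  proof (intro O.finite_measure_mono)
    have "(l\<^sup>2 * (n * v) + x) / l = l * r * (r * x) + (2 * b + r) * x"
      using l unfolding r2 by (simp add: power2_eq_square add_divide_distrib) (simp add: l_def)
    also have "\<dots> \<le> 1 * (r * x) + (2 * b + r) * x"
      using b r x by (intro add_mono mult_right_mono) (auto simp: l_def field_simps)
    also have "\<dots> = 2 * b * x + 2 * (r * x)" by (simp add: algebra_simps)
    also have "r * x = sqrt (real n * x) * sqrt v"
    proof -
      have "r * x = sqrt (n * v / x * x\<^sup>2)" using x by (subst real_sqrt_mult) (simp add: r_def)
      also have "n * v / x * x\<^sup>2 = (real n * x) * v" using x by (simp add: power2_eq_square)
      finally show ?thesis by (simp add: real_sqrt_mult)
    qed
    finally have le: "(l\<^sup>2 * (n * v) + x) / l \<le> 2 * b * x + 2 * sqrt (real n * x) * sqrt v" by simp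
    show "{S \<in> space \<Omega>. Z S \<le> (l\<^sup>2 * (n * v) + x) / l} \<subseteq> {S \<in> space \<Omega>. Z S \<le> 2 * b * x + 2 * sqrt (real n * x) * sqrt v}"
      using le by auto
    show "{S \<in> space \<Omega>. Z S \<le> 2 * b * x + 2 * sqrt (real n * x) * sqrt v} \<in> sets \<Omega>"
      using bdd_meas_measurable[OF Z] by measurable
  qed
  finally show ?thesis by (simp add: Z_def v_def \<mu>_def)
qed

lemma McDiarmid_lower_tail:
  assumes F: "bdd_meas \<Omega> F" and a: "a > 0" and x: "x > 0" and n: "n > 0"
    and diff: "\<And>S i y. S \<in> space \<Omega> \<Longrightarrow> i < n \<Longrightarrow> y \<in> space P \<Longrightarrow> \<bar>F (S(i := y)) - F S\<bar> \<le> a"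
  shows "1 - exp (- x) \<le> measure \<Omega> {S \<in> space \<Omega>. (\<integral>S. F S \<partial>\<Omega>) - F S \<le> a * sqrt (real n * x / 2)}"
proof -
  interpret O: prob_space \<Omega> by (rule prob_space_\<Omega>)
  define e where "e = (\<integral>S. F S \<partial>\<Omega>)"
  define r where "r = sqrt (real n * x / 2)"
  \<comment> \<open>This \<open>l\<close> minimises
    \<open>l * (real n * a\<^sup>2) / 8 + x / l\<close>; both terms then equal
    \<open>a * r / 2\<close>.\<close>
  define l where "l = 2 * x / (a * r)"
  have r: "r > 0" using n x by (simp add: r_def)
  have r2: "real n * x = 2 * r\<^sup>2" using n x by (simp add: r_def)
  have l: "l > 0" using a x r by (simp add: l_def)
  have Z: "bdd_meas \<Omega> (\<lambda>S. e - F S)" by (intro bdd_meas_intros F)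
  have "(\<integral>S. exp (l * (e - F S)) \<partial>\<Omega>) = (\<integral>S. exp (- l * (F S - e)) \<partial>\<Omega>)"
    by (simp add: algebra_simps)
  also have "\<dots> \<le> exp ((- l)\<^sup>2 * (\<Sum>i<n. a\<^sup>2) / 8)"
    unfolding e_def using diff by (intro McDiarmid_mgf[OF prob_space_axioms fin_I F]) auto
  finally have "1 - exp (- x) \<le> measure \<Omega> {S \<in> space \<Omega>. e - F S \<le> ((- l)\<^sup>2 * (\<Sum>i<n. a\<^sup>2) / 8 + x) / l}"
    by (rule O.chernoff_event[OF Z l])
  also have "((- l)\<^sup>2 * (\<Sum>i<n. a\<^sup>2) / 8 + x) / l = l * (real n * a\<^sup>2) / 8 + x / l"
    using l by (simp add: power2_eq_square field_simps)
  also have "x / l = a * r / 2" using x by (simp add: l_def)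
  also have "l * (real n * a\<^sup>2) / 8 = (real n * x) * a / (4 * r)"
    using a r by (simp add: l_def power2_eq_square)
  also have "\<dots> = a * r / 2" unfolding r2 using r by (simp add: power2_eq_square)
  finally show ?thesis by (simp add: e_def r_def)
qed

section \<open>Generalization gap of a stable predictor\<close>

lemma bdd_meas_update_pair:
  assumes h: "bdd_meas \<Omega> h" and i: "i < n"
  shows "bdd_meas (\<Omega> \<Otimes>\<^sub>M P) (\<lambda>(S, y). h (S(i := y)))"
proof -
  have "(\<lambda>p. (fst p)(i := snd p)) \<in> measurable (\<Omega> \<Otimes>\<^sub>M P) \<Omega>"
    using i by (intro measurable_fun_upd[where J = "{..<n}"]) auto
  from bdd_meas_compose[OF h this] show ?thesis by (simp add: case_prod_unfold)
qed

text \<open>Three events, each failing with probability at most \<open>exp (- x)\<close>: the dyadic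
  bound for the centred \<open>g i\<close> with differences \<open>2 * a\<close>, Bernstein for the
  i.i.d. remainder, and McDiarmid for the norm \<open>q\<close>, which replaces the norm of
  \<open>\<phi>\<close> by that of the predictor at hand.\<close>

lemma stable_generalization_pos:
  fixes f :: "(nat \<Rightarrow> 'z) \<Rightarrow> 'z \<Rightarrow> real"
  assumes n: "n > 0" and K: "n \<le> 2 ^ K" "\<And>k. k < K \<Longrightarrow> 2 ^ k \<le> n"
    and f [measurable]: "case_prod f \<in> borel_measurable (\<Omega> \<Otimes>\<^sub>M P)"
    and M: "M > 0" "\<And>S z. S \<in> space \<Omega> \<Longrightarrow> z \<in> space P \<Longrightarrow> \<bar>f S z\<bar> \<le> M"
    and a: "a > 0" "\<And>S i y z. S \<in> space \<Omega> \<Longrightarrow> i < n \<Longrightarrow> y \<in> space P \<Longrightarrow> z \<in> space P \<Longrightarrow> \<bar>f (S(i := y)) z - f S z\<bar> \<le> a"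
    and x: "x \<ge> 1"
  shows "\<exists>E\<in>sets \<Omega>. 1 - 3 * exp (- x) \<le> measure \<Omega> E \<and>
    (\<forall>S\<in>E. (\<integral>z. f S z \<partial>P) - (\<Sum>i<n. f S (S i)) / n
       \<le> 4 * a * x + 4 * real K * a * (1 + x) + 2 * M * x / n + 2 * sqrt (x / n) * sqrt (\<integral>z. (f S z)\<^sup>2 \<partial>P))"
proof -
  interpret O: prob_space \<Omega> by (rule prob_space_\<Omega>)
  have fin: "finite_measure P" "finite_measure \<Omega>" by (rule finite_measure_axioms finite_measure_\<Omega>)+
  have fp: "bdd_meas (\<Omega> \<Otimes>\<^sub>M P) (case_prod f)"
    using f M by (intro bdd_measI[where b = M]) (auto simp: space_pair_measure)
  have fS: "bdd_meas P (f S)" if "S \<in> space \<Omega>" for S using bdd_meas_Pair[OF fp that] .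
  have fz: "bdd_meas \<Omega> (\<lambda>S. f S z)" if "z \<in> space P" for z
    using bdd_meas_compose[OF fp, of "\<lambda>S. (S, z)" \<Omega>] that by simp
  have fsw: "bdd_meas (P \<Otimes>\<^sub>M \<Omega>) (\<lambda>(z, S). f S z)"
    using bdd_meas_compose[OF fp, of "\<lambda>(z, S). (S, z)" "P \<Otimes>\<^sub>M \<Omega>"] by (simp add: case_prod_unfold)
  define L where "L = (\<lambda>S. \<integral>z. f S z \<partial>P)"
  define \<phi> where "\<phi> = (\<lambda>z. \<integral>S. f S z \<partial>\<Omega>)"
  define \<mu> where "\<mu> = (\<integral>z. \<phi> z \<partial>P)"
  define q where "q = (\<lambda>S. sqrt (\<integral>z. (f S z)\<^sup>2 \<partial>P))"
  \<comment> \<open>Coordinate \<open>i\<close> of the training sample is replaced by a fresh point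
    \<open>y\<close>, so that the original \<open>S i\<close> serves as an independent test
    point.\<close>
  define g where "g = (\<lambda>i S. \<integral>y. L (S(i := y)) - f (S(i := y)) (S i) \<partial>P)"
  have L: "bdd_meas \<Omega> L" unfolding L_def by (rule bdd_meas_integral[OF prob_space_axioms fp])
  have \<phi>: "bdd_meas P \<phi>" unfolding \<phi>_def by (rule bdd_meas_integral[OF prob_space_\<Omega> fsw])
  have \<mu>L: "\<mu> = (\<integral>S. L S \<partial>\<Omega>)"
    unfolding \<mu>_def \<phi>_def L_def by (rule bdd_Fubini[OF prob_space_\<Omega> prob_space_axioms fp])
  have f2: "bdd_meas (\<Omega> \<Otimes>\<^sub>M P) (\<lambda>(S, z). (f S z)\<^sup>2)"
    using bdd_meas_power[OF fp, of 2] by (simp add: case_prod_unfold)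
  have q: "bdd_meas \<Omega> q"
    unfolding q_def by (intro bdd_meas_sqrt bdd_meas_integral[OF prob_space_axioms f2])
  have comp: "S i \<in> space P" if "S \<in> space \<Omega>" "i < n" for S i using component_in_space that by auto
  have upd: "S(i := y) \<in> space \<Omega>" if "S \<in> space \<Omega>" "i < n" "y \<in> space P" for S i y using update_in_space that by auto
  have gp: "bdd_meas (\<Omega> \<Otimes>\<^sub>M P) (\<lambda>(S, y). L (S(i := y)) - f (S(i := y)) (S i))" if i: "i < n" for i
  proof -
    have "(\<lambda>p. ((fst p)(i := snd p), fst p i)) \<in> measurable (\<Omega> \<Otimes>\<^sub>M P) (\<Omega> \<Otimes>\<^sub>M P)"
      using i by (intro measurable_Pair measurable_fun_upd[where J = "{..<n}"]) auto
    from bdd_meas_diff[OF bdd_meas_update_pair[OF L i] bdd_meas_compose[OF fp this]]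
    show ?thesis by (simp add: case_prod_unfold)
  qed
  have gS: "bdd_meas P (\<lambda>y. L (S(i := y)) - f (S(i := y)) (S i))" if "S \<in> space \<Omega>" "i < n" for S i
    using bdd_meas_Pair[OF gp[OF that(2)] that(1)] .
  have g: "bdd_meas \<Omega> (g i)" if i: "i < n" for i
    unfolding g_def by (rule bdd_meas_integral[OF prob_space_axioms gp[OF i]])
  have Ldiff: "\<bar>L (S(i := y)) - L S\<bar> \<le> a" if "S \<in> space \<Omega>" "i < n" "y \<in> space P" for S i y
    unfolding L_def using that by (intro bdd_integral_diff_abs_le fS upd a(2)) auto
  \<comment> \<open>The predictor trained on \<open>S(i := y)\<close> does not see
    \<open>S i\<close>. After Fubini the test point is integrated first, which turns its loss into
    the population loss \<open>L\<close> and leaves 0.\<close>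
  have mean0: "avg {i} (g i) S = 0" if i: "i < n" and S: "S \<in> space \<Omega>" for i S
  proof -
    have LS: "bdd_meas P (\<lambda>y. L (S(i := y)))" using bdd_meas_update[OF L S] i by simp
    have "(\<lambda>p. (S(i := snd p), fst p)) \<in> measurable (P \<Otimes>\<^sub>M P) (\<Omega> \<Otimes>\<^sub>M P)"
      using i S by (intro measurable_Pair measurable_fun_upd[where J = "{..<n}"]) auto
    from bdd_meas_compose[OF fp this]
    have fpp: "bdd_meas (P \<Otimes>\<^sub>M P) (\<lambda>(w, y). f (S(i := y)) w)" by (simp add: case_prod_unfold)
    have "(\<lambda>p. S(i := snd p)) \<in> measurable (P \<Otimes>\<^sub>M P) \<Omega>"
      using i S by (intro measurable_fun_upd[where J = "{..<n}"]) auto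
    from bdd_meas_diff[OF bdd_meas_compose[OF L this] fpp]
    have pp: "bdd_meas (P \<Otimes>\<^sub>M P) (\<lambda>(w, y). L (S(i := y)) - f (S(i := y)) w)" by (simp add: case_prod_unfold)
    have "avg {i} (g i) S = (\<integral>w. g i (S(i := w)) \<partial>P)"
      using avg_singleton[OF g[OF i] S] i by simp
    also have "\<dots> = (\<integral>w. (\<integral>y. L (S(i := y)) - f (S(i := y)) w \<partial>P) \<partial>P)"
      by (simp only: g_def fun_upd_upd fun_upd_same)
    also have "\<dots> = (\<integral>y. (\<integral>w. L (S(i := y)) - f (S(i := y)) w \<partial>P) \<partial>P)"
      by (rule bdd_Fubini[OF prob_space_axioms prob_space_axioms pp, symmetric])
    also have "\<dots> = (\<integral>y. 0 \<partial>P)"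
    proof (rule Bochner_Integration.integral_cong[OF refl])
      fix y assume y: "y \<in> space P"
      show "(\<integral>w. L (S(i := y)) - f (S(i := y)) w \<partial>P) = 0"
        using bdd_meas_integrable[OF fin(1) fS[OF upd[OF S i y]]] by (simp add: L_def prob_space)
    qed
    finally show ?thesis by simp
  qed
  have gdiff: "\<bar>g i (S(j := w)) - g i S\<bar> \<le> 2 * a"
    if i: "i < n" and j: "j < n" "j \<noteq> i" and S: "S \<in> space \<Omega>" and w: "w \<in> space P" for i j S w
    unfolding g_def
  proof (rule bdd_integral_diff_abs_le[OF gS[OF upd[OF S j(1) w] i] gS[OF S i]])
    fix y assume y: "y \<in> space P"
    have eq: "(S(j := w))(i := y) = (S(i := y))(j := w)" using j by (simp add: fun_upd_twist)
    have "\<bar>L ((S(i := y))(j := w)) - L (S(i := y))\<bar> \<le> a" by (intro Ldiff upd S i y j w)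
    moreover have "\<bar>f ((S(i := y))(j := w)) (S i) - f (S(i := y)) (S i)\<bar> \<le> a"
      by (intro a(2) upd S i y j w comp)
    moreover have "(S(j := w)) i = S i" using j by simp
    ultimately show "\<bar>L ((S(j := w))(i := y)) - f ((S(j := w))(i := y)) ((S(j := w)) i) - (L (S(i := y)) - f (S(i := y)) (S i))\<bar> \<le> 2 * a"
      unfolding eq by simp
  qed
  \<comment> \<open>With the test point \<open>S i\<close> fixed, all of the training sample is
    resampled, so \<open>L\<close> averages to \<open>\<mu>\<close> and the loss at
    \<open>S i\<close> to \<open>\<phi> (S i)\<close>.\<close>
  have avg_all: "avg ({..<n} - {i}) (g i) S = \<mu> - \<phi> (S i)" if i: "i < n" and S: "S \<in> space \<Omega>" for i S
  proof -
    define k where "k = (\<lambda>T. L T - f T (S i))"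
    have k: "bdd_meas \<Omega> k" unfolding k_def by (intro bdd_meas_diff L fz comp S i)
    have "avg ({..<n} - {i}) (g i) S = (\<integral>T. avg {i} k T \<partial>\<Omega>)"
      unfolding avg_def[of "{..<n} - {i}"]
    proof (rule Bochner_Integration.integral_cong[OF refl])
      fix T assume T: "T \<in> space \<Omega>"
      have "mix ({..<n} - {i}) S T = T(i := S i)"
        using S T i by (auto simp: mix_def fun_eq_iff space_PiM PiE_def extensional_def)
      then show "g i (mix ({..<n} - {i}) S T) = avg {i} k T"
        using avg_singleton[OF k T] i by (simp only: g_def k_def fun_upd_upd fun_upd_same lessThan_iff)
    qed
    also have "\<dots> = (\<integral>T. k T \<partial>\<Omega>)" by (rule integral_avg[OF k])
    also have "\<dots> = \<mu> - \<phi> (S i)"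
      unfolding k_def \<mu>L \<phi>_def
      by (intro Bochner_Integration.integral_diff bdd_meas_integrable[OF fin(2)] L fz comp S i)
    finally show ?thesis .
  qed
  \<comment> \<open>Replacing coordinate \<open>i\<close> changes the population loss and the loss
    at the test point by at most \<open>a\<close> each.\<close>
  have g_ge: "L S - f S (S i) \<le> g i S + 2 * a" if S: "S \<in> space \<Omega>" and i: "i < n" for S i
  proof -
    have "L S - f S (S i) - 2 * a \<le> g i S"
      unfolding g_def
    proof (rule bdd_integral_ge[OF gS[OF S i]])
      fix y assume y: "y \<in> space P"
      show "L S - f S (S i) - 2 * a \<le> L (S(i := y)) - f (S(i := y)) (S i)"
        using Ldiff[OF S i y] a(2)[OF S i y comp[OF S i]] by linarith
    qed
    then show ?thesis by simp
  qed
  \<comment> \<open>Minkowski's inequality by duality: the squared norm of \<open>\<phi>\<close> is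
    the expectation over \<open>S\<close> of its inner product with \<open>f S\<close>, and
    Cauchy-Schwarz bounds this by the norm of \<open>\<phi>\<close> times the mean of
    \<open>q\<close>.\<close>
  have sqrt_v: "sqrt (\<integral>z. (\<phi> z)\<^sup>2 \<partial>P) \<le> (\<integral>S. q S \<partial>\<Omega>)"
  proof -
    define v where "v = (\<integral>z. (\<phi> z)\<^sup>2 \<partial>P)"
    have pf: "bdd_meas (\<Omega> \<Otimes>\<^sub>M P) (\<lambda>(S, z). \<phi> z * f S z)"
      using bdd_meas_mult[OF bdd_meas_compose[OF \<phi>, of snd] fp] by (simp add: case_prod_unfold)
    have "v = (\<integral>z. (\<integral>S. \<phi> z * f S z \<partial>\<Omega>) \<partial>P)"
      by (simp add: v_def \<phi>_def power2_eq_square)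
    also have "\<dots> = (\<integral>S. (\<integral>z. \<phi> z * f S z \<partial>P) \<partial>\<Omega>)"
      by (rule bdd_Fubini[OF prob_space_\<Omega> prob_space_axioms pf])
    also have "\<dots> \<le> (\<integral>S. sqrt v * q S \<partial>\<Omega>)"
      unfolding v_def q_def
      by (intro bdd_integral_mono[OF fin(2)] bdd_meas_integral[OF prob_space_axioms pf] integral_mult_le_sqrt[OF fin(1)] \<phi> fS
          bdd_meas_mult bdd_meas_const bdd_meas_sqrt bdd_meas_integral[OF prob_space_axioms f2])
    also have "\<dots> = sqrt v * (\<integral>S. q S \<partial>\<Omega>)" by simp
    finally have le: "sqrt v * sqrt v \<le> sqrt v * (\<integral>S. q S \<partial>\<Omega>)" by (simp add: v_def)
    have "0 \<le> (\<integral>S. q S \<partial>\<Omega>)" by (intro Bochner_Integration.integral_nonneg) (simp add: q_def)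
    moreover have "0 \<le> sqrt v" by (simp add: v_def)
    ultimately have "sqrt v \<le> (\<integral>S. q S \<partial>\<Omega>)" using mult_left_le_imp_le[OF le]
      by (cases "sqrt v = 0") linarith+
    then show ?thesis by (simp add: v_def)
  qed
  define E1 where "E1 = {S \<in> space \<Omega>. (\<Sum>i<n. g i S - avg ({..<n} - {i}) (g i) S) \<le> 2 * real n * real K * (2 * a) * (1 + x)}"
  define E2 where "E2 = {S \<in> space \<Omega>. (\<Sum>i<n. \<mu> - \<phi> (S i)) \<le> 2 * M * x + 2 * sqrt (real n * x) * sqrt (\<integral>z. (\<phi> z)\<^sup>2 \<partial>P)}"
  define E3 where "E3 = {S \<in> space \<Omega>. (\<integral>S. q S \<partial>\<Omega>) - q S \<le> a * sqrt (real n * x / 2)}"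
  have m1: "1 - exp (- x) \<le> measure \<Omega> E1"
    unfolding E1_def using a(1) by (intro dyadic_tail K n g mean0 gdiff) auto
  have m2: "1 - exp (- x) \<le> measure \<Omega> E2"
    unfolding E2_def \<mu>_def
  proof (rule Bernstein_tail[OF \<phi> _ M(1) _ n])
    show "\<bar>\<phi> z\<bar> \<le> M" if "z \<in> space P" for z
      unfolding \<phi>_def using that by (intro O.bdd_integral_abs_le fz M) auto
  qed (use x in simp)
  have m3: "1 - exp (- x) \<le> measure \<Omega> E3"
    unfolding E3_def
  proof (rule McDiarmid_lower_tail[OF q a(1) _ n])
    fix S i y assume S: "S \<in> space \<Omega>" and i: "i < n" and y: "y \<in> space P"
    have "\<bar>f (S(i := y)) z - f S z\<bar> \<le> a" "\<bar>f S z - f (S(i := y)) z\<bar> \<le> a" if "z \<in> space P" for z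
      using a(2)[OF S i y that] by (simp_all add: abs_minus_commute)
    then show "\<bar>q (S(i := y)) - q S\<bar> \<le> a"
      using L2_norm_diff_le[OF fS[OF upd[OF S i y]] fS[OF S], of a] L2_norm_diff_le[OF fS[OF S] fS[OF upd[OF S i y]], of a]
      by (simp add: q_def abs_le_iff algebra_simps)
  qed (use x in simp)
  have sets [measurable]: "E1 \<in> sets \<Omega>" "E2 \<in> sets \<Omega>" "E3 \<in> sets \<Omega>"
  proof -
    have "bdd_meas \<Omega> (\<lambda>S. \<Sum>i<n. g i S - avg ({..<n} - {i}) (g i) S)"
      by (intro bdd_meas_sum bdd_meas_diff bdd_meas_avg g) auto
    from bdd_meas_measurable[OF this] show "E1 \<in> sets \<Omega>" unfolding E1_def by measurable
    have "bdd_meas \<Omega> (\<lambda>S. \<Sum>i<n. \<mu> - \<phi> (S i))"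
      by (intro bdd_meas_sum bdd_meas_diff bdd_meas_const bdd_meas_compose[OF \<phi>]) simp
    from bdd_meas_measurable[OF this] show "E2 \<in> sets \<Omega>" unfolding E2_def by measurable
    from bdd_meas_measurable[OF q] show "E3 \<in> sets \<Omega>" unfolding E3_def by measurable
  qed
  show ?thesis
  proof (intro bexI[of _ "E1 \<inter> E2 \<inter> E3"] conjI ballI)
    have "measure \<Omega> (space \<Omega> - E1 \<inter> E2 \<inter> E3) \<le> measure \<Omega> ((space \<Omega> - E1) \<union> (space \<Omega> - E2) \<union> (space \<Omega> - E3))"
      by (intro O.finite_measure_mono) auto
    also have "\<dots> \<le> measure \<Omega> (space \<Omega> - E1) + measure \<Omega> (space \<Omega> - E2) + measure \<Omega> (space \<Omega> - E3)"
      by (intro order_trans[OF measure_Un_le] add_mono) auto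
    also have "\<dots> \<le> 3 * exp (- x)" using m1 m2 m3 by (simp add: O.prob_compl)
    finally show "1 - 3 * exp (- x) \<le> measure \<Omega> (E1 \<inter> E2 \<inter> E3)" by (simp add: O.prob_compl)
  next
    fix S assume SE: "S \<in> E1 \<inter> E2 \<inter> E3"
    then have S: "S \<in> space \<Omega>" by (simp add: E1_def)
    have n0: "real n > 0" using n by simp
    have "n * L S - (\<Sum>i<n. f S (S i)) = (\<Sum>i<n. L S - f S (S i))" by (simp add: sum_subtractf)
    also have "\<dots> \<le> (\<Sum>i<n. g i S + 2 * a)" using g_ge[OF S] by (intro sum_mono) auto
    also have "\<dots> = (\<Sum>i<n. g i S - avg ({..<n} - {i}) (g i) S) + (\<Sum>i<n. avg ({..<n} - {i}) (g i) S) + n * (2 * a)"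
      by (simp add: sum.distrib sum_subtractf)
    also have "(\<Sum>i<n. avg ({..<n} - {i}) (g i) S) = (\<Sum>i<n. \<mu> - \<phi> (S i))"
      using avg_all[OF _ S] by (intro sum.cong) auto
    also have "(\<Sum>i<n. g i S - avg ({..<n} - {i}) (g i) S) + (\<Sum>i<n. \<mu> - \<phi> (S i)) + n * (2 * a)
       \<le> 2 * real n * real K * (2 * a) * (1 + x) + (2 * M * x + 2 * sqrt (real n * x) * (q S + a * sqrt (real n * x / 2))) + n * (2 * a)"
    proof (intro add_mono order_refl)
      show "(\<Sum>i<n. g i S - avg ({..<n} - {i}) (g i) S) \<le> 2 * real n * real K * (2 * a) * (1 + x)"
        using SE by (simp add: E1_def)
      have "(\<Sum>i<n. \<mu> - \<phi> (S i)) \<le> 2 * M * x + 2 * sqrt (real n * x) * sqrt (\<integral>z. (\<phi> z)\<^sup>2 \<partial>P)"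
        using SE by (simp add: E2_def)
      also have "\<dots> \<le> 2 * M * x + 2 * sqrt (real n * x) * (q S + a * sqrt (real n * x / 2))"
        using SE sqrt_v x M(1) by (intro add_mono mult_left_mono) (auto simp: E3_def)
      finally show "(\<Sum>i<n. \<mu> - \<phi> (S i)) \<le> 2 * M * x + 2 * sqrt (real n * x) * (q S + a * sqrt (real n * x / 2))" .
    qed
    also have "2 * sqrt (real n * x) * (q S + a * sqrt (real n * x / 2)) \<le> 2 * n * (sqrt (x / n) * q S) + 2 * n * a * x"
    proof -
      have 1: "sqrt (real n * x) = n * sqrt (x / n)"
        using n0 x by (simp add: real_sqrt_mult real_sqrt_divide field_simps)
      have "2 * sqrt (real n * x) * (a * sqrt (real n * x / 2)) = sqrt 2 * a * (real n * x)"
        using n0 x by (simp add: real_sqrt_divide field_simps)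
      also have "\<dots> \<le> 2 * a * (real n * x)"
        using a x by (intro mult_right_mono) (auto simp: real_le_lsqrt)
      finally have "2 * sqrt (real n * x) * (a * sqrt (real n * x / 2)) \<le> 2 * n * a * x" by (simp add: mult_ac)
      moreover have "2 * sqrt (real n * x) * q S = 2 * n * (sqrt (x / n) * q S)" by (simp only: 1 mult.assoc)
      ultimately show ?thesis unfolding distrib_left by (intro add_mono) auto
    qed
    also have "2 * real n * real K * (2 * a) * (1 + x) + (2 * M * x + (2 * n * (sqrt (x / n) * q S) + 2 * n * a * x)) + n * (2 * a)
       \<le> n * (4 * a * x + 4 * real K * a * (1 + x) + 2 * M * x / n + 2 * sqrt (x / n) * q S)"
    proof -
      \<comment> \<open>Since \<open>x \<ge> 1\<close>, the replacement cost \<open>2 * a\<close>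
        joins the \<open>2 * a * x\<close> from the norm estimate to form
        \<open>4 * a * x\<close>.\<close>
      have "n * (2 * a) \<le> n * (2 * a * x)" using a x by (intro mult_left_mono) auto
      then show ?thesis using n0 by (simp add: algebra_simps)
    qed
    finally have "n * (L S - (\<Sum>i<n. f S (S i)) / n) \<le> n * (4 * a * x + 4 * real K * a * (1 + x) + 2 * M * x / n + 2 * sqrt (x / n) * q S)"
      using n0 by (simp add: right_diff_distrib)
    then show "(\<integral>z. f S z \<partial>P) - (\<Sum>i<n. f S (S i)) / n
       \<le> 4 * a * x + 4 * real K * a * (1 + x) + 2 * M * x / n + 2 * sqrt (x / n) * sqrt (\<integral>z. (f S z)\<^sup>2 \<partial>P)"
      using n0 by (simp add: L_def q_def)
  qed (rule sets.Int sets)+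
qed

text \<open>Extends the bound to \<open>a = 0\<close> and \<open>M = 0\<close>. If
  \<open>M = 0\<close> the predictor vanishes; otherwise \<open>a\<close> is enlarged by a small
  positive amount.\<close>

lemma stable_generalization:
  fixes f :: "(nat \<Rightarrow> 'z) \<Rightarrow> 'z \<Rightarrow> real"
  assumes n: "n > 0" and K: "n \<le> 2 ^ K" "\<And>k. k < K \<Longrightarrow> 2 ^ k \<le> n"
    and f: "case_prod f \<in> borel_measurable (\<Omega> \<Otimes>\<^sub>M P)"
    and M: "M \<ge> 0" "\<And>S z. S \<in> space \<Omega> \<Longrightarrow> z \<in> space P \<Longrightarrow> \<bar>f S z\<bar> \<le> M"
    and a: "a \<ge> 0" "\<And>S i y z. S \<in> space \<Omega> \<Longrightarrow> i < n \<Longrightarrow> y \<in> space P \<Longrightarrow> z \<in> space P \<Longrightarrow> \<bar>f (S(i := y)) z - f S z\<bar> \<le> a"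
    and x: "x \<ge> 1"
  shows "\<exists>E\<in>sets \<Omega>. 1 - 3 * exp (- x) \<le> measure \<Omega> E \<and>
    (\<forall>S\<in>E. (\<integral>z. f S z \<partial>P) - (\<Sum>i<n. f S (S i)) / n
       \<le> 4 * a * x + 4 * real K * a * (1 + x) + 3 * M * x / n + 2 * sqrt (x / n) * sqrt (\<integral>z. (f S z)\<^sup>2 \<partial>P))"
proof (cases "M = 0")
  case True
  interpret O: prob_space \<Omega> by (rule prob_space_\<Omega>)
  have z: "f S z = 0" if "S \<in> space \<Omega>" "z \<in> space P" for S z using M(2)[OF that] True by simp
  have "(\<integral>z. f S z \<partial>P) - (\<Sum>i<n. f S (S i)) / n
       \<le> 4 * a * x + 4 * real K * a * (1 + x) + 3 * M * x / n + 2 * sqrt (x / n) * sqrt (\<integral>z. (f S z)\<^sup>2 \<partial>P)"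
    if S: "S \<in> space \<Omega>" for S
  proof -
    have "(\<integral>z. f S z \<partial>P) = (\<integral>z. 0 \<partial>P)" using z[OF S] by (intro Bochner_Integration.integral_cong) auto
    moreover have "(\<Sum>i<n. f S (S i)) = 0" using z[OF S component_in_space[OF S]] by simp
    ultimately show ?thesis
      using a x True by simp
  qed
  then show ?thesis using O.prob_space by (intro bexI[of _ "space \<Omega>"]) auto
next
  case False
  then have M0: "M > 0" using M by simp
  \<comment> \<open>Chosen so that, for \<open>x \<ge> 1\<close>, enlarging \<open>a\<close> by
    \<open>e\<close> costs at most \<open>M * x / n\<close>; this raises the coefficient of that
    term from 2 to 3.\<close>
  define e where "e = M / (real n * (4 + 8 * real K))"
  have e0: "e > 0" using M0 n by (simp add: e_def)
  have "\<exists>E\<in>sets \<Omega>. 1 - 3 * exp (- x) \<le> measure \<Omega> E \<and>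
    (\<forall>S\<in>E. (\<integral>z. f S z \<partial>P) - (\<Sum>i<n. f S (S i)) / n
       \<le> 4 * (a + e) * x + 4 * real K * (a + e) * (1 + x) + 2 * M * x / n + 2 * sqrt (x / n) * sqrt (\<integral>z. (f S z)\<^sup>2 \<partial>P))"
  proof (intro stable_generalization_pos n K f M0 M(2) x)
    show "a + e > 0" using a(1) e0 by simp
    fix S i y z assume "S \<in> space \<Omega>" "i < n" "y \<in> space P" "z \<in> space P"
    from a(2)[OF this] show "\<bar>f (S(i := y)) z - f S z\<bar> \<le> a + e" using e0 by linarith
  qed
  then obtain E where E: "E \<in> sets \<Omega>" "1 - 3 * exp (- x) \<le> measure \<Omega> E" and
    le: "\<forall>S\<in>E. (\<integral>z. f S z \<partial>P) - (\<Sum>i<n. f S (S i)) / n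
       \<le> 4 * (a + e) * x + 4 * real K * (a + e) * (1 + x) + 2 * M * x / n + 2 * sqrt (x / n) * sqrt (\<integral>z. (f S z)\<^sup>2 \<partial>P)"
    by blast
  have le2: "4 * (a + e) * x + 4 * real K * (a + e) * (1 + x) + 2 * M * x / n \<le> 4 * a * x + 4 * real K * a * (1 + x) + 3 * M * x / n"
  proof -
    have "4 * real K * e * 1 \<le> 4 * real K * e * x" using e0 x by (intro mult_left_mono) auto
    moreover have "e * (4 + 8 * real K) * x = M * x / n" using n by (simp add: e_def)
    moreover have "3 * M * x / n = 3 * (M * x / n)" "2 * M * x / n = 2 * (M * x / n)" by auto
    ultimately show ?thesis by (simp only: distrib_left distrib_right mult_1_right mult_ac)
  qed
  show ?thesis
  proof (intro bexI[OF _ E(1)] conjI ballI E(2))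
    fix S assume "S \<in> E"
    with le have "(\<integral>z. f S z \<partial>P) - (\<Sum>i<n. f S (S i)) / n
       \<le> 4 * (a + e) * x + 4 * real K * (a + e) * (1 + x) + 2 * M * x / n + 2 * sqrt (x / n) * sqrt (\<integral>z. (f S z)\<^sup>2 \<partial>P)"
      by blast
    with le2 show "(\<integral>z. f S z \<partial>P) - (\<Sum>i<n. f S (S i)) / n
       \<le> 4 * a * x + 4 * real K * a * (1 + x) + 3 * M * x / n + 2 * sqrt (x / n) * sqrt (\<integral>z. (f S z)\<^sup>2 \<partial>P)"
      by linarith
  qed
qed

end

subsection \<open>Strongly-convex-strongly-concave losses\<close>

text \<open>In the gradient inequalities based at the intermediate point, weighted by
  \<open>1 - t\<close> and \<open>t\<close>, the linear terms cancel, and t^2 (1 - t) + t (1 - t)^2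
  equals t (1 - t). The conclusion is free of gradients, so it can be integrated over the
  data.\<close>

lemma strongly_convex_combination:
  assumes f: "strongly_convex_on_grad C f f' \<rho>" and C: "convex C" "x \<in> C" "y \<in> C" and t: "0 \<le> t" "t \<le> 1"
  shows "f ((1 - t) *\<^sub>R x + t *\<^sub>R y) + \<rho> / 2 * (t * (1 - t)) * (norm (x - y))\<^sup>2 \<le> (1 - t) * f x + t * f y"
proof -
  define z where "z = (1 - t) *\<^sub>R x + t *\<^sub>R y"
  define d where "d = x - y"
  have z: "z \<in> C" unfolding z_def using C t by (intro convexD) auto
  have xz: "x - z = t *\<^sub>R d" and yz: "y - z = - ((1 - t) *\<^sub>R d)"
    by (simp_all add: z_def d_def algebra_simps)
  have "f x - f z \<ge> t * (f' z \<bullet> d) + \<rho> / 2 * (t\<^sup>2 * (norm d)\<^sup>2)"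
    using f C z unfolding strongly_convex_on_grad_def
    by (metis xz inner_scaleR_right norm_scaleR power_mult_distrib power2_abs)
  moreover have "f y - f z \<ge> - ((1 - t) * (f' z \<bullet> d)) + \<rho> / 2 * ((1 - t)\<^sup>2 * (norm d)\<^sup>2)"
    using f C z unfolding strongly_convex_on_grad_def
    by (metis yz inner_scaleR_right inner_minus_right norm_minus_cancel norm_scaleR power_mult_distrib power2_abs)
  ultimately have "(1 - t) * (f x - f z) + t * (f y - f z) \<ge>
     (1 - t) * (t * (f' z \<bullet> d) + \<rho> / 2 * (t\<^sup>2 * (norm d)\<^sup>2)) + t * (- ((1 - t) * (f' z \<bullet> d)) + \<rho> / 2 * ((1 - t)\<^sup>2 * (norm d)\<^sup>2))"
    using t by (intro add_mono mult_left_mono) auto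
  moreover have "(1 - t) * (t * (f' z \<bullet> d) + \<rho> / 2 * (t\<^sup>2 * (norm d)\<^sup>2)) + t * (- ((1 - t) * (f' z \<bullet> d)) + \<rho> / 2 * ((1 - t)\<^sup>2 * (norm d)\<^sup>2))
     = \<rho> / 2 * (t * (1 - t)) * (norm d)\<^sup>2"
    by (simp add: field_simps power2_eq_square)
  moreover have "(1 - t) * (f x - f z) + t * (f y - f z) = (1 - t) * f x + t * f y - f z"
    by (simp add: algebra_simps)
  ultimately show ?thesis unfolding z_def d_def by linarith
qed

text \<open>Convexity replaces the mean value theorem: the gradient inequality based at
  \<open>v\<close> bounds \<open>f v - f u\<close> from above, and exchanging the two points gives
  the modulus.\<close>

lemma strongly_convex_Lipschitz:
  assumes f: "strongly_convex_on_grad C f f' \<rho>" and \<rho>: "\<rho> \<ge> 0" and x: "x \<in> C" and y: "y \<in> C"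
    and G: "\<And>x. x \<in> C \<Longrightarrow> norm (f' x) \<le> G"
  shows "\<bar>f x - f y\<bar> \<le> G * norm (x - y)"
proof -
  have le: "f v - f u \<le> G * norm (u - v)" if u: "u \<in> C" and v: "v \<in> C" for u v
  proof -
    have "f' v \<bullet> (u - v) + \<rho> / 2 * (norm (u - v))\<^sup>2 \<le> f u - f v"
      using f u v by (simp add: strongly_convex_on_grad_def)
    moreover have "0 \<le> \<rho> / 2 * (norm (u - v))\<^sup>2" using \<rho> by simp
    moreover have "\<bar>f' v \<bullet> (u - v)\<bar> \<le> norm (f' v) * norm (u - v)" by (rule Cauchy_Schwarz_ineq2)
    moreover have "norm (f' v) * norm (u - v) \<le> G * norm (u - v)" using G[OF v] by (rule mult_right_mono) simp
    ultimately show ?thesis by linarith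
  qed
  show ?thesis using le[OF x y] le[OF y x] by (simp add: norm_minus_commute abs_le_iff)
qed

text \<open>At the midpoint the quadratic gain \<rho>/8 |x - y|^2 cannot exceed the range
  \<open>M\<close> of \<open>f\<close>, which caps every distance.\<close>

lemma strongly_convex_bounded_domain:
  assumes f: "strongly_convex_on_grad C f f' \<rho>" and \<rho>: "\<rho> > 0" and C: "convex C"
    and bd: "\<And>x. x \<in> C \<Longrightarrow> m \<le> f x \<and> f x \<le> m + M"
  shows "bounded C"
proof (cases "C = {}")
  case False
  then obtain x where x: "x \<in> C" by auto
  have "norm (x - y) \<le> sqrt (8 * M / \<rho>)" if y: "y \<in> C" for y
  proof -
    have h: "f ((1 - 1/2) *\<^sub>R x + (1/2) *\<^sub>R y) + \<rho> / 2 * (1/2 * (1 - 1/2)) * (norm (x - y))\<^sup>2 \<le> (1 - 1/2) * f x + 1/2 * f y"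
      by (rule strongly_convex_combination[OF f C x y]) auto
    have "(1 - 1/2) *\<^sub>R x + (1/2) *\<^sub>R y \<in> C" using C x y by (intro convexD) auto
    with bd[OF this] bd[OF x] bd[OF y] h have "\<rho> / 2 * (1/2 * (1 - 1/2)) * (norm (x - y))\<^sup>2 \<le> M" by argo
    then have "(norm (x - y))\<^sup>2 \<le> 8 * M / \<rho>" using \<rho> by (simp add: field_simps)
    then show ?thesis by (rule real_le_rsqrt)
  qed
  then show ?thesis unfolding bounded_def dist_norm using x by blast
qed simp

section \<open>Standing assumptions, compactness and Lipschitz bounds\<close>

locale saddle_loss = prob_space P for P :: "'z measure" +
  fixes W :: "'a::euclidean_space set" and V :: "'b::euclidean_space set"
    and l :: "'a \<Rightarrow> 'b \<Rightarrow> 'z \<Rightarrow> real" and gw :: "'a \<Rightarrow> 'b \<Rightarrow> 'z \<Rightarrow> 'a" and gv :: "'a \<Rightarrow> 'b \<Rightarrow> 'z \<Rightarrow> 'b"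
    and \<rho> G \<beta> M :: real
  assumes W: "W \<noteq> {}" "closed W" "convex W"
    and V: "V \<noteq> {}" "closed V" "convex V"
    and l_meas: "\<And>w v. w \<in> W \<Longrightarrow> v \<in> V \<Longrightarrow> (\<lambda>z. l w v z) \<in> borel_measurable P"
    and l_diff: "\<And>w v z. w \<in> W \<Longrightarrow> v \<in> V \<Longrightarrow> z \<in> space P \<Longrightarrow>
       ((\<lambda>(w', v'). l w' v' z) has_derivative (\<lambda>(h, k). gw w v z \<bullet> h + gv w v z \<bullet> k))
         (at (w, v) within W \<times> V)"
    and \<rho>: "\<rho> > 0"
    and sconvex: "\<And>v z. v \<in> V \<Longrightarrow> z \<in> space P \<Longrightarrow>
       strongly_convex_on_grad W (\<lambda>w. l w v z) (\<lambda>w. gw w v z) \<rho>"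
    and sconcave: "\<And>w z. w \<in> W \<Longrightarrow> z \<in> space P \<Longrightarrow>
       strongly_convex_on_grad V (\<lambda>v. - l w v z) (\<lambda>v. - gv w v z) \<rho>"
    and gw_bdd: "\<And>w v z. w \<in> W \<Longrightarrow> v \<in> V \<Longrightarrow> z \<in> space P \<Longrightarrow> norm (gw w v z) \<le> G"
    and gv_bdd: "\<And>w v z. w \<in> W \<Longrightarrow> v \<in> V \<Longrightarrow> z \<in> space P \<Longrightarrow> norm (gv w v z) \<le> G"
    and \<beta>: "\<beta> > 0"
    and gv_smooth: "\<And>w w' v z. w \<in> W \<Longrightarrow> w' \<in> W \<Longrightarrow> v \<in> V \<Longrightarrow> z \<in> space P \<Longrightarrow>
       norm (gv w v z - gv w' v z) \<le> \<beta> * norm (w - w')"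
    and l_bdd: "\<And>w v z. w \<in> W \<Longrightarrow> v \<in> V \<Longrightarrow> z \<in> space P \<Longrightarrow> 0 \<le> l w v z \<and> l w v z \<le> M"
begin

lemma bdd_meas_l: "w \<in> W \<Longrightarrow> v \<in> V \<Longrightarrow> bdd_meas P (l w v)"
  using l_bdd by (intro bdd_measI[where b = M] l_meas) auto

lemma G_nonneg: "G \<ge> 0"
proof -
  obtain w v z where "w \<in> W" "v \<in> V" "z \<in> space P" using W V not_empty by auto
  from gw_bdd[OF this] show ?thesis using norm_ge_zero order_trans by blast
qed

lemma M_nonneg: "M \<ge> 0"
proof -
  obtain w v z where "w \<in> W" "v \<in> V" "z \<in> space P" using W V not_empty by auto
  from l_bdd[OF this] show ?thesis by simp
qed

lemma compact_W: "compact W"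
proof -
  obtain v z where v: "v \<in> V" and z: "z \<in> space P" using V not_empty by auto
  have "bounded W"
    using l_bdd[OF _ v z] by (intro strongly_convex_bounded_domain[OF sconvex[OF v z] \<rho> W(3), of 0 M]) auto
  with W show ?thesis by (simp add: compact_eq_bounded_closed)
qed

lemma compact_V: "compact V"
proof -
  obtain w z where w: "w \<in> W" and z: "z \<in> space P" using W not_empty by auto
  have "bounded V"
    using l_bdd[OF w _ z] by (intro strongly_convex_bounded_domain[OF sconcave[OF w z] \<rho> V(3), of "-M" M]) auto
  with V show ?thesis by (simp add: compact_eq_bounded_closed)
qed

lemma l_Lipschitz_w: "w \<in> W \<Longrightarrow> w' \<in> W \<Longrightarrow> v \<in> V \<Longrightarrow> z \<in> space P \<Longrightarrow> \<bar>l w v z - l w' v z\<bar> \<le> G * norm (w - w')"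
  using \<rho> gw_bdd by (intro strongly_convex_Lipschitz[OF sconvex]) auto

lemma l_Lipschitz_v:
  assumes "w \<in> W" "v \<in> V" "v' \<in> V" "z \<in> space P" shows "\<bar>l w v z - l w v' z\<bar> \<le> G * norm (v - v')"
proof -
  have "\<bar>- l w v z - - l w v' z\<bar> \<le> G * norm (v - v')"
    using \<rho> gv_bdd assms by (intro strongly_convex_Lipschitz[OF sconcave]) auto
  then show ?thesis by simp
qed

lemma l_Lipschitz:
  assumes "w \<in> W" "w' \<in> W" "v \<in> V" "v' \<in> V" "z \<in> space P"
  shows "\<bar>l w v z - l w' v' z\<bar> \<le> G * (norm (w - w') + norm (v - v'))"
  using l_Lipschitz_w[of w w' v z] l_Lipschitz_v[of w' v v' z] assms by (simp add: distrib_left)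

lemma pop_loss_bounds: "w \<in> W \<Longrightarrow> v \<in> V \<Longrightarrow> 0 \<le> pop_loss P l w v" "w \<in> W \<Longrightarrow> v \<in> V \<Longrightarrow> pop_loss P l w v \<le> M"
  unfolding pop_loss_def using l_bdd by (auto intro!: bdd_integral_le bdd_integral_ge bdd_meas_l)

lemma pop_loss_Lipschitz_w:
  "w \<in> W \<Longrightarrow> w' \<in> W \<Longrightarrow> v \<in> V \<Longrightarrow> \<bar>pop_loss P l w v - pop_loss P l w' v\<bar> \<le> G * norm (w - w')"
  unfolding pop_loss_def by (intro bdd_integral_diff_abs_le bdd_meas_l l_Lipschitz_w)

lemma pop_loss_Lipschitz_v:
  "w \<in> W \<Longrightarrow> v \<in> V \<Longrightarrow> v' \<in> V \<Longrightarrow> \<bar>pop_loss P l w v - pop_loss P l w v'\<bar> \<le> G * norm (v - v')"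
  unfolding pop_loss_def by (intro bdd_integral_diff_abs_le bdd_meas_l l_Lipschitz_v)

text \<open>The derivative-free form of strong concavity is integrated over the data, which avoids
  differentiating under the integral sign.\<close>

lemma pop_loss_concave:
  assumes w: "w \<in> W" and v: "v \<in> V" "v' \<in> V" and t: "0 \<le> t" "t \<le> 1"
  shows "(1 - t) * pop_loss P l w v + t * pop_loss P l w v' + \<rho> / 2 * (t * (1 - t)) * (norm (v - v'))\<^sup>2
     \<le> pop_loss P l w ((1 - t) *\<^sub>R v + t *\<^sub>R v')"
proof -
  define u where "u = (1 - t) *\<^sub>R v + t *\<^sub>R v'"
  define k where "k = \<rho> / 2 * (t * (1 - t)) * (norm (v - v'))\<^sup>2"
  have u: "u \<in> V" unfolding u_def using V v t by (intro convexD) auto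
  note i [simp] = bdd_meas_integrable[OF finite_measure_axioms bdd_meas_l[OF w v(1)]]
    bdd_meas_integrable[OF finite_measure_axioms bdd_meas_l[OF w v(2)]]
  have "(\<integral>z. (1 - t) * l w v z + t * l w v' z + k \<partial>P) \<le> (\<integral>z. l w u z \<partial>P)"
  proof (intro bdd_integral_mono[OF finite_measure_axioms] bdd_meas_intros bdd_meas_l w v u)
    fix z assume z: "z \<in> space P"
    show "(1 - t) * l w v z + t * l w v' z + k \<le> l w u z"
      using strongly_convex_combination[OF sconcave[OF w z] V(3) v t] by (simp add: u_def k_def algebra_simps)
  qed
  also have "(\<integral>z. (1 - t) * l w v z + t * l w v' z + k \<partial>P) = (1 - t) * pop_loss P l w v + t * pop_loss P l w v' + k"
    by (simp add: pop_loss_def prob_space)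
  finally show ?thesis by (simp add: u_def k_def pop_loss_def)
qed

section \<open>The best response and the minimiser of the primal risk\<close>

definition vstar :: "'a \<Rightarrow> 'b" where
  "vstar w = (SOME v. v \<in> V \<and> (\<forall>v'\<in>V. pop_loss P l w v' \<le> pop_loss P l w v))"

lemma vstar:
  assumes w: "w \<in> W"
  shows vstar_in: "vstar w \<in> V" and vstar_max: "\<And>v. v \<in> V \<Longrightarrow> pop_loss P l w v \<le> pop_loss P l w (vstar w)"
proof -
  have "G-lipschitz_on V (pop_loss P l w)"
    using pop_loss_Lipschitz_v[OF w] G_nonneg by (intro lipschitz_onI) (auto simp: dist_norm)
  then have "continuous_on V (pop_loss P l w)" by (rule lipschitz_on_continuous_on)
  then have "\<exists>v. v \<in> V \<and> (\<forall>v'\<in>V. pop_loss P l w v' \<le> pop_loss P l w v)"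
    using continuous_attains_sup[OF compact_V V(1)] by blast
  from someI_ex[OF this] show "vstar w \<in> V" "\<And>v. v \<in> V \<Longrightarrow> pop_loss P l w v \<le> pop_loss P l w (vstar w)"
    by (auto simp: vstar_def)
qed

text \<open>Strong concavity on the segment from the maximiser to \<open>v\<close>, set against
  maximality and divided by \<open>t\<close>, gives the claim with the factor \<open>1 - t\<close>,
  which is arbitrarily close to 1. It also shows that the maximiser picked by \<open>vstar\<close>
  is the only one.\<close>

lemma vstar_growth:
  assumes w: "w \<in> W" and v: "v \<in> V"
  shows "\<rho> / 2 * (norm (vstar w - v))\<^sup>2 \<le> pop_loss P l w (vstar w) - pop_loss P l w v"
proof (rule field_le_mult_one_interval)
  fix s :: real assume s: "0 < s" "s < 1"
  define t where "t = 1 - s"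
  have t: "0 < t" "t < 1" using s by (auto simp: t_def)
  note v1 = vstar_in[OF w]
  have u: "(1 - t) *\<^sub>R vstar w + t *\<^sub>R v \<in> V" using V v v1 t by (intro convexD) auto
  have "(1 - t) * pop_loss P l w (vstar w) + t * pop_loss P l w v + \<rho> / 2 * (t * (1 - t)) * (norm (vstar w - v))\<^sup>2
     \<le> pop_loss P l w (vstar w)"
    using pop_loss_concave[OF w v1 v, of t] vstar_max[OF w u] t by simp
  then have "t * (s * (\<rho> / 2 * (norm (vstar w - v))\<^sup>2)) \<le> t * (pop_loss P l w (vstar w) - pop_loss P l w v)"
    by (simp add: t_def algebra_simps)
  then show "s * (\<rho> / 2 * (norm (vstar w - v))\<^sup>2) \<le> pop_loss P l w (vstar w) - pop_loss P l w v"
    using t by simp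
qed

text \<open>The mean value theorem on the segment from \<open>v'\<close> to \<open>v\<close> for the
  difference of the losses at \<open>w\<close> and \<open>w'\<close>, whose derivative is controlled
  by the Lipschitz dependence of \<open>gv\<close> on \<open>w\<close>.\<close>

lemma l_cross_difference:
  assumes w: "w \<in> W" "w' \<in> W" and v: "v \<in> V" "v' \<in> V" and z: "z \<in> space P"
  shows "(l w v z - l w v' z) - (l w' v z - l w' v' z) \<le> \<beta> * norm (w - w') * norm (v - v')"
proof -
  define \<phi> where "\<phi> = (\<lambda>t. v' + t *\<^sub>R (v - v'))"
  have \<phi>V: "\<phi> t \<in> V" if "0 \<le> t" "t \<le> 1" for t
  proof -
    have "\<phi> t = (1 - t) *\<^sub>R v' + t *\<^sub>R v" by (simp add: \<phi>_def algebra_simps)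
    then show ?thesis using convexD[OF V(3) v(2,1), of "1 - t" t] that by simp
  qed
  have der: "((\<lambda>t. l u (\<phi> t) z) has_derivative (\<lambda>h. h * (gv u (\<phi> t) z \<bullet> (v - v')))) (at t within {0..1})"
    if u: "u \<in> W" and t: "0 \<le> t" "t \<le> 1" for u t
  proof -
    have 1: "((\<lambda>t. (u, \<phi> t)) has_derivative (\<lambda>h. (0, h *\<^sub>R (v - v')))) (at t within {0..1})"
      unfolding \<phi>_def by (auto intro!: derivative_eq_intros)
    have 2: "((\<lambda>(w', v'). l w' v' z) has_derivative (\<lambda>(h, k). gw u (\<phi> t) z \<bullet> h + gv u (\<phi> t) z \<bullet> k))
         (at (u, \<phi> t) within ((\<lambda>t. (u, \<phi> t)) ` {0..1}))"
      by (rule has_derivative_subset[OF l_diff[OF u \<phi>V[OF t] z]]) (use u \<phi>V in auto)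
    from has_derivative_in_compose[OF 1 2] show ?thesis by simp
  qed
  have "\<exists>t\<in>{0..1}. (l w (\<phi> 1) z - l w' (\<phi> 1) z) - (l w (\<phi> 0) z - l w' (\<phi> 0) z)
      = (1 - 0) * (gv w (\<phi> t) z \<bullet> (v - v')) - (1 - 0) * (gv w' (\<phi> t) z \<bullet> (v - v'))"
    by (rule mvt_very_simple[where f' = "\<lambda>t h. h * (gv w (\<phi> t) z \<bullet> (v - v')) - h * (gv w' (\<phi> t) z \<bullet> (v - v'))"])
      (auto intro!: has_derivative_diff der w)
  then obtain t where t: "0 \<le> t" "t \<le> 1"
    and eq: "(l w v z - l w' v z) - (l w v' z - l w' v' z) = (gv w (\<phi> t) z - gv w' (\<phi> t) z) \<bullet> (v - v')"
    by (auto simp: \<phi>_def inner_diff_left)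
  have "(gv w (\<phi> t) z - gv w' (\<phi> t) z) \<bullet> (v - v') \<le> norm (gv w (\<phi> t) z - gv w' (\<phi> t) z) * norm (v - v')"
    by (rule norm_cauchy_schwarz)
  also have "\<dots> \<le> \<beta> * norm (w - w') * norm (v - v')"
    by (intro mult_right_mono gv_smooth w \<phi>V t z) simp
  finally show ?thesis using eq by linarith
qed

text \<open>Adding the growth inequalities at \<open>w\<close> and \<open>w'\<close>, each tested
  with the best response to the other, bounds \<rho> |v - v'|^2 by a mixed second difference of the
  loss, which is at most \<beta> |w - w'| |v - v'|.\<close>

lemma vstar_Lipschitz:
  assumes w: "w \<in> W" "w' \<in> W"
  shows "norm (vstar w - vstar w') \<le> \<beta> / \<rho> * norm (w - w')"
proof -
  define v v' where "v = vstar w" and "v' = vstar w'"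
  have v: "v \<in> V" "v' \<in> V" using vstar_in w by (auto simp: v_def v'_def)
  note i [simp] = bdd_meas_integrable[OF finite_measure_axioms bdd_meas_l]
  have "\<rho> * (norm (v - v'))\<^sup>2 \<le> (pop_loss P l w v - pop_loss P l w v') - (pop_loss P l w' v - pop_loss P l w' v')"
    using vstar_growth[OF w(1) v(2)] vstar_growth[OF w(2) v(1)] by (simp add: v_def v'_def norm_minus_commute)
  also have "\<dots> = (\<integral>z. (l w v z - l w v' z) - (l w' v z - l w' v' z) \<partial>P)"
    using w v by (simp add: pop_loss_def)
  also have "\<dots> \<le> \<beta> * norm (w - w') * norm (v - v')"
    by (intro bdd_integral_le bdd_meas_intros bdd_meas_l w v l_cross_difference)
  finally have "(\<rho> * norm (v - v')) * norm (v - v') \<le> (\<beta> * norm (w - w')) * norm (v - v')"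
    by (simp add: power2_eq_square mult.assoc)
  then have "\<rho> * norm (v - v') \<le> \<beta> * norm (w - w')"
    using \<beta> by (cases "norm (v - v') = 0") (auto simp: mult_le_cancel_right)
  then show ?thesis using \<rho> by (simp add: v_def v'_def field_simps)
qed

lemma pop_risk_eq: "w \<in> W \<Longrightarrow> pop_risk P l V w = pop_loss P l w (vstar w)"
  unfolding pop_risk_def using vstar by (intro cSup_eq_maximum) auto

text \<open>A supremum of \<open>G\<close>-Lipschitz functions is \<open>G\<close>-Lipschitz, so
  compactness of \<open>W\<close> supplies a minimiser.\<close>

lemma pop_risk_attains_inf:
  obtains w where "w \<in> W" "(INF w\<in>W. pop_risk P l V w) = pop_risk P l V w"
proof -
  have le: "pop_risk P l V w - pop_risk P l V w' \<le> G * norm (w - w')" if w: "w \<in> W" "w' \<in> W" for w w'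
    using pop_loss_Lipschitz_w[OF w vstar_in[OF w(1)]] vstar_max[OF w(2) vstar_in[OF w(1)]]
    by (simp add: pop_risk_eq w)
  have "G-lipschitz_on W (pop_risk P l V)"
  proof (rule lipschitz_onI[OF _ G_nonneg])
    fix w w' assume "w \<in> W" "w' \<in> W"
    then show "dist (pop_risk P l V w) (pop_risk P l V w') \<le> G * dist w w'"
      using le[of w w'] le[of w' w] by (simp add: dist_real_def dist_norm norm_minus_commute abs_le_iff)
  qed
  then have "continuous_on W (pop_risk P l V)" by (rule lipschitz_on_continuous_on)
  then obtain w where w: "w \<in> W" "\<And>w'. w' \<in> W \<Longrightarrow> pop_risk P l V w \<le> pop_risk P l V w'"
    using continuous_attains_inf[OF compact_W W(1)] by blast
  then have "(INF w\<in>W. pop_risk P l V w) = pop_risk P l V w"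
    by (intro cInf_eq_minimum) auto
  with w show ?thesis using that by blast
qed

text \<open>McShane's formula over a countable dense set turns Lipschitz continuity in \<open>(w, v)\<close> into joint
  measurability.\<close>

lemma measurable_l_compose:
  assumes X [measurable]: "X \<in> borel_measurable N" and Y [measurable]: "Y \<in> borel_measurable N"
    and XW: "\<And>s. s \<in> space N \<Longrightarrow> X s \<in> W" and YV: "\<And>s. s \<in> space N \<Longrightarrow> Y s \<in> V"
  shows "(\<lambda>(s, z). l (X s) (Y s) z) \<in> borel_measurable (N \<Otimes>\<^sub>M P)"
proof -
  obtain D where D: "countable D" "D \<subseteq> W \<times> V" "W \<times> V \<subseteq> closure D" using separable by blast
  have D0: "D \<noteq> {}" using D W V by (metis Sigma_empty1 closure_empty equals0D mem_Sigma_iff subset_empty subsetI ex_in_conv)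
  define F where "F = (\<lambda>d (s, z). l (fst d) (snd d) z + G * (norm (X s - fst d) + norm (Y s - snd d)))"
  have lower: "l (X s) (Y s) z \<le> F d (s, z)" if "s \<in> space N" "z \<in> space P" "d \<in> D" for s z d
    using l_Lipschitz[of "X s" "fst d" "Y s" "snd d" z] XW[OF that(1)] YV[OF that(1)] that D(2)
    by (fastforce simp: F_def)
  have bdd: "bdd_below ((\<lambda>d. F d p) ` D)" if "p \<in> space (N \<Otimes>\<^sub>M P)" for p
    using that lower by (intro bdd_belowI2[where m = "case p of (s, z) \<Rightarrow> l (X s) (Y s) z"]) (auto simp: space_pair_measure)
  have eq: "l (X s) (Y s) z = (INF d\<in>D. F d (s, z))" if s: "s \<in> space N" and z: "z \<in> space P" for s z
  proof (rule antisym)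
    show "l (X s) (Y s) z \<le> (INF d\<in>D. F d (s, z))"
      by (rule cINF_greatest[OF D0]) (rule lower[OF s z])
    show "(INF d\<in>D. F d (s, z)) \<le> l (X s) (Y s) z"
    proof (rule field_le_epsilon)
      fix e :: real assume e: "e > 0"
      \<comment> \<open>The penalty in \<open>F\<close> and the Lipschitz error of moving to
        \<open>d\<close> each cost at most \<open>G * (2 * e')\<close>, so four multiples of
        \<open>G * e'\<close> must fit into \<open>e\<close>; adding 1 to \<open>G\<close> avoids
        dividing by zero.\<close>
      define e' where "e' = e / (4 * (G + 1))"
      have e': "e' > 0" using e G_nonneg by (simp add: e'_def)
      have "(X s, Y s) \<in> closure D" using D(3) XW[OF s] YV[OF s] by auto
      then obtain d where d: "d \<in> D" "dist d (X s, Y s) < e'" using e' by (auto simp: closure_approachable)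
      have dWV: "fst d \<in> W" "snd d \<in> V" using d D by auto
      have "norm (X s - fst d) \<le> e'" "norm (Y s - snd d) \<le> e'"
        using d(2) dist_fst_le[of d "(X s, Y s)"] dist_snd_le[of d "(X s, Y s)"]
        by (auto simp: dist_norm norm_minus_commute)
      then have nrm: "G * (norm (X s - fst d) + norm (Y s - snd d)) \<le> G * (2 * e')"
        using G_nonneg by (intro mult_left_mono) auto
      have "4 * (G * e') \<le> e" using e G_nonneg by (simp add: e'_def field_simps)
      moreover have "F d (s, z) \<le> l (X s) (Y s) z + 2 * (G * (norm (X s - fst d) + norm (Y s - snd d)))"
        using l_Lipschitz[OF XW[OF s] dWV(1) YV[OF s] dWV(2) z] by (simp add: F_def abs_le_iff)
      ultimately have "F d (s, z) \<le> l (X s) (Y s) z + e" using nrm by linarith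
      moreover have "(INF d\<in>D. F d (s, z)) \<le> F d (s, z)"
        using bdd[of "(s, z)"] s z d by (intro cINF_lower) (auto simp: space_pair_measure)
      ultimately show "(INF d\<in>D. F d (s, z)) \<le> l (X s) (Y s) z + e" by linarith
    qed
  qed
  have "(\<lambda>p. INF d\<in>D. F d p) \<in> borel_measurable (N \<Otimes>\<^sub>M P)"
  proof (rule borel_measurable_cINF[OF D(1) _ bdd])
    fix d assume "d \<in> D"
    then have [measurable]: "l (fst d) (snd d) \<in> borel_measurable P" using D by (intro l_meas) auto
    show "F d \<in> borel_measurable (N \<Otimes>\<^sub>M P)" unfolding F_def by measurable
  qed
  also have "?this \<longleftrightarrow> ?thesis"
    using eq by (intro measurable_cong) (auto simp: space_pair_measure)
  finally show ?thesis .
qed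

text \<open>Although \<open>vstar\<close> is defined by choice, its Lipschitz continuity on
  \<open>W\<close> makes it Borel there.\<close>

lemma measurable_vstar:
  assumes X [measurable]: "X \<in> borel_measurable N" and XW: "\<And>s. s \<in> space N \<Longrightarrow> X s \<in> W"
  shows "(\<lambda>s. vstar (X s)) \<in> borel_measurable N"
proof -
  have "(\<beta> / \<rho>)-lipschitz_on W vstar"
    using vstar_Lipschitz \<beta> \<rho> by (intro lipschitz_onI) (auto simp: dist_norm)
  then have "continuous_on W vstar" by (rule lipschitz_on_continuous_on)
  then have "vstar \<in> borel_measurable (restrict_space borel W)" by (rule borel_measurable_continuous_on_restrict)
  moreover have "X \<in> measurable N (restrict_space borel W)"
    using X XW by (intro measurable_restrict_space2) auto
  ultimately show ?thesis by (rule measurable_compose[rotated])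
qed

section \<open>Empirical risk and the second moment of the loss\<close>

lemma emp_loss_bounds:
  assumes S: "S \<in> {..<n} \<rightarrow>\<^sub>E space P" and w: "w \<in> W" and v: "v \<in> V" and n: "n > 0"
  shows "0 \<le> emp_loss l n S w v" "emp_loss l n S w v \<le> M"
proof -
  have b: "0 \<le> l w v (S i)" "l w v (S i) \<le> M" if "i < n" for i using l_bdd[OF w v, of "S i"] S that by auto
  show "0 \<le> emp_loss l n S w v" using b by (auto simp: emp_loss_def intro!: divide_nonneg_nonneg sum_nonneg)
  have "(\<Sum>i<n. l w v (S i)) \<le> (\<Sum>i<n. M)" using b by (intro sum_mono) auto
  then show "emp_loss l n S w v \<le> M" using n by (simp add: emp_loss_def field_simps)
qed

lemma emp_loss_diff_le_strong_pd_emp_risk: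
  assumes S: "S \<in> {..<n} \<rightarrow>\<^sub>E space P" and n: "n > 0" and w: "w \<in> W" "w' \<in> W" and v: "v \<in> V" "v' \<in> V"
  shows "emp_loss l n S w v' - emp_loss l n S w' v \<le> strong_pd_emp_risk l n S W V w v"
proof -
  have "emp_loss l n S w v' \<le> (SUP v'\<in>V. emp_loss l n S w v')"
    using emp_loss_bounds[OF S w(1) _ n] by (intro cSUP_upper v bdd_aboveI2[where M = M]) auto
  moreover have "(INF w'\<in>W. emp_loss l n S w' v) \<le> emp_loss l n S w' v"
    using emp_loss_bounds[OF S _ v(1) n] by (intro cINF_lower w bdd_belowI2[where m = 0]) auto
  ultimately show ?thesis by (simp add: strong_pd_emp_risk_def)
qed

text \<open>The range of the loss gives l^2 <= M l pointwise, and AM-GM with weight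
  \<open>\<iota>\<close> absorbs the square root into the fraction \<open>\<iota>\<close> of the
  population loss.\<close>

lemma L2_loss_le:
  assumes w: "w \<in> W" and v: "v \<in> V" and \<iota>: "\<iota> > 0" and y: "y \<ge> 0"
  shows "2 * sqrt y * sqrt (\<integral>z. (l w v z)\<^sup>2 \<partial>P) \<le> \<iota> * pop_loss P l w v + M * y / \<iota>"
proof -
  define L where "L = pop_loss P l w v"
  have L: "L \<ge> 0" unfolding L_def by (rule pop_loss_bounds[OF w v])
  have "(\<integral>z. (l w v z)\<^sup>2 \<partial>P) \<le> (\<integral>z. M * l w v z \<partial>P)"
    using l_bdd[OF w v]
    by (intro bdd_integral_mono[OF finite_measure_axioms] bdd_meas_intros bdd_meas_l w v) (auto simp: power2_eq_square intro: mult_right_mono)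
  also have "\<dots> = M * L" by (simp add: L_def pop_loss_def)
  finally have "2 * sqrt y * sqrt (\<integral>z. (l w v z)\<^sup>2 \<partial>P) \<le> 2 * sqrt y * sqrt (M * L)"
    using y by (intro mult_left_mono) auto
  also have "\<dots> = 2 * (sqrt (\<iota> * L) * sqrt (M * y / \<iota>))"
    using \<iota> by (simp add: real_sqrt_mult[symmetric] mult_ac)
  also have "\<dots> \<le> (sqrt (\<iota> * L))\<^sup>2 + (sqrt (M * y / \<iota>))\<^sup>2"
    using sum_squares_bound[of "sqrt (\<iota> * L)" "sqrt (M * y / \<iota>)"] by simp
  also have "\<dots> = \<iota> * L + M * y / \<iota>" using \<iota> L y M_nonneg by simp
  finally show ?thesis by (simp add: L_def)
qed

end

subsection \<open>The excess risk bound\<close>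

text \<open>For the least admissible \<open>K\<close>, if positive, both
  \<open>(K - 1) * ln 2\<close> and \<open>ln 2\<close> are at most \<open>ln n\<close>, so
  \<open>K * ln 2 \<le> 2 * ln n\<close>, and \<open>ln 2 \<ge> 1/2\<close> yields the constant 4.
  For \<open>n = 1\<close> the depth is 0, matching \<open>ln 1 = 0\<close>.\<close>

lemma dyadic_depth:
  assumes n: "n > 0"
  obtains K :: nat where "n \<le> 2 ^ K" "\<And>k. k < K \<Longrightarrow> 2 ^ k \<le> n" "real K \<le> 4 * ln (real n)"
proof -
  define K where "K = (LEAST K. n \<le> 2 ^ K)"
  have ex: "n \<le> 2 ^ n" by (simp add: less_imp_le)
  have K: "n \<le> 2 ^ K" unfolding K_def by (rule LeastI[of _ n]) (rule ex)
  have lt: "2 ^ k < n" if "k < K" for k using not_less_Least[of k "\<lambda>K. n \<le> 2 ^ K"] that by (simp add: K_def)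
  have "real K \<le> 4 * ln (real n)"
  proof (cases K)
    case 0
    then show ?thesis using n by simp
  next
    case (Suc k)
    have "1 < n" using lt[of 0] Suc by simp
    then have "ln 2 \<le> ln (real n)" by simp
    moreover have "k * ln 2 \<le> ln (real n)"
    proof -
      have "k * ln 2 = ln (2 ^ k :: real)" by (simp add: ln_realpow)
      also have "\<dots> \<le> ln (real n)" using lt[of k] Suc n by (simp flip: of_nat_power add: less_imp_le)
      finally show ?thesis .
    qed
    moreover have "real K * (1 / 2) \<le> real K * ln 2" using ln2_ge_two_thirds by (intro mult_left_mono) auto
    ultimately show ?thesis using Suc by (simp add: algebra_simps)
  qed
  with K lt show ?thesis by (intro that[of K]) (auto intro: less_imp_le)
qed

lemma argument_stable_update:
  assumes A: "argument_stable Z n A \<gamma>" and S: "S \<in> {..<n} \<rightarrow>\<^sub>E Z" and i: "i < n" and y: "y \<in> Z"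
  shows "norm (fst (A (S(i := y))) - fst (A S)) + norm (snd (A (S(i := y))) - snd (A S)) \<le> \<gamma>"
proof -
  have S': "S(i := y) \<in> {..<n} \<rightarrow>\<^sub>E Z" using S i y by (auto simp: PiE_def extensional_def)
  have "{j \<in> {..<n}. (S(i := y)) j \<noteq> S j} \<subseteq> {i}" by auto
  then have "card {j \<in> {..<n}. (S(i := y)) j \<noteq> S j} \<le> card {i}" by (intro card_mono) auto
  then show ?thesis using A S S' unfolding argument_stable_def by (simp del: fun_upd_apply)
qed

theorem theorem3:
  fixes P :: "'z measure"
    and n :: nat
    and W V :: "(real ^ 'p) set"
    and l :: "real ^ 'p \<Rightarrow> real ^ 'p \<Rightarrow> 'z \<Rightarrow> real"
    and gw gv :: "real ^ 'p \<Rightarrow> real ^ 'p \<Rightarrow> 'z \<Rightarrow> real ^ 'p"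
    and \<rho> G \<beta> M\<^sub>l \<gamma> \<iota> \<zeta> :: real
    and A :: "(nat \<Rightarrow> 'z) \<Rightarrow> (real ^ 'p) \<times> (real ^ 'p)"
  assumes P: "prob_space P"
    and n: "n > 0"
    and W: "W \<noteq> {}" "closed W" "convex W"
    and V: "V \<noteq> {}" "closed V" "convex V"
    and l_meas: "\<And>w v. w \<in> W \<Longrightarrow> v \<in> V \<Longrightarrow> (\<lambda>z. l w v z) \<in> borel_measurable P"
    and l_diff: "\<And>w v z. w \<in> W \<Longrightarrow> v \<in> V \<Longrightarrow> z \<in> space P \<Longrightarrow>
       ((\<lambda>(w', v'). l w' v' z) has_derivative (\<lambda>(h, k). gw w v z \<bullet> h + gv w v z \<bullet> k))
         (at (w, v) within W \<times> V)"
    and \<rho>: "\<rho> > 0"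
    and sconvex: "\<And>v z. v \<in> V \<Longrightarrow> z \<in> space P \<Longrightarrow>
       strongly_convex_on_grad W (\<lambda>w. l w v z) (\<lambda>w. gw w v z) \<rho>"
    and sconcave: "\<And>w z. w \<in> W \<Longrightarrow> z \<in> space P \<Longrightarrow>
       strongly_convex_on_grad V (\<lambda>v. - l w v z) (\<lambda>v. - gv w v z) \<rho>"
    and grad_bdd: "\<And>w v z. w \<in> W \<Longrightarrow> v \<in> V \<Longrightarrow> z \<in> space P \<Longrightarrow>
       norm (gw w v z) \<le> G \<and> norm (gv w v z) \<le> G"
    and \<beta>: "\<beta> > 0"
    and smooth_w: "\<And>w w' v z. w \<in> W \<Longrightarrow> w' \<in> W \<Longrightarrow> v \<in> V \<Longrightarrow> z \<in> space P \<Longrightarrow>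
       norm (gw w v z - gw w' v z) \<le> \<beta> * norm (w - w') \<and>
       norm (gv w v z - gv w' v z) \<le> \<beta> * norm (w - w')"
    and smooth_v: "\<And>w v v' z. w \<in> W \<Longrightarrow> v \<in> V \<Longrightarrow> v' \<in> V \<Longrightarrow> z \<in> space P \<Longrightarrow>
       norm (gw w v z - gw w v' z) \<le> \<beta> * norm (v - v') \<and>
       norm (gv w v z - gv w v' z) \<le> \<beta> * norm (v - v')"
    and l_bdd: "\<And>w v z. w \<in> W \<Longrightarrow> v \<in> V \<Longrightarrow> z \<in> space P \<Longrightarrow> 0 \<le> l w v z \<and> l w v z \<le> M\<^sub>l"
    and A_range: "\<And>S. S \<in> PiE {..<n} (\<lambda>_. space P) \<Longrightarrow> A S \<in> W \<times> V"
    and A_meas: "A \<in> borel_measurable (PiM {..<n} (\<lambda>_. P))"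
    and A_stable: "argument_stable (space P) n A \<gamma>"
    and \<iota>: "0 < \<iota>" "\<iota> < 1"
    and \<zeta>: "0 < \<zeta>" "\<zeta> < 1"
  shows "\<exists>E \<in> sets (PiM {..<n} (\<lambda>_. P)).
     measure (PiM {..<n} (\<lambda>_. P)) E \<ge> 1 - \<zeta> \<and>
     (\<forall>S\<in>E.
        pop_risk P l V (fst (A S)) - (1 + \<iota>) / (1 - \<iota>) * (INF w\<in>W. pop_risk P l V w)
        \<le> sqrt ((1 + \<beta> / \<rho>)\<^sup>2 * G\<^sup>2 * \<gamma>\<^sup>2 * (1 + 64 * real n * ln (6 / \<zeta>))
                  / (2 * (1 - \<iota>)\<^sup>2 * real n) * ln (6 / \<zeta>))
          + sqrt ((G\<^sup>2 * \<gamma>\<^sup>2 + 64 * G\<^sup>2 * real n * \<gamma>\<^sup>2 * ln (6 / \<zeta>))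
                  / (2 * (1 - \<iota>)\<^sup>2 * real n) * ln (6 / \<zeta>))
          + 50 * sqrt 2 * (1 + exp 1 + \<beta> / \<rho>) * G * \<gamma> * ln (real n) / (1 - \<iota>)
              * ln (6 * exp 1 / \<zeta>)
          + (24 + 4 * \<iota>) * M\<^sub>l / (3 * \<iota> * (1 - \<iota>) * real n) * ln (6 / \<zeta>)
          + 1 / (1 - \<iota>) * strong_pd_emp_risk l n S W V (fst (A S)) (snd (A S)))"
proof -
  have n0: "real n > 0" using n by simp
  interpret saddle_loss P W V l gw gv \<rho> G \<beta> M\<^sub>l
    using P W V l_meas l_diff \<rho> sconvex sconcave grad_bdd \<beta> smooth_w l_bdd
    by (intro saddle_loss.intro saddle_loss_axioms.intro) auto
  interpret iid_sequence P n by unfold_locales auto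
  interpret O: prob_space \<Omega> by (rule prob_space_\<Omega>)
  have sp: "space \<Omega> = {..<n} \<rightarrow>\<^sub>E space P" by (simp add: space_PiM)
  have Aw: "fst (A S) \<in> W" and Av: "snd (A S) \<in> V" if "S \<in> space \<Omega>" for S
    using A_range that by (force simp: sp)+
  have [measurable]: "(\<lambda>S. fst (A S)) \<in> borel_measurable \<Omega>" "(\<lambda>S. snd (A S)) \<in> borel_measurable \<Omega>"
    using A_meas by (auto simp: borel_prod[symmetric] intro: measurable_compose)
  obtain ws where ws: "ws \<in> W" "(INF w\<in>W. pop_risk P l V w) = pop_risk P l V ws"
    using pop_risk_attains_inf by blast
  obtain K :: nat where K: "n \<le> 2 ^ K" "\<And>k. k < K \<Longrightarrow> 2 ^ k \<le> n" "real K \<le> 4 * ln (real n)"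
    using dyadic_depth[OF n] by blast
  have stable: "norm (fst (A (S(i := y))) - fst (A S)) + norm (snd (A (S(i := y))) - snd (A S)) \<le> \<gamma>"
    if "S \<in> space \<Omega>" "i < n" "y \<in> space P" for S i y
    using argument_stable_update[OF A_stable] that by (simp add: sp)
  have \<gamma>: "\<gamma> \<ge> 0"
  proof -
    \<comment> \<open>A sample is compared with itself, by updating coordinate 0 with its own
      value.\<close>
    obtain S where S: "S \<in> space \<Omega>" using O.not_empty by blast
    then have "S 0 \<in> space P" using n component_in_space by auto
    from stable[OF S n this] show ?thesis by (meson add_nonneg_nonneg norm_ge_zero order_trans)
  qed
  \<comment> \<open>Each of the two gaps fails with probability at most
    \<open>3 * exp (- x)\<close>, so six events share \<open>\<zeta>\<close>.\<close>
  define x where "x = ln (6 / \<zeta>)"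
  have ex: "exp (- x) = \<zeta> / 6" using \<zeta> by (simp add: x_def exp_minus)
  have x1: "x \<ge> 1"
  proof -
    have "\<zeta> * exp 1 \<le> 1 * 3" using exp_le \<zeta> by (intro mult_mono) auto
    then have "exp 1 \<le> 6 / \<zeta>" using \<zeta> by (simp add: field_simps)
    then show ?thesis unfolding x_def using \<zeta> by (subst ln_ge_iff) auto
  qed
  have lnx: "ln (6 * exp 1 / \<zeta>) = 1 + x"
  proof -
    have "ln (6 * exp 1 / \<zeta>) = ln ((6 / \<zeta>) * exp 1)" by simp
    also have "\<dots> = x + 1" using \<zeta> by (subst ln_mult) (auto simp: x_def)
    finally show ?thesis by simp
  qed
  define a2 where "a2 = G * \<gamma>"
  define a1 where "a1 = (1 + \<beta> / \<rho>) * a2"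
  have a2: "a2 \<ge> 0" using G_nonneg \<gamma> by (simp add: a2_def)
  have b0: "\<beta> / \<rho> \<ge> 0" using \<beta> \<rho> by simp
  have a1: "a1 \<ge> 0" using a2 b0 by (simp add: a1_def)
  \<comment> \<open>\<open>f1\<close> is tested at the population best response to the learned
    \<open>w\<close>, so its mean is the primal risk. \<open>f2\<close> carries a minus sign because
    there the empirical loss has to be bounded by the population loss.\<close>
  define f1 where "f1 = (\<lambda>S z. l (fst (A S)) (vstar (fst (A S))) z)"
  define f2 where "f2 = (\<lambda>S z. - l ws (snd (A S)) z)"
  have "\<exists>E\<in>sets \<Omega>. 1 - 3 * exp (- x) \<le> measure \<Omega> E \<and>
    (\<forall>S\<in>E. (\<integral>z. f1 S z \<partial>P) - (\<Sum>i<n. f1 S (S i)) / n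
       \<le> 4 * a1 * x + 4 * real K * a1 * (1 + x) + 3 * M\<^sub>l * x / n + 2 * sqrt (x / n) * sqrt (\<integral>z. (f1 S z)\<^sup>2 \<partial>P))"
  proof (rule stable_generalization[OF n K(1,2) _ M_nonneg _ a1 _ x1])
    show "case_prod f1 \<in> borel_measurable (\<Omega> \<Otimes>\<^sub>M P)"
      unfolding f1_def by (intro measurable_l_compose measurable_vstar vstar_in Aw) auto
    show "\<bar>f1 S z\<bar> \<le> M\<^sub>l" if "S \<in> space \<Omega>" "z \<in> space P" for S z
      using l_bdd[OF Aw vstar_in[OF Aw], of S S z] that by (simp add: f1_def)
    fix S i y z assume S: "S \<in> space \<Omega>" and i: "i < n" and y: "y \<in> space P" and z: "z \<in> space P"
    define w w' where "w = fst (A (S(i := y)))" and "w' = fst (A S)"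
    have S': "S(i := y) \<in> space \<Omega>" using update_in_space[OF S _ y] i by simp
    have w: "w \<in> W" "w' \<in> W" using Aw S S' by (auto simp: w_def w'_def)
    have "norm (snd (A (S(i := y))) - snd (A S)) \<ge> 0" by simp
    then have ww: "norm (w - w') \<le> \<gamma>" using stable[OF S i y] unfolding w_def w'_def by linarith
    have "\<bar>f1 (S(i := y)) z - f1 S z\<bar> \<le> G * (norm (w - w') + norm (vstar w - vstar w'))"
      unfolding f1_def w_def[symmetric] w'_def[symmetric] by (intro l_Lipschitz w vstar_in z)
    also have "\<dots> \<le> G * (norm (w - w') + \<beta> / \<rho> * norm (w - w'))"
      using G_nonneg by (intro mult_left_mono add_mono order_refl vstar_Lipschitz w)
    also have "\<dots> = (G * (1 + \<beta> / \<rho>)) * norm (w - w')" by (simp add: algebra_simps)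
    also have "\<dots> \<le> (G * (1 + \<beta> / \<rho>)) * \<gamma>" using G_nonneg b0 by (intro mult_left_mono ww) auto
    finally show "\<bar>f1 (S(i := y)) z - f1 S z\<bar> \<le> a1" by (simp add: a1_def a2_def mult_ac)
  qed
  then obtain E1 where E1 [measurable]: "E1 \<in> sets \<Omega>" and m1: "1 - 3 * exp (- x) \<le> measure \<Omega> E1"
    and b1: "\<And>S. S \<in> E1 \<Longrightarrow> (\<integral>z. f1 S z \<partial>P) - (\<Sum>i<n. f1 S (S i)) / n
       \<le> 4 * a1 * x + 4 * real K * a1 * (1 + x) + 3 * M\<^sub>l * x / n + 2 * sqrt (x / n) * sqrt (\<integral>z. (f1 S z)\<^sup>2 \<partial>P)"
    by blast
  have "\<exists>E\<in>sets \<Omega>. 1 - 3 * exp (- x) \<le> measure \<Omega> E \<and>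
    (\<forall>S\<in>E. (\<integral>z. f2 S z \<partial>P) - (\<Sum>i<n. f2 S (S i)) / n
       \<le> 4 * a2 * x + 4 * real K * a2 * (1 + x) + 3 * M\<^sub>l * x / n + 2 * sqrt (x / n) * sqrt (\<integral>z. (f2 S z)\<^sup>2 \<partial>P))"
  proof (rule stable_generalization[OF n K(1,2) _ M_nonneg _ a2 _ x1])
    have "(\<lambda>(S, z). l ws (snd (A S)) z) \<in> borel_measurable (\<Omega> \<Otimes>\<^sub>M P)"
      using ws by (intro measurable_l_compose Av) auto
    then show "case_prod f2 \<in> borel_measurable (\<Omega> \<Otimes>\<^sub>M P)"
      unfolding f2_def case_prod_unfold by (rule borel_measurable_uminus)
    show "\<bar>f2 S z\<bar> \<le> M\<^sub>l" if "S \<in> space \<Omega>" "z \<in> space P" for S z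
      using l_bdd[OF ws(1) Av, of S z] that by (simp add: f2_def)
    fix S i y z assume S: "S \<in> space \<Omega>" and i: "i < n" and y: "y \<in> space P" and z: "z \<in> space P"
    define v v' where "v = snd (A (S(i := y)))" and "v' = snd (A S)"
    have S': "S(i := y) \<in> space \<Omega>" using update_in_space[OF S _ y] i by simp
    have v: "v \<in> V" "v' \<in> V" using Av S S' by (auto simp: v_def v'_def)
    have "norm (fst (A (S(i := y))) - fst (A S)) \<ge> 0" by simp
    then have vv: "norm (v - v') \<le> \<gamma>" using stable[OF S i y] unfolding v_def v'_def by linarith
    have "\<bar>f2 (S(i := y)) z - f2 S z\<bar> = \<bar>l ws v z - l ws v' z\<bar>"
      unfolding f2_def v_def[symmetric] v'_def[symmetric] by simp
    also have "\<dots> \<le> G * norm (v - v')" by (intro l_Lipschitz_v ws v z)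
    also have "\<dots> \<le> a2" unfolding a2_def using G_nonneg by (intro mult_left_mono vv)
    finally show "\<bar>f2 (S(i := y)) z - f2 S z\<bar> \<le> a2" .
  qed
  then obtain E2 where E2 [measurable]: "E2 \<in> sets \<Omega>" and m2: "1 - 3 * exp (- x) \<le> measure \<Omega> E2"
    and b2: "\<And>S. S \<in> E2 \<Longrightarrow> (\<integral>z. f2 S z \<partial>P) - (\<Sum>i<n. f2 S (S i)) / n
       \<le> 4 * a2 * x + 4 * real K * a2 * (1 + x) + 3 * M\<^sub>l * x / n + 2 * sqrt (x / n) * sqrt (\<integral>z. (f2 S z)\<^sup>2 \<partial>P)"
    by blast
  show ?thesis
  proof (intro bexI[of _ "E1 \<inter> E2"] conjI ballI)
    have "measure \<Omega> (space \<Omega> - E1 \<inter> E2) \<le> measure \<Omega> ((space \<Omega> - E1) \<union> (space \<Omega> - E2))"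
      by (intro O.finite_measure_mono) auto
    also have "\<dots> \<le> measure \<Omega> (space \<Omega> - E1) + measure \<Omega> (space \<Omega> - E2)"
      by (rule measure_Un_le) auto
    also have "\<dots> \<le> \<zeta>" using m1 m2 by (simp add: O.prob_compl ex)
    finally show "1 - \<zeta> \<le> measure \<Omega> (E1 \<inter> E2)" by (simp add: O.prob_compl)
  next
    fix S assume SE: "S \<in> E1 \<inter> E2"
    then have S: "S \<in> space \<Omega>" using sets.sets_into_space[OF E1] by auto
    define w v where "w = fst (A S)" and "v = snd (A S)"
    have w: "w \<in> W" and v: "v \<in> V" using Aw[OF S] Av[OF S] by (auto simp: w_def v_def)
    note vw = vstar_in[OF w]
    define R Rs where "R = pop_risk P l V w" and "Rs = pop_risk P l V ws"
    define \<Delta> where "\<Delta> = strong_pd_emp_risk l n S W V w v"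
    define y where "y = x / real n"
    have y: "y \<ge> 0" using x1 n0 by (simp add: y_def)
    have div: "(c * Rs + p + q + r * s + t / (3 * \<iota> * m) * x + D) / d
        = c / d * Rs + p / d + q / d + r / d * s + t / (3 * \<iota> * d * m) * x + 1 / d * D" for c d p q r s t m D :: real
      by (simp add: add_divide_distrib mult_ac)
    have My: "M\<^sub>l * y \<ge> 0" using M_nonneg y by simp
    \<comment> \<open>The next four inequalities chain \<open>R\<close>, the empirical losses at
      \<open>(w, vstar w)\<close> and \<open>(ws, v)\<close>, and \<open>Rs\<close>. The norm terms
      have been traded for \<open>\<iota> * R\<close> and for \<open>\<iota>\<close> times the
      population loss at \<open>(ws, v)\<close>.\<close>
    have "R - emp_loss l n S w (vstar w) \<le> 4 * a1 * x + 4 * real K * a1 * (1 + x) + 3 * (M\<^sub>l * y) + (\<iota> * R + M\<^sub>l * y / \<iota>)"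
      using b1[of S] SE L2_loss_le[OF w vw \<iota>(1) y]
      by (simp add: f1_def w_def[symmetric] R_def pop_risk_eq w emp_loss_def pop_loss_def y_def)
    moreover have "emp_loss l n S ws v - pop_loss P l ws v
        \<le> 4 * a2 * x + 4 * real K * a2 * (1 + x) + 3 * (M\<^sub>l * y) + (\<iota> * pop_loss P l ws v + M\<^sub>l * y / \<iota>)"
      using b2[of S] SE L2_loss_le[OF ws(1) v \<iota>(1) y]
      by (simp add: f2_def v_def[symmetric] emp_loss_def pop_loss_def y_def sum_negf)
    moreover have "(1 + \<iota>) * pop_loss P l ws v \<le> (1 + \<iota>) * Rs"
      unfolding Rs_def pop_risk_eq[OF ws(1)] using \<iota> by (intro mult_left_mono vstar_max ws v) auto
    moreover have "emp_loss l n S w (vstar w) - emp_loss l n S ws v \<le> \<Delta>"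
      unfolding \<Delta>_def using S by (intro emp_loss_diff_le_strong_pd_emp_risk n w ws v vw) (simp add: sp)
    \<comment> \<open>Multiplied by \<open>3 * \<iota>\<close>, the coefficients of
      \<open>M\<^sub>l * y\<close> satisfy 18 \<iota> + 6 <= 24 + 4 \<iota>, as \<iota> < 1.\<close>
    moreover have "6 * (M\<^sub>l * y) + 2 * (M\<^sub>l * y / \<iota>) \<le> (24 + 4 * \<iota>) * M\<^sub>l / (3 * \<iota> * real n) * x"
    proof -
      have "\<iota> * (M\<^sub>l * y) \<le> 1 * (M\<^sub>l * y)" using \<iota> My by (intro mult_right_mono) auto
      moreover have "(6 * (M\<^sub>l * y) + 2 * (M\<^sub>l * y / \<iota>)) * (3 * \<iota>) = 18 * (\<iota> * (M\<^sub>l * y)) + 6 * (M\<^sub>l * y)"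
        using \<iota> by (simp add: distrib_right)
      moreover have "(24 + 4 * \<iota>) * (M\<^sub>l * y) = 24 * (M\<^sub>l * y) + 4 * (\<iota> * (M\<^sub>l * y))"
        by (simp add: distrib_right)
      ultimately have "(6 * (M\<^sub>l * y) + 2 * (M\<^sub>l * y / \<iota>)) * (3 * \<iota>) \<le> (24 + 4 * \<iota>) * (M\<^sub>l * y)"
        using My by linarith
      then have "6 * (M\<^sub>l * y) + 2 * (M\<^sub>l * y / \<iota>) \<le> (24 + 4 * \<iota>) * (M\<^sub>l * y) / (3 * \<iota>)"
        using \<iota> by (subst pos_le_divide_eq) auto
      then show ?thesis by (simp add: y_def mult_ac)
    qed
    \<comment> \<open>By the bound on the depth, \<open>4 * K\<close> is at most
      \<open>16 * ln n\<close>; and \<open>a1 + a2\<close> equals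
      \<open>(2 + \<beta> / \<rho>) * a2\<close> with \<open>2 \<le> 1 + exp 1\<close>.\<close>
    moreover have "4 * real K * a1 * (1 + x) + 4 * real K * a2 * (1 + x)
        \<le> 50 * sqrt 2 * (1 + exp 1 + \<beta> / \<rho>) * G * \<gamma> * ln (real n) * (1 + x)"
    proof -
      have ln0: "ln (real n) \<ge> 0" using n by simp
      have "(16::real) \<le> 50 * sqrt 2" using real_sqrt_ge_one[of 2] by linarith
      then have "16 * ln (real n) \<le> 50 * sqrt 2 * ln (real n)" using ln0 by (rule mult_right_mono)
      then have k: "4 * real K \<le> 50 * sqrt 2 * ln (real n)" using K(3) by linarith
      have aa: "a1 + a2 \<le> (1 + exp 1 + \<beta> / \<rho>) * a2"
        using a2 exp_ge_add_one_self[of 1] mult_right_mono[of 1 "exp 1" a2] by (simp add: a1_def algebra_simps)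
      have "(4 * real K) * (a1 + a2) \<le> (50 * sqrt 2 * ln (real n)) * ((1 + exp 1 + \<beta> / \<rho>) * a2)"
        by (rule mult_mono[OF k aa]) (use a1 a2 ln0 in auto)
      then have "(4 * real K) * (a1 + a2) * (1 + x) \<le> (50 * sqrt 2 * ln (real n)) * ((1 + exp 1 + \<beta> / \<rho>) * a2) * (1 + x)"
        by (rule mult_right_mono) (use x1 in simp)
      then show ?thesis by (simp add: a2_def algebra_simps)
    qed
    \<comment> \<open>Moving \<open>\<iota> * R\<close> to the left produces the factor
      \<open>1 - \<iota>\<close>.\<close>
    ultimately have "R * (1 - \<iota>) \<le> (1 + \<iota>) * Rs + 4 * a1 * x + 4 * a2 * x
        + 50 * sqrt 2 * (1 + exp 1 + \<beta> / \<rho>) * G * \<gamma> * ln (real n) * (1 + x)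
        + (24 + 4 * \<iota>) * M\<^sub>l / (3 * \<iota> * real n) * x + \<Delta>"
      by (simp add: algebra_simps)
    then have "R \<le> ((1 + \<iota>) * Rs + 4 * a1 * x + 4 * a2 * x
        + 50 * sqrt 2 * (1 + exp 1 + \<beta> / \<rho>) * G * \<gamma> * ln (real n) * (1 + x)
        + (24 + 4 * \<iota>) * M\<^sub>l / (3 * \<iota> * real n) * x + \<Delta>) / (1 - \<iota>)"
      using \<iota> by (subst pos_le_divide_eq) auto
    also have "\<dots> = (1 + \<iota>) / (1 - \<iota>) * Rs + 4 * a1 * x / (1 - \<iota>) + 4 * a2 * x / (1 - \<iota>)
        + 50 * sqrt 2 * (1 + exp 1 + \<beta> / \<rho>) * G * \<gamma> * ln (real n) / (1 - \<iota>) * (1 + x)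
        + (24 + 4 * \<iota>) * M\<^sub>l / (3 * \<iota> * (1 - \<iota>) * real n) * x + 1 / (1 - \<iota>) * \<Delta>"
      by (rule div)
    finally have main: "R - (1 + \<iota>) / (1 - \<iota>) * Rs \<le> 4 * a1 * x / (1 - \<iota>) + 4 * a2 * x / (1 - \<iota>)
        + 50 * sqrt 2 * (1 + exp 1 + \<beta> / \<rho>) * G * \<gamma> * ln (real n) / (1 - \<iota>) * (1 + x)
        + (24 + 4 * \<iota>) * M\<^sub>l / (3 * \<iota> * (1 - \<iota>) * real n) * x + 1 / (1 - \<iota>) * \<Delta>"
      by linarith
    \<comment> \<open>After squaring, 16 has to be at most
      \<open>(1 + 64 * real n * x) / (2 * real n * x)\<close>, which exceeds 32.\<close>
    have sq: "4 * a * x / (1 - \<iota>) \<le> sqrt (a\<^sup>2 * (1 + 64 * real n * x) / (2 * (1 - \<iota>)\<^sup>2 * real n) * x)" for a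
    proof (rule real_le_rsqrt)
      have "(4 * a * x / (1 - \<iota>))\<^sup>2 = a\<^sup>2 * x\<^sup>2 / (1 - \<iota>)\<^sup>2 * 16"
        by (simp add: power_mult_distrib power_divide)
      also have "\<dots> \<le> a\<^sup>2 * x\<^sup>2 / (1 - \<iota>)\<^sup>2 * ((1 + 64 * real n * x) / (2 * real n * x))"
        using n0 x1 by (intro mult_left_mono) (auto simp: field_simps)
      also have "\<dots> = a\<^sup>2 * (1 + 64 * real n * x) / (2 * (1 - \<iota>)\<^sup>2 * real n) * x"
        using n0 x1 by (simp add: power2_eq_square mult_ac)
      finally show "(4 * a * x / (1 - \<iota>))\<^sup>2 \<le> a\<^sup>2 * (1 + 64 * real n * x) / (2 * (1 - \<iota>)\<^sup>2 * real n) * x" .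
    qed
    have s1: "a1\<^sup>2 * (1 + 64 * real n * x) = (1 + \<beta> / \<rho>)\<^sup>2 * G\<^sup>2 * \<gamma>\<^sup>2 * (1 + 64 * real n * x)"
      by (simp add: a1_def a2_def power_mult_distrib mult_ac)
    have s2: "a2\<^sup>2 * (1 + 64 * real n * x) = G\<^sup>2 * \<gamma>\<^sup>2 + 64 * G\<^sup>2 * real n * \<gamma>\<^sup>2 * x"
      by (simp add: a2_def power_mult_distrib algebra_simps)
    show "pop_risk P l V (fst (A S)) - (1 + \<iota>) / (1 - \<iota>) * (INF w\<in>W. pop_risk P l V w)
        \<le> sqrt ((1 + \<beta> / \<rho>)\<^sup>2 * G\<^sup>2 * \<gamma>\<^sup>2 * (1 + 64 * real n * ln (6 / \<zeta>))
                  / (2 * (1 - \<iota>)\<^sup>2 * real n) * ln (6 / \<zeta>))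
          + sqrt ((G\<^sup>2 * \<gamma>\<^sup>2 + 64 * G\<^sup>2 * real n * \<gamma>\<^sup>2 * ln (6 / \<zeta>))
                  / (2 * (1 - \<iota>)\<^sup>2 * real n) * ln (6 / \<zeta>))
          + 50 * sqrt 2 * (1 + exp 1 + \<beta> / \<rho>) * G * \<gamma> * ln (real n) / (1 - \<iota>)
              * ln (6 * exp 1 / \<zeta>)
          + (24 + 4 * \<iota>) * M\<^sub>l / (3 * \<iota> * (1 - \<iota>) * real n) * ln (6 / \<zeta>)
          + 1 / (1 - \<iota>) * strong_pd_emp_risk l n S W V (fst (A S)) (snd (A S))"
      using main sq[of a1] sq[of a2]
      unfolding s1 s2 ws(2) lnx x_def[symmetric] w_def[symmetric] v_def[symmetric] R_def[symmetric] Rs_def[symmetric] \<Delta>_def[symmetric]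
      by linarith
  qed (use E1 E2 in auto)
qed

end
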